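(* Let $f:[1,\infty)\to\mathbb R$ be a function whose germ at $\infty$ belongs to some Hardy field and such that $f(x)\to\infty$ as $x\to\infty$. Suppose that $f$ satisfies the growth condition \[ f(x) \ll (|x|+1)^k \quad \text{for some } k\in\mathbb N, \] and the condition \[ \lim_{x\to\infty} |f(x)-g(x)| = \infty \quad \text{for all } g(x)\in\mathbb Q[x]. \] Then the sequence $[f(n)]$, $n=1,2,\dots$, is an asymptotic basis; that is, there exist positive integers $s$ and $N_0$ such that every integer $N>N_0$ can be written in the form \[ [f(n_1)]+[f(n_2)]+\dots+[f(n_s)] = N \] with $n_1,n_2,\dots,n_s\in\mathbb N$.
   Context: Here $[\theta]$ denotes the integer part of the real number $\theta$, $\mathbb N=\{1,2,3,\dots\}$, and $A\ll B$ means $|A|\le KB$ for some constant $K>0$. Germs and Hardy fields: two real-valued functions, each defined on a neighborhood of $\infty$, are called equivalent if they are equal in some neighborhood of $\infty$; the equivalence classes are called germs. Let $B$ be the ring of all germs of continuous real-valued functions, with pointwise addition and multiplication. A Hardy field is a subring of $B$ which is a field and which is closed with respect to differentiation. Convention: a function from a Hardy field is a priori defined only on a neighborhood of $\infty$; it is regarded as defined on $[1,\infty)$ by replacing $f(x)$ with $f(x+k_0)$ for a sufficiently large constant $k_0$, if necessary. Asymptotic basis: an integer sequence $(a_n)_{n\in\mathbb N}$ is an asymptotic basis if there are positive integers $s$ and $N_0$ such that every integer $N>N_0$ is a sum of exactly $s$ (not necessarily distinct) terms of the sequence. *)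

theory Defs
  imports Complex_Main "HOL-Computational_Algebra.Polynomial" "HOL-Algebra.Subrings"
begin

text \<open>
  Functions that are only defined on a neighbourhood of infinity are modelled by total
  functions. Their values outside the neighbourhood are forgotten when passing to germs.
\<close>

definition germ_eq :: "(real \<Rightarrow> real) \<Rightarrow> (real \<Rightarrow> real) \<Rightarrow> bool" where
  "germ_eq f g \<longleftrightarrow> (\<forall>\<^sub>F x in at_top. f x = g x)"

lemma germ_eq_equivp: "equivp germ_eq"
proof (rule equivpI)
  show "reflp germ_eq"
    by (auto simp: reflp_def germ_eq_def)
  show "symp germ_eq"
    by (auto simp: symp_def germ_eq_def elim: eventually_mono)
  show "transp germ_eq"
    unfolding transp_def germ_eq_def by (auto elim: eventually_elim2)
qed

quotient_type germ = "real \<Rightarrow> real" / germ_eq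
  morphisms rep_germ germ_of
  by (rule germ_eq_equivp)

instantiation germ :: comm_ring_1
begin

lift_definition zero_germ :: germ is "\<lambda>x. 0" .

lift_definition one_germ :: germ is "\<lambda>x. 1" .

lift_definition plus_germ :: "germ \<Rightarrow> germ \<Rightarrow> germ" is "\<lambda>f g x. f x + g x"
  unfolding germ_eq_def by (auto elim: eventually_elim2)

lift_definition minus_germ :: "germ \<Rightarrow> germ \<Rightarrow> germ" is "\<lambda>f g x. f x - g x"
  unfolding germ_eq_def by (auto elim: eventually_elim2)

lift_definition uminus_germ :: "germ \<Rightarrow> germ" is "\<lambda>f x. - f x"
  unfolding germ_eq_def by (auto elim: eventually_mono)

lift_definition times_germ :: "germ \<Rightarrow> germ \<Rightarrow> germ" is "\<lambda>f g x. f x * g x"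
  unfolding germ_eq_def by (auto elim: eventually_elim2)

instance
  by standard (transfer, simp add: germ_eq_def algebra_simps)+

end

lift_definition continuous_germ :: "germ \<Rightarrow> bool"
  is "\<lambda>f. \<exists>a. continuous_on {a<..} f"
proof -
  have *: "\<exists>a. continuous_on {a<..} g"
    if eq: "germ_eq f g" and cont: "\<exists>a. continuous_on {a<..} f" for f g
  proof -
    from eq obtain b where b: "\<And>x. b \<le> x \<Longrightarrow> f x = g x"
      by (auto simp: germ_eq_def eventually_at_top_linorder)
    from cont obtain a where "continuous_on {a<..} f" by blast
    then have "continuous_on {max a b<..} f"
      by (rule continuous_on_subset) auto
    then have "continuous_on {max a b<..} g"
      by (subst continuous_on_cong[OF refl, of _ g f]) (auto simp: b)
    then show ?thesis by blast
  qed
  show "(\<exists>a. continuous_on {a<..} f) = (\<exists>a. continuous_on {a<..} g)"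
    if "germ_eq f g" for f g
    using * that equivp_symp[OF germ_eq_equivp] by blast
qed

lift_definition germ_has_derivative :: "germ \<Rightarrow> germ \<Rightarrow> bool"
  is "\<lambda>f f'. \<forall>\<^sub>F x in at_top. (f has_real_derivative f' x) (at x)"
proof -
  have *: "\<forall>\<^sub>F x in at_top. (g has_real_derivative g' x) (at x)"
    if eq: "germ_eq f g" "germ_eq f' g'"
      and deriv: "\<forall>\<^sub>F x in at_top. (f has_real_derivative f' x) (at x)" for f g f' g'
  proof -
    from eq(1) obtain b where b: "\<And>x. b \<le> x \<Longrightarrow> f x = g x"
      by (auto simp: germ_eq_def eventually_at_top_linorder)
    have "\<forall>\<^sub>F x in at_top. f' x = g' x"
      using eq(2) by (simp add: germ_eq_def)
    with deriv eventually_gt_at_top[of b]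
    show ?thesis
    proof eventually_elim
      case (elim x)
      have "(f has_real_derivative g' x) (at x)"
        using elim by simp
      then show ?case
        using elim(2) b
        by (auto intro: has_field_derivative_transform_within_open[where S = "{b<..}"])
    qed
  qed
  show "(\<forall>\<^sub>F x in at_top. (f has_real_derivative f' x) (at x)) =
        (\<forall>\<^sub>F x in at_top. (g has_real_derivative g' x) (at x))"
    if "germ_eq f g" "germ_eq f' g'" for f g f' g'
    using * that equivp_symp[OF germ_eq_equivp] by blast
qed

definition germ_ring :: "germ ring" where
  "germ_ring = \<lparr>carrier = {g. continuous_germ g}, mult = (*), one = 1, zero = 0, add = (+)\<rparr>"

lemma continuous_germ_0: "continuous_germ 0"
  by transfer (auto intro: continuous_on_const)

lemma continuous_germ_1: "continuous_germ 1"
  by transfer (auto intro: continuous_on_const)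

lemma continuous_germ_uminus: "continuous_germ g \<Longrightarrow> continuous_germ (- g)"
  by transfer (auto intro: continuous_on_minus)

lemma continuous_germ_add:
  "continuous_germ g \<Longrightarrow> continuous_germ h \<Longrightarrow> continuous_germ (g + h)"
proof (transfer, elim exE)
  fix f g :: "real \<Rightarrow> real" and a b
  assume "continuous_on {a<..} f" "continuous_on {b<..} g"
  then have "continuous_on {max a b<..} f" "continuous_on {max a b<..} g"
    by (auto elim!: continuous_on_subset)
  then show "\<exists>a. continuous_on {a<..} (\<lambda>x. f x + g x)"
    by (blast intro: continuous_on_add)
qed

lemma continuous_germ_mult:
  "continuous_germ g \<Longrightarrow> continuous_germ h \<Longrightarrow> continuous_germ (g * h)"
proof (transfer, elim exE)
  fix f g :: "real \<Rightarrow> real" and a b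
  assume "continuous_on {a<..} f" "continuous_on {b<..} g"
  then have "continuous_on {max a b<..} f" "continuous_on {max a b<..} g"
    by (auto elim!: continuous_on_subset)
  then show "\<exists>a. continuous_on {a<..} (\<lambda>x. f x * g x)"
    by (blast intro: continuous_on_mult)
qed

lemma cring_germ_ring: "cring germ_ring"
proof (rule cringI)
  show "abelian_group germ_ring"
  proof (rule abelian_groupI)
    show "\<exists>y\<in>carrier germ_ring. y \<oplus>\<^bsub>germ_ring\<^esub> x = \<zero>\<^bsub>germ_ring\<^esub>"
      if "x \<in> carrier germ_ring" for x
      using that by (intro bexI[of _ "- x"]) (auto simp: germ_ring_def continuous_germ_uminus)
  qed (auto simp: germ_ring_def continuous_germ_0 continuous_germ_add)
  show "comm_monoid germ_ring"
    by (rule comm_monoidI)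
      (auto simp: germ_ring_def continuous_germ_1 continuous_germ_mult)
qed (auto simp: germ_ring_def algebra_simps)

definition hardy_field :: "germ set \<Rightarrow> bool" where
  "hardy_field H \<longleftrightarrow>
     subfield H germ_ring \<and> (\<forall>g\<in>H. \<exists>g'\<in>H. germ_has_derivative g g')"

text \<open>
  Sequences are indexed by the positive integers: the value \<open>a 0\<close> plays no role.
\<close>

definition asymptotic_basis :: "(nat \<Rightarrow> int) \<Rightarrow> bool" where
  "asymptotic_basis a \<longleftrightarrow>
     (\<exists>s\<ge>1. \<exists>N\<^sub>0\<ge>1. \<forall>N>N\<^sub>0.
        \<exists>n :: nat \<Rightarrow> nat. (\<forall>i\<in>{1..s}. n i \<ge> 1) \<and> (\<Sum>i=1..s. a (n i)) = N)"

end

theory Submission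
  imports Defs "HOL-Analysis.Kronecker_Approximation_Theorem"
begin

text \<open>
  Let \<open>A\<close> be the set of values \<open>\<lfloor>f n\<rfloor>\<close>, translated so that its minimum is 0. By Schnirelmann's theorem
  it suffices that \<open>A\<close> has no common divisor and that the set of sums of \<open>r\<close> elements of \<open>A\<close> has
  positive lower density for some \<open>r\<close>.

  Comparability of germs in a Hardy field shows that either \<open>f' \<longrightarrow> 0\<close>, in which case \<open>\<lfloor>f n\<rfloor>\<close> takes all
  large values, or on suitable progressions \<open>X + q y\<close> with \<open>y \<le> X powr \<eta>\<close> the function \<open>f\<close> is up to \<open>O(1)\<close> a
  polynomial in \<open>y\<close> whose leading coefficient is bounded away from 0 and infinity. A mean value bound
  for Vinogradov's system with many variables (with the exact order of magnitude) yields tuples \<open>y\<close>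
  for which the power sums below the top degree \<open>k\<close> are fixed while the top power sums fill a positive
  proportion of an interval of length \<open>H ^ k\<close>; this makes the sums of values of \<open>f\<close> fill a positive proportion of an
  interval of length a power of \<open>X\<close>. Translating these sets by greedily chosen sums of elements of \<open>A\<close>
  gives positive density.

  A common divisor \<open>d\<close> of \<open>A\<close> is excluded by Weyl's inequality: after subtracting a rational polynomial,
  which is periodic modulo \<open>d\<close>, the leading coefficient on the progressions can be taken irrational.
\<close>

section \<open>Schnirelmann density\<close>

text \<open>The lower coefficients of the local polynomials are uncontrolled, so sums of values of
  \<open>f\<close> can be compared only between tuples whose lower power sums coincide. Fixing those
  sums costs the full factor \<open>H ^ (1 + ... + (k - 1))\<close>; a positive proportion survives
  only if the number of power sum vectors has the exact order \<open>H ^ (1 + ... + k)\<close>. Even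
  a loss of \<open>H powr \<epsilon>\<close> would be fatal. Hence every estimate for exponential
  sums is stated for sums of size at least \<open>H / t\<close>, with bounds polynomial in
  \<open>t\<close> and uniform in \<open>H\<close>; a moment of sufficiently high order is then
  bounded without loss.

  The sets of sums so obtained lie in windows that may be short compared with their height.
  Spreading them out is possible because \<open>f powr (1 / (D + 1))\<close> increases by at most 1
  per step: subtracting a nearly maximal value leaves a remainder of smaller exponent, and finitely
  many repetitions make the remainder shorter than a window.

  Stretching a progression serves two ends. It compensates a Taylor coefficient that tends to 0, and
  it allows the leading coefficient to be prescribed, in particular as an irrational number.\<close>

definition sumset :: "nat set \<Rightarrow> nat set \<Rightarrow> nat set" where
  "sumset A B = {x + y | x y. x \<in> A \<and> y \<in> B}"

definition dens_ge :: "nat set \<Rightarrow> real \<Rightarrow> bool" where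
  "dens_ge A \<alpha> \<longleftrightarrow> (\<forall>n. \<alpha> * real n \<le> real (card (A \<inter> {1..n})))"

lemma dens_ge_le_1: "dens_ge A \<alpha> \<Longrightarrow> \<alpha> \<le> 1"
proof -
  assume "dens_ge A \<alpha>"
  then have "\<alpha> * real 1 \<le> real (card (A \<inter> {1..1}))"
    unfolding dens_ge_def by blast
  also have "card (A \<inter> {1..1}) \<le> card {1::nat..1}"
    by (rule card_mono) auto
  finally show ?thesis by simp
qed

text \<open>Between consecutive elements of \<open>A\<close> the sumset contains a translate of an
  initial piece of \<open>B\<close>. The claim \<open>key\<close> is the form that induction on
  \<open>n\<close> supports, with the actual count of \<open>A\<close> in place of its lower bound;
  that bound is inserted only at the end, where \<open>\<beta> \<le> 1\<close> makes the expression
  monotone in the count.\<close>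

lemma schnirelmann_inequality:
  assumes A0: "0 \<in> A" and B0: "0 \<in> B" and A: "dens_ge A \<alpha>" and B: "dens_ge B \<beta>"
  shows "dens_ge (sumset A B) (\<alpha> + \<beta> - \<alpha> * \<beta>)"
proof -
  let ?C = "sumset A B"
  have sub: "A \<subseteq> ?C" using B0 unfolding sumset_def by force
  have b1: "\<beta> \<le> 1" using dens_ge_le_1[OF B] .
  have key: "real (card (A \<inter> {1..n})) + \<beta> * (real n - real (card (A \<inter> {1..n}))) \<le> real (card (?C \<inter> {1..n}))" for n
  proof (induction n rule: less_induct)
    case (less n)
    show ?case
    proof (cases "n = 0")
      case True then show ?thesis by simp
    next
      case n0: False
      show ?thesis
      proof (cases "n \<in> A")
        case True
        have e: "{1..n} = insert n {1..n-1}" using n0 by auto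
        have a: "card (A \<inter> {1..n}) = Suc (card (A \<inter> {1..n-1}))"
          unfolding e using True n0 by (subst Int_insert_right_if1) auto
        have c: "card (?C \<inter> {1..n}) = Suc (card (?C \<inter> {1..n-1}))"
          unfolding e using True sub n0 by (subst Int_insert_right_if1) auto
        \<comment> \<open>Passing from \<open>n - 1\<close> to \<open>n\<close> adds one to both
          counts and leaves the number of non-elements of \<open>A\<close> unchanged.\<close>
        show ?thesis using less.IH[of "n-1"] n0 unfolding a c by (simp add: of_nat_diff algebra_simps)
      next
        case False
        define a where "a = Max (A \<inter> {0..n})"
        have fin: "finite (A \<inter> {0..n})" and ne: "A \<inter> {0..n} \<noteq> {}" using A0 by auto
        have aA: "a \<in> A \<inter> {0..n}" unfolding a_def by (rule Max_in[OF fin ne])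
        then have an: "a < n" using False by (cases "a = n") auto
        have up: "x \<le> a" if "x \<in> A" "x \<le> n" for x
          unfolding a_def using that by (intro Max_ge[OF fin]) auto
        have A_eq: "A \<inter> {1..n} = A \<inter> {1..a}" using up an by fastforce
        have inj: "inj_on (\<lambda>b. a + b) (B \<inter> {1..n-a})" by (auto simp: inj_on_def)
        \<comment> \<open>The gap after \<open>a\<close> is free of \<open>A\<close>, and the
          translate of \<open>B\<close> by \<open>a\<close> fills it with density at least
          \<open>\<beta>\<close>.\<close>
        have "(?C \<inter> {1..a}) \<union> (\<lambda>b. a + b) ` (B \<inter> {1..n-a}) \<subseteq> ?C \<inter> {1..n}"
          using aA an unfolding sumset_def by auto
        then have "card ((?C \<inter> {1..a}) \<union> (\<lambda>b. a + b) ` (B \<inter> {1..n-a})) \<le> card (?C \<inter> {1..n})"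
          by (intro card_mono) auto
        moreover have "card ((?C \<inter> {1..a}) \<union> (\<lambda>b. a + b) ` (B \<inter> {1..n-a})) = card (?C \<inter> {1..a}) + card (B \<inter> {1..n-a})"
          by (subst card_Un_disjoint) (auto simp: card_image)
        moreover have "\<beta> * real (n - a) \<le> real (card (B \<inter> {1..n-a}))"
          using B unfolding dens_ge_def by blast
        moreover note less.IH[OF an]
        ultimately show ?thesis unfolding A_eq using an by (simp add: of_nat_diff algebra_simps)
      qed
    qed
  qed
  show ?thesis unfolding dens_ge_def
  proof
    fix n
    have "\<alpha> * real n \<le> real (card (A \<inter> {1..n}))" using A unfolding dens_ge_def by blast
    then have "(1 - \<beta>) * (\<alpha> * real n) \<le> (1 - \<beta>) * real (card (A \<inter> {1..n}))"
      using b1 by (intro mult_left_mono) auto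
    then show "(\<alpha> + \<beta> - \<alpha> * \<beta>) * real n \<le> real (card (?C \<inter> {1..n}))"
      using key[of n] by (simp add: algebra_simps)
  qed
qed

text \<open>Pigeonhole: \<open>A\<close> and its reflection under \<open>n - a\<close> each have at
  least \<open>1 + n / 2\<close> elements among the \<open>n + 1\<close> numbers up to
  \<open>n\<close>, so they meet. The element 0 supplies the extra 1.\<close>

lemma dens_half_covers:
  assumes A0: "0 \<in> A" and A: "dens_ge A (1/2)"
  shows "n \<in> sumset A A"
proof (rule ccontr)
  assume n: "n \<notin> sumset A A"
  let ?X = "A \<inter> {0..n}" and ?Y = "(\<lambda>a. n - a) ` (A \<inter> {0..n})"
  have card: "real (card ?X) \<ge> 1 + real n / 2"
  proof -
    have "?X = insert 0 (A \<inter> {1..n})" using A0 by auto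
    then have "card ?X = Suc (card (A \<inter> {1..n}))" by simp
    then show ?thesis using A unfolding dens_ge_def by (simp add: field_simps)
  qed
  have inj: "inj_on (\<lambda>a. n - a) ?X" by (auto simp: inj_on_def)
  have "?X \<inter> ?Y = {}"
  proof (rule ccontr)
    assume "?X \<inter> ?Y \<noteq> {}"
    then obtain x where "x \<in> ?X" "x \<in> ?Y" by blast
    then obtain y where "x \<in> A" "y \<in> A" "y \<le> n" "x = n - y" by (elim imageE) auto
    then have "n = x + y" by simp
    then show False using n \<open>x \<in> A\<close> \<open>y \<in> A\<close> unfolding sumset_def by blast
  qed
  then have "card (?X \<union> ?Y) = card ?X + card ?X"
    by (subst card_Un_disjoint) (auto simp: card_image[OF inj])
  moreover have "card (?X \<union> ?Y) \<le> card {0..n}" by (rule card_mono) auto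
  ultimately have "2 * card ?X \<le> n + 1" by simp
  then have "2 * real (card ?X) \<le> real n + 1" by linarith
  then show False using card by simp
qed

section \<open>Sums with a prescribed number of summands\<close>

definition sums_of :: "nat \<Rightarrow> nat set \<Rightarrow> nat set" where
  "sums_of t A = {sum_list xs | xs. length xs = t \<and> set xs \<subseteq> A}"

lemma sums_of_add: "sumset (sums_of s A) (sums_of t A) = sums_of (s + t) A"
proof (intro equalityI subsetI)
  fix x assume "x \<in> sumset (sums_of s A) (sums_of t A)"
  then obtain xs ys where "x = sum_list xs + sum_list ys" "length xs = s" "set xs \<subseteq> A" "length ys = t" "set ys \<subseteq> A"
    unfolding sumset_def sums_of_def by auto
  then show "x \<in> sums_of (s + t) A" unfolding sums_of_def
    by (intro CollectI exI[of _ "xs @ ys"]) auto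
next
  fix x assume "x \<in> sums_of (s + t) A"
  then obtain xs where xs: "x = sum_list xs" "length xs = s + t" "set xs \<subseteq> A"
    unfolding sums_of_def by auto
  have "x = sum_list (take s xs) + sum_list (drop s xs)"
    using xs by (metis append_take_drop_id sum_list_append)
  moreover have "sum_list (take s xs) \<in> sums_of s A"
    unfolding sums_of_def using xs set_take_subset[of s xs]
    by (intro CollectI exI[of _ "take s xs"]) auto
  moreover have "sum_list (drop s xs) \<in> sums_of t A"
    unfolding sums_of_def using xs set_drop_subset[of s xs]
    by (intro CollectI exI[of _ "drop s xs"]) auto
  ultimately show "x \<in> sumset (sums_of s A) (sums_of t A)" unfolding sumset_def by blast
qed

lemma sums_of_addI: "x \<in> sums_of s A \<Longrightarrow> y \<in> sums_of t A \<Longrightarrow> x + y \<in> sums_of (s + t) A"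
  using sums_of_add[of s A t] unfolding sumset_def by blast

lemma zero_in_sums_of: "0 \<in> A \<Longrightarrow> 0 \<in> sums_of t A"
  unfolding sums_of_def by (intro CollectI exI[of _ "replicate t 0"]) (auto simp: sum_list_replicate)

lemma sums_of_mono: "0 \<in> A \<Longrightarrow> s \<le> t \<Longrightarrow> sums_of s A \<subseteq> sums_of t A"
  using sums_of_addI[OF _ zero_in_sums_of, of _ s A "t - s"] by auto

lemma sums_of_1: "sums_of (Suc 0) A = A"
proof (intro equalityI subsetI)
  fix x assume "x \<in> A"
  then show "x \<in> sums_of (Suc 0) A" unfolding sums_of_def by (intro CollectI exI[of _ "[x]"]) auto
qed (auto simp: sums_of_def length_Suc_conv)

lemma sums_of_set_subset: "x \<in> sums_of s (sums_of t A) \<Longrightarrow> x \<in> sums_of (s * t) A"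
proof (induction s arbitrary: x)
  case 0 then show ?case by (auto simp: sums_of_def)
next
  case (Suc s)
  have "x \<in> sumset (sums_of (Suc 0) (sums_of t A)) (sums_of s (sums_of t A))"
    using Suc.prems by (simp add: sums_of_add)
  then obtain y z where "x = y + z" "y \<in> sums_of t A" "z \<in> sums_of s (sums_of t A)"
    unfolding sumset_def sums_of_1 by blast
  then show ?case using Suc.IH[of z] sums_of_addI[of y t A z] by simp
qed

text \<open>The Schnirelmann inequality says that the deficits \<open>1 - \<alpha>\<close> multiply.
  The deficit of an iterated sum therefore decays geometrically, and once it is at most 1/2 one
  doubling covers every number.\<close>

lemma schnirelmann_basis:
  assumes A0: "0 \<in> A" and A: "dens_ge A \<alpha>" and pos: "\<alpha> > 0"
  obtains h where "\<And>n. n \<in> sums_of h A"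
proof -
  have a1: "\<alpha> \<le> 1" using dens_ge_le_1[OF A] .
  have d: "dens_ge (sums_of (Suc h) A) (1 - (1 - \<alpha>) ^ Suc h)" for h
  proof (induction h)
    case 0 then show ?case using A by (simp add: sums_of_1)
  next
    case (Suc h)
    have "dens_ge (sumset (sums_of (Suc 0) A) (sums_of (Suc h) A)) (\<alpha> + (1 - (1 - \<alpha>) ^ Suc h) - \<alpha> * (1 - (1 - \<alpha>) ^ Suc h))"
      by (rule schnirelmann_inequality) (use A0 A Suc zero_in_sums_of sums_of_1 in auto)
    then show ?case by (simp add: sums_of_add algebra_simps)
  qed
  obtain h where h: "(1 - \<alpha>) ^ h < 1/2" using real_arch_pow_inv[of "1/2" "1 - \<alpha>"] pos by auto
  have "(1 - \<alpha>) ^ Suc h \<le> 1/2"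
  proof -
    have "(1 - \<alpha>) ^ Suc h \<le> (1 - \<alpha>) ^ h" using pos a1 by (intro power_decreasing) auto
    then show ?thesis using h by simp
  qed
  then have "1/2 * real n \<le> (1 - (1 - \<alpha>) ^ Suc h) * real n" for n
    by (intro mult_right_mono) auto
  then have "dens_ge (sums_of (Suc h) A) (1/2)"
    using d[of h] order_trans unfolding dens_ge_def by blast
  then have "n \<in> sums_of (Suc h + Suc h) A" for n
    using dens_half_covers[OF zero_in_sums_of[OF A0]] sums_of_add by blast
  then show ?thesis using that by blast
qed

text \<open>Differences of two sums with the same number of summands form a subgroup of the
  integers, and \<open>0 \<in> A\<close> places \<open>A\<close> itself inside it. The least
  positive element divides every element of \<open>A\<close>, hence equals 1.\<close>

lemma sums_of_consecutive:
  assumes A0: "0 \<in> A" and gcd: "\<And>d. d \<ge> 2 \<Longrightarrow> \<exists>a\<in>A. \<not> d dvd a"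
  obtains t c where "c \<in> sums_of t A" "Suc c \<in> sums_of t A"
proof -
  define D where "D = {int x - int y | x y t. x \<in> sums_of t A \<and> y \<in> sums_of t A}"
  have Ddiff: "u - v \<in> D" if uv: "u \<in> D" "v \<in> D" for u v
  proof -
    obtain x y t where 1: "u = int x - int y" "x \<in> sums_of t A" "y \<in> sums_of t A"
      using uv(1) unfolding D_def by blast
    obtain x' y' t' where 2: "v = int x' - int y'" "x' \<in> sums_of t' A" "y' \<in> sums_of t' A"
      using uv(2) unfolding D_def by blast
    have "x + y' \<in> sums_of (t + t') A" using sums_of_addI 1 2 by blast
    moreover have "y + x' \<in> sums_of (t + t') A" using sums_of_addI 1 2 by blast
    moreover have "u - v = int (x + y') - int (y + x')" using 1 2 by simp
    ultimately show ?thesis unfolding D_def by blast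
  qed
  have AD: "int a \<in> D" if "a \<in> A" for a
    unfolding D_def using that A0 sums_of_1[of A] by (intro CollectI exI[of _ a] exI[of _ 0] exI[of _ "Suc 0"]) auto
  have Dmult: "int n * u \<in> D" if "u \<in> D" for u n
  proof (induction n)
    case 0 show ?case using AD[OF A0] by simp
  next
    case (Suc n)
    have "0 - u \<in> D" using Ddiff[OF AD[OF A0] that] by simp
    from Ddiff[OF Suc this] show ?case by (simp add: algebra_simps)
  qed
  obtain a0 where a0: "a0 \<in> A" "a0 > 0" using gcd[of 2] by (metis dvd_0_right gr0I order_refl)
  define d where "d = (LEAST d. d > 0 \<and> int d \<in> D)"
  have d: "d > 0" "int d \<in> D"
    using LeastI[of "\<lambda>d. d > 0 \<and> int d \<in> D" a0] a0 AD unfolding d_def by auto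
  have least: "d \<le> e" if "e > 0" "int e \<in> D" for e
    unfolding d_def using that by (intro Least_le) auto
  have "d = 1"
  proof (rule ccontr)
    assume "d \<noteq> 1"
    then obtain a where a: "a \<in> A" "\<not> d dvd a" using gcd[of d] d by auto
    have "int a - int (a div d) * int d \<in> D" using Ddiff[OF AD[OF a(1)] Dmult[OF d(2)]] .
    moreover have "int a - int (a div d) * int d = int (a mod d)"
      by (metis minus_mult_div_eq_mod mult.commute of_nat_mult of_nat_mod zdiv_int)
    ultimately have "int (a mod d) \<in> D" by simp
    moreover have "a mod d > 0" using a(2) by (simp add: dvd_eq_mod_eq_0)
    ultimately show False using least[of "a mod d"] mod_less_divisor[OF d(1), of a] by linarith
  qed
  then obtain x y t where "1 = int x - int y" "x \<in> sums_of t A" "y \<in> sums_of t A"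
    using d(2) unfolding D_def by auto
  moreover from this have "x = Suc y" by linarith
  ultimately show ?thesis using that by blast
qed

text \<open>Density for large \<open>N\<close> does not suffice for Schnirelmann's theorem, which
  also needs the element 1. Adding either of two consecutive sums \<open>c\<close>,
  \<open>Suc c\<close> to the sums of \<open>r\<close> elements and shifting back by
  \<open>c\<close> gives a set \<open>B\<close> that contains both 0 and 1.\<close>

lemma basis_of_positive_density:
  assumes A0: "0 \<in> A" and gcd: "\<And>d. d \<ge> 2 \<Longrightarrow> \<exists>a\<in>A. \<not> d dvd a"
    and pos: "\<delta> > 0" and dens: "\<And>N. N \<ge> N0 \<Longrightarrow> \<delta> * real N \<le> real (card (sums_of r A \<inter> {0..N}))"
  obtains h M where "h \<ge> 1" "\<And>N. N \<ge> M \<Longrightarrow> N \<in> sums_of h A"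
proof -
  obtain t c where c: "c \<in> sums_of t A" "Suc c \<in> sums_of t A"
    using sums_of_consecutive[OF A0 gcd] .
  define B where "B = {x. x + c \<in> sums_of (r + t) A}"
  have sub: "sums_of r A \<subseteq> B" "Suc ` sums_of r A \<subseteq> B"
    unfolding B_def using sums_of_addI[of _ r A] c by force+
  have B0: "0 \<in> B" "1 \<in> B" using sub zero_in_sums_of[OF A0, of r] by auto
  \<comment> \<open>From \<open>N1\<close> on, half of the density absorbs the loss of the element
    0; below \<open>N1\<close> the single element 1 yields density \<open>1 / N1\<close>.\<close>
  define N1 where "N1 = max (nat \<lceil>2 / \<delta>\<rceil>) (max 1 N0)"
  define \<alpha> where "\<alpha> = min (\<delta> / 2) (1 / real N1)"
  have N1: "N1 \<ge> 1" "N1 \<ge> N0" "2 / \<delta> \<le> real N1" unfolding N1_def by linarith+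
  have "dens_ge B \<alpha>" unfolding dens_ge_def
  proof
    fix n
    show "\<alpha> * real n \<le> real (card (B \<inter> {1..n}))"
    proof (cases "n \<ge> N1")
      case True
      have "\<delta> * real n \<le> real (card (sums_of r A \<inter> {0..n}))" using dens[of n] True N1 by simp
      also have "card (sums_of r A \<inter> {0..n}) \<le> card (insert 0 (B \<inter> {1..n}))"
        using sub by (intro card_mono) auto
      also have "\<dots> \<le> card (B \<inter> {1..n}) + 1" by (simp add: card_insert_if)
      finally have "\<delta> * real n - 1 \<le> real (card (B \<inter> {1..n}))" by simp
      moreover have "2 \<le> \<delta> * real n" 
      proof -
        have "2 / \<delta> \<le> real n" using True N1 by linarith
        then show ?thesis using pos by (simp add: field_simps)
      qed
      moreover have "\<alpha> * real n \<le> \<delta> / 2 * real n" unfolding \<alpha>_def by (intro mult_right_mono) auto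
      ultimately show ?thesis by simp
    next
      case False
      show ?thesis
      proof (cases "n = 0")
        case True then show ?thesis by simp
      next
        case n: False
        have "\<alpha> * real n \<le> 1 / real N1 * real n" unfolding \<alpha>_def by (intro mult_right_mono) auto
        also have "\<dots> \<le> 1" using False N1 by (simp add: field_simps)
        also have "1 \<le> real (card (B \<inter> {1..n}))"
        proof -
          have "card {1::nat} \<le> card (B \<inter> {1..n})" using B0 n by (intro card_mono) auto
          then show ?thesis by simp
        qed
        finally show ?thesis .
      qed
    qed
  qed
  moreover have "\<alpha> > 0" unfolding \<alpha>_def using pos N1 by simp
  ultimately obtain h where h: "\<And>n. n \<in> sums_of h B" using schnirelmann_basis B0 by blast
  have shift: "sum_list xs + length xs * c = sum_list (map (\<lambda>x. x + c) xs)" for xs :: "nat list"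
    by (induction xs) auto
  have "N + h * c \<in> sums_of (h * (r + t)) A" for N
  proof -
    obtain xs where xs: "N = sum_list xs" "length xs = h" "set xs \<subseteq> B" using h[of N] unfolding sums_of_def by auto
    have "N + h * c = sum_list (map (\<lambda>x. x + c) xs)" using shift xs by metis
    then have "N + h * c \<in> sums_of h (sums_of (r + t) A)"
      unfolding sums_of_def[of h] using xs unfolding B_def by (intro CollectI exI[of _ "map (\<lambda>x. x + c) xs"]) auto
    then show ?thesis by (rule sums_of_set_subset)
  qed
  then have "N \<in> sums_of (h * (r + t)) A" if "N \<ge> h * c" for N
    using that by (metis le_add_diff_inverse2)
  \<comment> \<open>A further summand 0 makes the number of summands positive.\<close>
  then have "N \<in> sums_of (Suc (h * (r + t))) A" if "N \<ge> h * c" for N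
    using sums_of_mono[OF A0, of "h * (r + t)" "Suc (h * (r + t))"] that by auto
  then show ?thesis by (intro that[of "Suc (h * (r + t))" "h * c"]) auto
qed

section \<open>Weyl sums\<close>

definition ee :: "real \<Rightarrow> complex" where "ee x = cis (2 * pi * x)"

lemma norm_ee [simp]: "norm (ee x) = 1"
  by (simp add: ee_def)

lemma ee_add: "ee (x + y) = ee x * ee y"
  by (simp add: ee_def cis_mult distrib_left)

lemma ee_0 [simp]: "ee 0 = 1"
  by (simp add: ee_def)

lemma cnj_ee: "cnj (ee x) = ee (- x)"
  by (simp add: ee_def cis_cnj)

lemma ee_diff: "ee (x - y) = ee x * cnj (ee y)"
  using ee_add[of x "- y"] by (simp add: cnj_ee)

lemma ee_of_int [simp]: "ee (of_int n) = 1"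
  using cis_multiple_2pi[of "of_int n"] by (simp add: ee_def Ints_of_int)

lemma ee_sum: "finite A \<Longrightarrow> ee (\<Sum>i\<in>A. f i) = (\<Prod>i\<in>A. ee (f i))"
  by (induction A rule: finite_induct) (auto simp: ee_add)

lemma ee_eq_of_int_diff: "x - y = of_int n \<Longrightarrow> ee x = ee y"
  using ee_add[of y "of_int n"] by (simp add: algebra_simps)

lemma norm_ee_minus_one: "norm (ee r - 1) = 2 * \<bar>sin (pi * r)\<bar>"
proof -
  have "(norm (ee r - 1))\<^sup>2 = (cos (2 * (pi * r)) - 1)\<^sup>2 + (sin (2 * (pi * r)))\<^sup>2"
    by (simp add: ee_def cmod_power2 mult.assoc)
  also have "\<dots> = 2 - 2 * cos (2 * (pi * r))"
    using sin_cos_squared_add[of "2 * (pi * r)"] by (simp add: power2_eq_square algebra_simps)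
  also have "\<dots> = (2 * sin (pi * r))\<^sup>2"
    by (simp add: cos_double_sin power2_eq_square)
  finally show ?thesis
    by (metis abs_mult abs_norm_cancel abs_numeral power2_eq_iff_nonneg abs_ge_zero power2_abs norm_ge_zero)
qed

lemma norm_ee_diff_le: "norm (ee x - ee y) \<le> 2 * pi * \<bar>x - y\<bar>"
proof -
  have "ee x - ee y = ee y * (ee (x - y) - 1)" using ee_add[of y "x - y"] by (simp add: algebra_simps)
  then have "norm (ee x - ee y) = 2 * \<bar>sin (pi * (x - y))\<bar>" by (simp add: norm_mult norm_ee_minus_one)
  also have "\<dots> \<le> 2 * \<bar>pi * (x - y)\<bar>" using abs_sin_x_le_abs_x[of "pi * (x - y)"] by simp
  also have "\<dots> = 2 * pi * \<bar>x - y\<bar>" by (simp add: abs_mult)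
  finally show ?thesis .
qed

text \<open>A chord of the unit circle dominates the distance of its parameter to the nearest
  integer. The constant 1 is not sharp, so crude bounds for the sine suffice: slope at least 1/2 on
  the first third of the half circle, value at least 1/2 between \<open>pi / 6\<close> and
  \<open>pi / 2\<close>.\<close>

lemma norm_ee_minus_one_ge: "\<bar>x - of_int (round x)\<bar> \<le> norm (ee x - 1)"
proof -
  define r where "r = x - of_int (round x)"
  have r: "\<bar>r\<bar> \<le> 1/2" unfolding r_def using of_int_round_abs_le[of x] by (simp add: abs_minus_commute)
  have "ee x = ee r" by (rule ee_eq_of_int_diff[of _ _ "round x"]) (simp add: r_def)
  have "\<bar>r\<bar> \<le> 2 * \<bar>sin (pi * r)\<bar>"
  proof -
    define s where "s = \<bar>r\<bar>"
    have s: "0 \<le> s" "s \<le> 1/2" using r by (auto simp: s_def)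
    have "\<bar>sin (pi * r)\<bar> = \<bar>sin (pi * s)\<bar>" unfolding s_def by (cases "r \<ge> 0") auto
    moreover have "s \<le> 2 * sin (pi * s)"
    proof (cases "s \<le> 1/6")
      case True
      have "cos (pi/3) \<le> cos t" if "0 \<le> t" "t \<le> pi/3" for t :: real
        using that pi_gt_zero by (intro cos_monotone_0_pi_le) auto
      then have c: "cos t \<ge> 1/2" if "0 \<le> t" "t \<le> pi/3" for t :: real
        using that by (simp add: cos_60)
      have ps: "pi * s \<le> pi / 3" using True by simp
      have "sin 0 - 0 / 2 \<le> sin (pi * s) - (pi * s) / 2"
      proof (rule DERIV_nonneg_imp_nondecreasing[of 0 "pi * s" "\<lambda>t. sin t - t / 2"])
        show "0 \<le> pi * s" using s by simp
        fix t assume "0 \<le> t" "t \<le> pi * s"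
        then have "cos t \<ge> 1/2" using c[of t] ps by linarith
        then show "\<exists>y. ((\<lambda>t. sin t - t / 2) has_real_derivative y) (at t) \<and> 0 \<le> y"
          by (intro exI[of _ "cos t - 1/2"]) (auto intro!: derivative_eq_intros)
      qed
      then have "pi * s \<le> 2 * sin (pi * s)" by simp
      moreover have "1 * s \<le> pi * s" using s pi_gt3 by (intro mult_right_mono) auto
      ultimately show ?thesis by simp
    next
      case False
      have "sin (pi / 6) \<le> sin (pi * s)" using False s pi_gt_zero by (intro sin_monotone_2pi_le) (auto simp: field_simps)
      then show ?thesis using s by (simp add: sin_30)
    qed
    ultimately show ?thesis unfolding s_def by linarith
  qed
  then show ?thesis using \<open>ee x = ee r\<close> norm_ee_minus_one[of r] by (simp add: r_def)
qed

text \<open>\<open>phase k \<theta> \<phi>\<close> encodes through iterated differences that \<open>\<phi>\<close> is a polynomial of degree at most \<open>k\<close>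
  whose coefficient of \<open>y ^ k\<close> is \<open>\<theta>\<close>. The lower coefficients are left unconstrained.\<close>

fun phase :: "nat \<Rightarrow> real \<Rightarrow> (int \<Rightarrow> real) \<Rightarrow> bool" where
  "phase 0 \<theta> \<phi> = (\<forall>y. \<phi> y = \<theta>)"
| "phase (Suc k) \<theta> \<phi> = (\<forall>h. phase k (real (Suc k) * of_int h * \<theta>) (\<lambda>y. \<phi> (y + h) - \<phi> y))"

lemma phase_poly: "phase k (c k) (\<lambda>y. \<Sum>j\<le>k. c j * of_int y ^ j)"
proof (induction k arbitrary: c)
  case 0 show ?case by simp
next
  case (Suc k)
  show ?case unfolding phase.simps
  proof
    fix h :: int
    define d where "d = (\<lambda>i. \<Sum>j\<in>{i<..Suc k}. c j * real (j choose i) * of_int h ^ (j - i))"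
    have "(\<Sum>j\<le>Suc k. c j * of_int (y + h) ^ j) - (\<Sum>j\<le>Suc k. c j * of_int y ^ j) = (\<Sum>i\<le>k. d i * of_int y ^ i)" for y
    proof -
      have bin: "of_int (y + h) ^ j - of_int y ^ j = (\<Sum>i<j. real (j choose i) * of_int h ^ (j - i) * (of_int y :: real) ^ i)" for j
      proof -
        have "(of_int (y + h) :: real) ^ j = (\<Sum>i\<le>j. real (j choose i) * of_int y ^ i * of_int h ^ (j - i))"
          by (simp add: binomial_ring)
        also have "{..j} = insert j {..<j}" by auto
        finally show ?thesis by (simp add: algebra_simps)
      qed
      have "(\<Sum>j\<le>Suc k. c j * of_int (y + h) ^ j) - (\<Sum>j\<le>Suc k. c j * of_int y ^ j)
          = (\<Sum>j\<le>Suc k. c j * (of_int (y + h) ^ j - of_int y ^ j))"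
        by (simp add: sum_subtractf right_diff_distrib)
      also have "\<dots> = (\<Sum>j\<le>Suc k. \<Sum>i<j. c j * real (j choose i) * of_int h ^ (j - i) * of_int y ^ i)"
        unfolding bin by (simp add: sum_distrib_left mult.assoc)
      also have "\<dots> = (\<Sum>j\<le>Suc k. \<Sum>i\<in>{i\<in>{..k}. i < j}. c j * real (j choose i) * of_int h ^ (j - i) * of_int y ^ i)"
        by (intro sum.cong refl) auto
      also have "\<dots> = (\<Sum>i\<le>k. \<Sum>j\<in>{j\<in>{..Suc k}. i < j}. c j * real (j choose i) * of_int h ^ (j - i) * of_int y ^ i)"
        by (rule sum.swap_restrict) auto
      also have "\<dots> = (\<Sum>i\<le>k. d i * of_int y ^ i)"
        unfolding d_def sum_distrib_right by (intro sum.cong refl) auto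
      finally show ?thesis .
    qed
    moreover have "d k = real (Suc k) * of_int h * c (Suc k)"
    proof -
      have "{k<..Suc k} = {Suc k}" by auto
      then show ?thesis unfolding d_def by simp
    qed
    ultimately show "phase k (real (Suc k) * of_int h * c (Suc k)) (\<lambda>y. (\<Sum>j\<le>Suc k. c j * of_int (y + h) ^ j) - (\<Sum>j\<le>Suc k. c j * of_int y ^ j))"
      using Suc.IH[of d] by simp
  qed
qed

lemma geometric_phase_sum:
  assumes "a \<le> b" and \<phi>: "\<And>y. \<phi> (y + 1) - \<phi> y = \<theta>"
  shows "(ee \<theta> - 1) * (\<Sum>y\<in>{a..<b::int}. ee (\<phi> y)) = ee (\<phi> b) - ee (\<phi> a)"
  using assms(1)
proof (induction b rule: int_ge_induct)
  case base show ?case by simp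
next
  case (step b)
  have "{a..<b + 1} = insert b {a..<b}" using step by auto
  moreover have "ee (\<phi> (b + 1)) = ee \<theta> * ee (\<phi> b)"
    using \<phi>[of b] ee_add[of \<theta> "\<phi> b"] by (simp add: algebra_simps)
  ultimately show ?case using step.IH by (simp add: algebra_simps)
qed

text \<open>Expanding the square and writing one variable as \<open>y + h\<close> gives a sum over
  shifts. For a polynomial phase, each inner sum has a phase of degree lower by one.\<close>

lemma van_der_corput:
  fixes z :: "int \<Rightarrow> complex"
  assumes len: "b - a \<le> int H"
  shows "(norm (\<Sum>y\<in>{a..<b}. z y))\<^sup>2
    \<le> (\<Sum>h\<in>{- int H<..<int H}. norm (\<Sum>y\<in>{max a (a - h)..<min b (b - h)}. z (y + h) * cnj (z y)))"
proof -
  let ?I = "{a..<b}" and ?D = "{- int H<..<int H}"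
  have "complex_of_real ((norm (\<Sum>y\<in>?I. z y))\<^sup>2) = (\<Sum>y\<in>?I. z y) * cnj (\<Sum>y\<in>?I. z y)"
    using complex_norm_square by blast
  also have "\<dots> = (\<Sum>y\<in>?I. \<Sum>y'\<in>?I. z y' * cnj (z y))"
    by (simp add: cnj_sum sum_product) (rule sum.swap)
  also have "\<dots> = (\<Sum>y\<in>?I. \<Sum>h\<in>{h\<in>?D. y + h \<in> ?I}. z (y + h) * cnj (z y))"
  proof (rule sum.cong[OF refl])
    fix y assume y: "y \<in> ?I"
    show "(\<Sum>y'\<in>?I. z y' * cnj (z y)) = (\<Sum>h\<in>{h\<in>?D. y + h \<in> ?I}. z (y + h) * cnj (z y))"
      by (rule sum.reindex_bij_witness[of _ "\<lambda>h. y + h" "\<lambda>y'. y' - y"]) (use y len in auto)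
  qed
  also have "\<dots> = (\<Sum>h\<in>?D. \<Sum>y\<in>{y\<in>?I. y + h \<in> ?I}. z (y + h) * cnj (z y))"
    by (rule sum.swap_restrict) auto
  also have "\<dots> = (\<Sum>h\<in>?D. \<Sum>y\<in>{max a (a - h)..<min b (b - h)}. z (y + h) * cnj (z y))"
    by (intro sum.cong refl) auto
  finally have "(norm (\<Sum>y\<in>?I. z y))\<^sup>2 = norm (\<Sum>h\<in>?D. \<Sum>y\<in>{max a (a - h)..<min b (b - h)}. z (y + h) * cnj (z y))"
    by (metis norm_of_real abs_power2 abs_norm_cancel power_abs)
  also have "\<dots> \<le> (\<Sum>h\<in>?D. norm (\<Sum>y\<in>{max a (a - h)..<min b (b - h)}. z (y + h) * cnj (z y)))"
    by (rule norm_sum)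
  finally show ?thesis .
qed

section \<open>Weyl's inequality: from large sums to rational approximation\<close>

lemma pigeonhole_fibre:
  assumes "finite A" "finite B" "f ` A \<subseteq> B" "B \<noteq> {}"
  obtains b where "b \<in> B" "card A \<le> card B * card {a\<in>A. f a = b}"
proof -
  obtain b where b: "b \<in> B" "card (f -` {b} \<inter> A) * card B \<ge> card A"
    using pigeonhole_card[of f A B] assms by auto
  moreover have "f -` {b} \<inter> A = {a\<in>A. f a = b}" by auto
  ultimately show ?thesis using that[of b] by (simp add: mult.commute)
qed

text \<open>If a proportion \<open>\<delta>\<close> of the multiples of \<open>\<theta>\<close> lies
  close to integers, then \<open>\<theta>\<close> is close to a fraction with denominator
  \<open>O(1 / \<delta>)\<close>. Take the Dirichlet approximation \<open>a / q\<close>. For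
  \<open>m\<close> in \<open>P\<close> the integer \<open>r m\<close>, which is congruent to
  \<open>m * a\<close> modulo \<open>q\<close>, is small, and it determines \<open>m\<close> within
  a block of length \<open>q\<close>. Counting such pairs bounds \<open>card P\<close> by about
  \<open>N / q + N * \<epsilon>\<close>, which forces \<open>q\<close> to be small.\<close>

lemma many_close_multiples:
  fixes \<theta> \<delta> \<epsilon> :: real and N :: nat
  assumes N: "N \<ge> 1" and \<delta>: "0 < \<delta>" "\<delta> \<le> 1" and \<epsilon>: "0 \<le> \<epsilon>" "\<epsilon> \<le> \<delta> / 25"
    and P: "P \<subseteq> {1..N}" "\<delta> * real N \<le> real (card P)"
    and close: "\<And>m. m \<in> P \<Longrightarrow> \<exists>n::int. \<bar>real m * \<theta> - of_int n\<bar> \<le> \<epsilon>"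
  obtains q :: nat and n :: int where "1 \<le> q" "real q \<le> 12 / \<delta>" "\<bar>real q * \<theta> - of_int n\<bar> \<le> 12 * \<epsilon> / (\<delta>\<^sup>2 * real N)"
proof -
  \<comment> \<open>Denominators up to \<open>2 * N\<close> make \<open>m * \<beta>\<close> at most
    1/2 in absolute value for every \<open>m \<le> N\<close>.\<close>
  obtain a k where ak: "coprime a k" "0 < k" "k \<le> int (2 * N)" "\<bar>of_int k * \<theta> - of_int a\<bar> < 1 / real (2 * N)"
    using Dirichlet_approx_coprime[of "2 * N" \<theta>] N by auto
  define q where "q = nat k"
  have q: "q > 0" "q \<le> 2 * N" "int q = k" using ak N unfolding q_def by auto
  define \<beta> where "\<beta> = real q * \<theta> - of_int a"
  have \<beta>: "\<bar>\<beta>\<bar> < 1 / (2 * real N)" using ak q unfolding \<beta>_def by (metis of_int_of_nat_eq of_nat_mult of_nat_numeral)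
  have "\<forall>m\<in>P. \<exists>n::int. \<bar>real m * \<theta> - of_int n\<bar> \<le> \<epsilon>" using close by blast
  then obtain v where v: "\<And>m. m \<in> P \<Longrightarrow> \<bar>real m * \<theta> - of_int (v m)\<bar> \<le> \<epsilon>" by metis
  define r where "r = (\<lambda>m. int m * a - int q * v m)"
  have mb: "\<bar>real m * \<beta>\<bar> \<le> 1/2" if "m \<in> P" for m
  proof -
    have "real m * \<bar>\<beta>\<bar> \<le> real N * (1 / (2 * real N))"
      using that P(1) \<beta> by (intro mult_mono) auto
    then show ?thesis using N by (simp add: abs_mult)
  qed
  have req: "of_int (r m) = real q * (real m * \<theta> - of_int (v m)) - real m * \<beta>" for m
    unfolding r_def \<beta>_def by (simp add: algebra_simps)
  have qv: "\<bar>real q * (real m * \<theta> - of_int (v m))\<bar> \<le> real q * \<epsilon>" if "m \<in> P" for m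
    using v[OF that] by (simp add: abs_mult mult_left_mono)
  have rb: "\<bar>of_int (r m)\<bar> \<le> real q * \<epsilon> + 1/2" if "m \<in> P" for m
    unfolding req using mb[OF that] qv[OF that] by linarith
  define R where "R = \<lfloor>real q * \<epsilon> + 1/2\<rfloor>"
  have R0: "R \<ge> 0" unfolding R_def using \<epsilon> by simp
  have inj: "inj_on (\<lambda>m. (m div q, r m)) P"
  proof (rule inj_onI)
    fix m m' assume mm: "m \<in> P" "m' \<in> P" "(m div q, r m) = (m' div q, r m')"
    then have "(int m - int m') * a = int q * (v m - v m')" unfolding r_def by (simp add: algebra_simps)
    then have "int q dvd (int m - int m') * a" by simp
    moreover have "coprime (int q) a" using ak(1) q by (simp add: coprime_commute)
    ultimately have "int q dvd int m - int m'" by (simp add: coprime_dvd_mult_left_iff)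
    then have "int m mod int q = int m' mod int q" by (simp add: mod_eq_dvd_iff)
    then have "m mod q = m' mod q" by (simp flip: of_nat_mod)
    moreover have "m div q = m' div q" using mm by simp
    ultimately show "m = m'" by (metis div_mult_mod_eq)
  qed
  have "card P \<le> card ({0..N div q} \<times> {-R..R})"
  proof (rule card_inj_on_le[OF inj])
    show "(\<lambda>m. (m div q, r m)) ` P \<subseteq> {0..N div q} \<times> {-R..R}"
    proof (rule image_subsetI)
      fix m assume m: "m \<in> P"
      have "\<bar>r m\<bar> \<le> R" unfolding R_def using rb[OF m] by (simp add: le_floor_iff)
      moreover have "m div q \<le> N div q" using m P(1) by (intro div_le_mono) auto
      ultimately show "(m div q, r m) \<in> {0..N div q} \<times> {-R..R}" by auto
    qed
  qed auto
  then have "card P \<le> (N div q + 1) * nat (2 * R + 1)"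
    by (simp add: card_cartesian_product)
  then have "real (card P) \<le> real ((N div q + 1) * nat (2 * R + 1))"
    using of_nat_le_iff by blast
  also have "\<dots> = real (N div q + 1) * (2 * of_int R + 1)"
    using R0 by (simp add: algebra_simps)
  also have "\<dots> \<le> (3 * real N / real q) * (2 * real q * \<epsilon> + 2)"
  proof (rule mult_mono)
    have "real (N div q * q) \<le> real N" using div_times_less_eq_dividend of_nat_le_iff by blast
    then have "real (N div q) \<le> real N / real q" using q by (simp add: field_simps)
    moreover have "1 \<le> 2 * real N / real q" using q by (simp add: field_simps)
    moreover have "3 * real N / real q = real N / real q + 2 * real N / real q" by (simp add: field_simps)
    ultimately show "real (N div q + 1) \<le> 3 * real N / real q" by simp
    have "of_int R \<le> real q * \<epsilon> + 1/2" unfolding R_def by linarith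
    then show "2 * of_int R + 1 \<le> 2 * real q * \<epsilon> + 2" by linarith
  qed (use R0 in auto)
  also have "\<dots> = 6 * real N * \<epsilon> + 6 * real N / real q" using q by (simp add: field_simps)
  finally have "\<delta> * real N \<le> real N * (6 * \<epsilon> + 6 / real q)" using P(2) by (simp add: algebra_simps)
  then have "\<delta> \<le> 6 * \<epsilon> + 6 / real q" using N by (simp add: mult.commute)
  then have "\<delta> / 2 \<le> 6 / real q" using \<epsilon> \<delta> by linarith
  then have qle: "real q \<le> 12 / \<delta>" using q \<delta> by (simp add: field_simps)
  have qe: "real q * \<epsilon> < 1/2"
  proof -
    have "real q * \<epsilon> \<le> (12 / \<delta>) * (\<delta> / 25)" using qle \<epsilon> \<delta> by (intro mult_mono) auto
    then show ?thesis using \<delta> by simp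
  qed
  \<comment> \<open>By now \<open>q * \<epsilon> < 1/2\<close>, so every integer \<open>r m\<close>
    vanishes and \<open>m * \<beta>\<close> itself is bounded by \<open>q * \<epsilon>\<close>. Some
    \<open>m\<close> in \<open>P\<close> is at least \<open>\<delta> * N\<close>, and dividing by it
    yields the bound for \<open>\<beta>\<close>.\<close>
  have mbe: "real m * \<bar>\<beta>\<bar> \<le> real q * \<epsilon>" if "m \<in> P" for m
  proof -
    have "\<bar>real_of_int (r m)\<bar> < 1" using rb[OF that] qe by linarith
    then have "r m = 0" by linarith
    then have "real m * \<beta> = real q * (real m * \<theta> - of_int (v m))" using req[of m] by simp
    then show ?thesis using qv[OF that] by (metis abs_mult abs_of_nat)
  qed
  have "\<exists>m\<in>P. \<delta> * real N \<le> real m"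
  proof (rule ccontr)
    assume "\<not> ?thesis"
    then have lt: "real m < \<delta> * real N" if "m \<in> P" for m using that by force
    have fin: "finite P" using P(1) finite_subset by blast
    have "0 < \<delta> * real N" using \<delta> N by simp
    then have "P \<noteq> {}" using P(2) by (intro notI) simp
    then have "Max P \<in> P" using fin by simp
    have "P \<subseteq> {1..Max P}" using P(1) fin by auto
    then have "card P \<le> card {1..Max P}" by (intro card_mono) auto
    then show False using lt[OF \<open>Max P \<in> P\<close>] P(2) by simp
  qed
  then obtain m where m: "m \<in> P" "\<delta> * real N \<le> real m" by blast
  have "\<delta> * real N * \<bar>\<beta>\<bar> \<le> real q * \<epsilon>" using mbe[OF m(1)] m(2) by (meson abs_ge_zero mult_right_mono order_trans)
  also have "\<dots> \<le> 12 / \<delta> * \<epsilon>" using qle \<epsilon> by (intro mult_right_mono) auto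
  finally have "\<bar>\<beta>\<bar> \<le> 12 * \<epsilon> / (\<delta>\<^sup>2 * real N)" using \<delta> N by (simp add: field_simps power2_eq_square)
  then show ?thesis using that[of q a] q qle unfolding \<beta>_def by auto
qed

lemma power_bound_mono:
  fixes c t :: real and D :: nat
  assumes "t \<ge> 1" "c \<le> real D" "d \<le> D"
  shows "c * t ^ d \<le> real D * t ^ D"
  using assms by (intro mult_mono power_increasing) auto

text \<open>The parameter \<open>t\<close> is the factor by which the sum may fall short of the
  trivial bound \<open>H\<close>. One number \<open>C\<close> serves as constant and as exponent,
  and \<open>H\<close> enters only through the natural scale \<open>H ^ k\<close>; this uniformity
  is what later allows mean values without loss.\<close>

definition weyl_const :: "nat \<Rightarrow> nat \<Rightarrow> bool" where
  "weyl_const k C \<longleftrightarrow> (\<forall>(H::nat) (t::real) \<theta> \<phi> a b. H \<ge> 1 \<longrightarrow> t \<ge> 1 \<longrightarrow> b - a \<le> int H \<longrightarrow> phase k \<theta> \<phi> \<longrightarrow>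
     real H / t \<le> norm (\<Sum>y\<in>{a..<b}. ee (\<phi> y)) \<longrightarrow>
     (\<exists>(q::nat) (n::int). 1 \<le> q \<and> real q \<le> real C * t ^ C \<and> \<bar>real q * \<theta> - of_int n\<bar> \<le> real C * t ^ C / real H ^ k))"

lemma weyl_constD:
  assumes "weyl_const k C" "H \<ge> 1" "t \<ge> 1" "b - a \<le> int H" "phase k \<theta> \<phi>" "real H / t \<le> norm (\<Sum>y\<in>{a..<b}. ee (\<phi> y))"
  obtains q :: nat and n :: int where "1 \<le> q" "real q \<le> real C * t ^ C" "\<bar>real q * \<theta> - of_int n\<bar> \<le> real C * t ^ C / real H ^ k"
  using assms unfolding weyl_const_def by metis

lemma weyl_const_1: "weyl_const (Suc 0) 2"
  unfolding weyl_const_def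
proof (intro allI impI)
  fix H :: nat and t \<theta> :: real and \<phi> and a b :: int
  assume H: "H \<ge> 1" and t: "t \<ge> 1" and ph: "phase (Suc 0) \<theta> \<phi>"
    and large: "real H / t \<le> norm (\<Sum>y\<in>{a..<b}. ee (\<phi> y))"
  have pos: "real H / t > 0" using H t by simp
  then have ab: "a \<le> b" using large by (cases "a \<le> b") auto
  have "(ee \<theta> - 1) * (\<Sum>y\<in>{a..<b}. ee (\<phi> y)) = ee (\<phi> b) - ee (\<phi> a)"
    using ph by (intro geometric_phase_sum[OF ab]) simp
  then have "norm (ee \<theta> - 1) * norm (\<Sum>y\<in>{a..<b}. ee (\<phi> y)) = norm (ee (\<phi> b) - ee (\<phi> a))"
    by (metis norm_mult)
  also have "\<dots> \<le> 2" using norm_triangle_ineq4[of "ee (\<phi> b)" "ee (\<phi> a)"] by simp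
  finally have "norm (ee \<theta> - 1) * (real H / t) \<le> 2"
    using large by (meson mult_left_mono norm_ge_zero order_trans)
  then have "\<bar>\<theta> - of_int (round \<theta>)\<bar> * (real H / t) \<le> 2"
    using norm_ee_minus_one_ge[of \<theta>] pos by (meson mult_right_mono less_imp_le order_trans)
  then have "\<bar>\<theta> - of_int (round \<theta>)\<bar> \<le> 2 * t / real H" using H t by (simp add: field_simps)
  moreover have "t \<le> t ^ 2" using t by (simp add: power2_eq_square)
  ultimately have "\<bar>real 1 * \<theta> - of_int (round \<theta>)\<bar> \<le> real 2 * t ^ 2 / real H ^ Suc 0"
    using H by (simp add: divide_right_mono order_trans)
  moreover have "real 1 \<le> real 2 * t ^ 2" using \<open>t \<le> t ^ 2\<close> t by simp
  ultimately show "\<exists>(q::nat) (n::int). 1 \<le> q \<and> real q \<le> real 2 * t ^ 2 \<and> \<bar>real q * \<theta> - of_int n\<bar> \<le> real 2 * t ^ 2 / real H ^ Suc 0"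
    by blast
qed

text \<open>When \<open>H ^ k\<close> is bounded by the permitted power of \<open>t\<close>, the
  permitted error is at least 1 and the denominator 1 will do.\<close>

lemma trivial_approx:
  assumes "H \<ge> 1" "real H ^ k \<le> B" "B \<le> real C * (t::real) ^ C"
  shows "\<exists>(q::nat) (n::int). 1 \<le> q \<and> real q \<le> real C * t ^ C \<and> \<bar>real q * \<theta> - of_int n\<bar> \<le> real C * t ^ C / real H ^ k"
proof -
  have "1 \<le> real H ^ k" using assms by (simp add: one_le_power)
  moreover from this have "real 1 \<le> real C * t ^ C" using assms by linarith
  moreover have "1 \<le> real C * t ^ C / real H ^ k"
    using assms by (simp add: le_divide_eq)
  moreover have "\<bar>real 1 * \<theta> - of_int (round \<theta>)\<bar> \<le> 1"
    using of_int_round_abs_le[of \<theta>] by (simp add: abs_minus_commute)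
  ultimately show ?thesis by (intro exI[of _ "1::nat"] exI[of _ "round \<theta>"] conjI) linarith+
qed

text \<open>Differencing shows that many shifts \<open>h\<close> have a large sum of degree
  \<open>k\<close>, so \<open>Suc k * h * \<theta>\<close> is close to a fraction with small
  denominator. A pigeonhole over denominators makes one of them common to many \<open>h\<close>, and
  \<open>many_close_multiples\<close> passes from these multiples to
  \<open>\<theta>\<close>.\<close>

lemma weyl_const_step:
  assumes C: "weyl_const k C" and k: "k \<ge> 1"
  obtains C' where "weyl_const (Suc k) C'"
proof -
  define E where "E = max 1 C * 4 ^ max 1 C"
  \<comment> \<open>A crude sum of everything needed as coefficient or as exponent; 40000 is the
    square of the 200 in the degenerate case at the end.\<close>
  define D where "D = 40000 * (k + 1) * E ^ 4 * 4 ^ (k + 1) + (4 + 8 * max 1 C) + (2 * k + 2)"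
  have E: "E \<ge> 1" unfolding E_def by (simp add: Suc_le_eq)
  have "weyl_const (Suc k) D" unfolding weyl_const_def
  proof (intro allI impI)
    fix H :: nat and t \<theta> :: real and \<phi> and a b :: int
    assume H: "H \<ge> 1" and t: "t \<ge> 1" and len: "b - a \<le> int H" and ph: "phase (Suc k) \<theta> \<phi>"
      and large: "real H / t \<le> norm (\<Sum>y\<in>{a..<b}. ee (\<phi> y))"
    define Q where "Q = real E * t ^ (2 * max 1 C)"
    have t2: "t\<^sup>2 \<ge> 1" using t by simp
    have Q1: "Q \<ge> 1" unfolding Q_def using E t by (metis mult_mono' mult_1 of_nat_1 of_nat_le_iff one_le_power zero_le_one)
    have CQ: "real C * (4 * t\<^sup>2) ^ C \<le> Q"
    proof -
      have "real C * (4 * t\<^sup>2) ^ C \<le> real (max 1 C) * (4 * t\<^sup>2) ^ max 1 C"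
        using t2 by (intro mult_mono power_increasing) auto
      also have "\<dots> = Q" unfolding Q_def E_def by (simp add: power_mult_distrib power_mult)
      finally show ?thesis .
    qed
    have Qpow: "c * t ^ d * Q ^ e \<le> real D * t ^ D" if "c \<le> 40000 * (k + 1)" "d \<le> 4" "e \<le> 4" for c d e :: nat
    proof -
      have "c * t ^ d * Q ^ e = real (c * E ^ e) * t ^ (d + 2 * max 1 C * e)"
        unfolding Q_def by (simp add: power_mult_distrib power_mult power_add)
      also have "\<dots> \<le> real D * t ^ D"
      proof (rule power_bound_mono[OF t])
        have "c * E ^ e \<le> 40000 * (k + 1) * E ^ 4" using that E by (intro mult_mono power_increasing) auto
        also have "\<dots> \<le> 40000 * (k + 1) * E ^ 4 * 4 ^ (k + 1)" by simp
        also have "\<dots> \<le> D" unfolding D_def by simp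
        finally show "real (c * E ^ e) \<le> real D" using of_nat_le_iff by blast
        have "d + 2 * max 1 C * e \<le> 4 + 2 * max 1 C * 4" using that by (intro add_mono mult_mono) auto
        then show "d + 2 * max 1 C * e \<le> D" unfolding D_def by linarith
      qed
      finally show ?thesis .
    qed
    show "\<exists>(q::nat) (n::int). 1 \<le> q \<and> real q \<le> real D * t ^ D \<and> \<bar>real q * \<theta> - of_int n\<bar> \<le> real D * t ^ D / real H ^ Suc k"
    proof (cases "real H < 4 * t\<^sup>2")
      case True
      have "(4 * t\<^sup>2) ^ Suc k = real (4 ^ Suc k) * t ^ (2 * Suc k)"
        by (simp only: power_mult_distrib power_mult of_nat_power of_nat_numeral)
      also have "\<dots> \<le> real D * t ^ D"
      proof (rule power_bound_mono[OF t])
        have "1 * 4 ^ (k + 1) \<le> (40000 * (k + 1) * E ^ 4) * 4 ^ (k + 1)" using E by (intro mult_right_mono) (auto simp: Suc_le_eq)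
        then have "4 ^ Suc k \<le> D" unfolding D_def Suc_eq_plus1 mult_1 by linarith
        then show "real (4 ^ Suc k) \<le> real D" using of_nat_le_iff by blast
      qed (simp add: D_def)
      finally have *: "(4 * t\<^sup>2) ^ Suc k \<le> real D * t ^ D" .
      have "real H ^ Suc k \<le> (4 * t\<^sup>2) ^ Suc k" using True by (intro power_mono) auto
      then show ?thesis using trivial_approx[OF H _ *] by blast
    next
      case HL: False
      define T where "T = (\<lambda>h. \<Sum>y\<in>{max a (a - h)..<min b (b - h)}. ee (\<phi> (y + h) - \<phi> y))"
      define Big where "Big = {h\<in>{- int H<..<int H}. real H / (4 * t\<^sup>2) \<le> norm (T h)}"
      have TH: "norm (T h) \<le> real H" for h
      proof -
        have "norm (T h) \<le> (\<Sum>y\<in>{max a (a - h)..<min b (b - h)}. norm (ee (\<phi> (y + h) - \<phi> y)))"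
          unfolding T_def by (rule norm_sum)
        also have "\<dots> = real (nat (min b (b - h) - max a (a - h)))" by simp
        also have "\<dots> \<le> real H" using len by simp
        finally show ?thesis .
      qed
      have "Big \<subseteq> {- int H<..<int H}" unfolding Big_def by auto
      then have finB: "finite Big" using finite_subset by blast
      have "(real H / t)\<^sup>2 \<le> (norm (\<Sum>y\<in>{a..<b}. ee (\<phi> y)))\<^sup>2"
        using large H t by (intro power_mono) auto
      also have "\<dots> \<le> (\<Sum>h\<in>{- int H<..<int H}. norm (T h))"
        using van_der_corput[OF len, of "\<lambda>y. ee (\<phi> y)"] unfolding T_def ee_diff .
      \<comment> \<open>The threshold \<open>H / (4 * t\<^sup>2)\<close> in \<open>Big\<close> is
        such that all shifts outside \<open>Big\<close> together contribute at most half of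
        \<open>(H / t)\<^sup>2\<close>.\<close>
      also have "\<dots> \<le> (\<Sum>h\<in>{- int H<..<int H}. (if h \<in> Big then real H else 0) + real H / (4 * t\<^sup>2))"
        using TH H t by (intro sum_mono) (auto simp: Big_def intro: add_increasing2)
      also have "\<dots> = real (card Big) * real H + real (card {- int H<..<int H}) * (real H / (4 * t\<^sup>2))"
      proof -
        have "{h\<in>{- int H<..<int H}. h \<in> Big} = Big" unfolding Big_def by auto
        then show ?thesis by (simp add: sum.distrib sum.If_cases Int_def)
      qed
      also have "\<dots> \<le> real (card Big) * real H + (2 * real H) * (real H / (4 * t\<^sup>2))"
        using H by (intro add_left_mono mult_right_mono) auto
      finally have "real H * (real H / (2 * t\<^sup>2)) \<le> real H * real (card Big)"
        using t by (simp add: field_simps power2_eq_square)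
      then have cB: "real H / (2 * t\<^sup>2) \<le> real (card Big)"
        using H by (subst (asm) mult_le_cancel_left_pos) auto
      define P where "P = {m\<in>{1..H}. int m \<in> Big \<or> - int m \<in> Big}"
      have "Big \<subseteq> insert 0 (int ` P \<union> (\<lambda>m. - int m) ` P)"
      proof
        fix h assume h: "h \<in> Big"
        have "\<bar>h\<bar> < int H" using h unfolding Big_def by auto
        then show "h \<in> insert 0 (int ` P \<union> (\<lambda>m. - int m) ` P)"
          using h unfolding P_def by (cases h rule: int_cases2) (auto simp: image_iff)
      qed
      then have "card Big \<le> card (insert 0 (int ` P \<union> (\<lambda>m. - int m) ` P))"
        by (intro card_mono) (auto simp: P_def)
      also have "\<dots> \<le> Suc (card (int ` P \<union> (\<lambda>m. - int m) ` P))" by (rule card_insert_le_m1) auto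
      also have "\<dots> \<le> Suc (card (int ` P) + card ((\<lambda>m. - int m) ` P))" using card_Un_le by auto
      also have "\<dots> \<le> Suc (card P + card P)"
        by (intro Suc_leI le_imp_less_Suc add_mono card_image_le) (auto simp: P_def)
      finally have "real (card Big) \<le> 1 + 2 * real (card P)" by linarith
      moreover have "1 \<le> real H / (4 * t\<^sup>2)" using HL t by (simp add: field_simps)
      moreover have "real H / (2 * t\<^sup>2) = 4 * (real H / (8 * t\<^sup>2))" "real H / (4 * t\<^sup>2) = 2 * (real H / (8 * t\<^sup>2))"
        by simp_all
      \<comment> \<open>Discarding the shift 0 costs at most \<open>H / (4 * t\<^sup>2)\<close>,
        because \<open>H\<close> is at least \<open>4 * t\<^sup>2\<close> here; identifying
        \<open>h\<close> with \<open>- h\<close> halves what remains.\<close>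
      ultimately have cP: "real H / (8 * t\<^sup>2) \<le> real (card P)" using cB by linarith
      have t4: "4 * t\<^sup>2 \<ge> 1" using t2 by linarith
      define \<epsilon> where "\<epsilon> = Q / real H ^ k"
      have approx: "\<exists>(q::nat) (n::int). 1 \<le> q \<and> real q \<le> Q \<and> \<bar>real q * (real (Suc k) * of_int h * \<theta>) - of_int n\<bar> \<le> \<epsilon>"
        if h: "h \<in> Big" for h
      proof -
        have l: "min b (b - h) - max a (a - h) \<le> int H" using len by auto
        have "phase k (real (Suc k) * of_int h * \<theta>) (\<lambda>y. \<phi> (y + h) - \<phi> y)" using ph by simp
        note ph' = this
        have lg: "real H / (4 * t\<^sup>2) \<le> norm (\<Sum>y\<in>{max a (a - h)..<min b (b - h)}. ee (\<phi> (y + h) - \<phi> y))"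
          using h unfolding Big_def T_def by auto
        obtain q :: nat and n :: int where q: "1 \<le> q" "real q \<le> real C * (4 * t\<^sup>2) ^ C"
          "\<bar>real q * (real (Suc k) * of_int h * \<theta>) - of_int n\<bar> \<le> real C * (4 * t\<^sup>2) ^ C / real H ^ k"
          by (rule weyl_constD[OF C H t4 l ph' lg])
        have "real C * (4 * t\<^sup>2) ^ C / real H ^ k \<le> \<epsilon>" unfolding \<epsilon>_def using CQ by (intro divide_right_mono) auto
        then show ?thesis using q CQ by (meson order_trans)
      qed
      have "\<exists>(q::nat) (n::int). 1 \<le> q \<and> real q \<le> Q \<and> \<bar>real q * (real (Suc k) * real m * \<theta>) - of_int n\<bar> \<le> \<epsilon>"
        if m: "m \<in> P" for m
      proof (cases "int m \<in> Big")
        case True then show ?thesis using approx[OF True] by simp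
      next
        case False
        then have "- int m \<in> Big" using m unfolding P_def by auto
        from approx[OF this] obtain q n where q: "1 \<le> q" "real q \<le> Q" "\<bar>real q * (real (Suc k) * of_int (- int m) * \<theta>) - of_int n\<bar> \<le> \<epsilon>"
          by blast
        have "real q * (real (Suc k) * real m * \<theta>) - of_int (- n) = - (real q * (real (Suc k) * of_int (- int m) * \<theta>) - of_int n)"
          by simp
        then show ?thesis using q by (metis abs_minus_cancel)
      qed
      then obtain f :: "nat \<Rightarrow> nat" where f: "\<And>m. m \<in> P \<Longrightarrow> 1 \<le> f m \<and> real (f m) \<le> Q \<and> (\<exists>n::int. \<bar>real (f m) * (real (Suc k) * real m * \<theta>) - of_int n\<bar> \<le> \<epsilon>)"
        by metis
      have finP: "finite P" unfolding P_def by auto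
      have fQ: "f ` P \<subseteq> {1..nat \<lfloor>Q\<rfloor>}" using f by (auto simp: le_nat_floor)
      have ne: "{1..nat \<lfloor>Q\<rfloor>} \<noteq> {}" using Q1 by (simp add: le_nat_floor)
      obtain q where q: "q \<in> {1..nat \<lfloor>Q\<rfloor>}" "card P \<le> card {1..nat \<lfloor>Q\<rfloor>} * card {m\<in>P. f m = q}"
        using pigeonhole_fibre[OF finP _ fQ ne] by blast
      define P' where "P' = {m\<in>P. f m = q}"
      define \<delta> where "\<delta> = 1 / (8 * t\<^sup>2 * Q)"
      have qQ: "1 \<le> q" "real q \<le> Q" using q Q1 by (auto simp: le_nat_iff le_floor_iff)
      have "real (card P) \<le> real (nat \<lfloor>Q\<rfloor>) * real (card P')"
        using q(2) unfolding P'_def by (metis card_atLeastAtMost diff_Suc_1 of_nat_le_iff of_nat_mult)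
      also have "\<dots> \<le> Q * real (card P')" using Q1 by (intro mult_right_mono) auto
      finally have cPP: "real (card P) \<le> Q * real (card P')" .
      have cP': "\<delta> * real H \<le> real (card P')"
      proof -
        have "\<delta> * real H = real H / (8 * t\<^sup>2) / Q" unfolding \<delta>_def by simp
        also have "\<dots> \<le> Q * real (card P') / Q"
          using cP cPP Q1 by (intro divide_right_mono) auto
        also have "\<dots> = real (card P')" using Q1 by simp
        finally show ?thesis .
      qed
      have \<delta>: "0 < \<delta>" "\<delta> \<le> 1"
      proof -
        show "0 < \<delta>" unfolding \<delta>_def using Q1 t by simp
        have "1 * 1 \<le> 8 * t\<^sup>2 * Q" using t2 Q1 by (intro mult_mono) auto
        then show "\<delta> \<le> 1" unfolding \<delta>_def by (simp add: field_simps)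
      qed
      show ?thesis
      proof (cases "\<epsilon> \<le> \<delta> / 25")
        case True
        have P'H: "P' \<subseteq> {1..H}" unfolding P'_def P_def by auto
        have \<epsilon>0: "0 \<le> \<epsilon>" unfolding \<epsilon>_def using Q1 by simp
        have close: "\<exists>n::int. \<bar>real m * (real q * real (Suc k) * \<theta>) - of_int n\<bar> \<le> \<epsilon>" if "m \<in> P'" for m
          using f[of m] that unfolding P'_def by (auto simp: mult_ac)
        obtain q' :: nat and n :: int where q': "1 \<le> q'" "real q' \<le> 12 / \<delta>"
          "\<bar>real q' * (real q * real (Suc k) * \<theta>) - of_int n\<bar> \<le> 12 * \<epsilon> / (\<delta>\<^sup>2 * real H)"
          by (rule many_close_multiples[OF H \<delta> \<epsilon>0 True P'H cP' close])
        have "real (q' * q * Suc k) \<le> (12 / \<delta>) * Q * real (Suc k)"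
          using q' qQ \<delta> unfolding of_nat_mult by (intro mult_mono) auto
        also have "\<dots> = real (96 * (k + 1)) * t ^ 2 * Q ^ 2" unfolding \<delta>_def by (simp add: power2_eq_square)
        also have "\<dots> \<le> real D * t ^ D" by (rule Qpow) auto
        finally have 1: "real (q' * q * Suc k) \<le> real D * t ^ D" .
        have "12 * \<epsilon> / (\<delta>\<^sup>2 * real H) = real 768 * t ^ 4 * Q ^ 3 / real H ^ Suc k"
          unfolding \<epsilon>_def \<delta>_def using t Q1 H by (simp add: field_simps power2_eq_square power3_eq_cube power4_eq_xxxx)
        also have "\<dots> \<le> real D * t ^ D / real H ^ Suc k" by (intro divide_right_mono Qpow) auto
        finally have 2: "\<bar>real (q' * q * Suc k) * \<theta> - of_int n\<bar> \<le> real D * t ^ D / real H ^ Suc k"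
          using q'(3) by (simp only: of_nat_mult mult_ac)
        have "1 \<le> q' * q * Suc k" using q' qQ by (simp add: Suc_le_eq)
        then show ?thesis using 1 2 by blast
      next
        case False
        \<comment> \<open>If \<open>\<epsilon>\<close> is not small against \<open>\<delta>\<close>,
          then \<open>H ^ k\<close> is bounded by a power of \<open>t\<close>. As
          \<open>k \<ge> 1\<close>, squaring raises the exponent of \<open>H\<close> to at least
          \<open>Suc k\<close>, and the trivial approximation applies.\<close>
        then have "real H ^ k \<le> 200 * t\<^sup>2 * Q\<^sup>2" unfolding \<epsilon>_def \<delta>_def using t Q1 H by (simp add: field_simps power2_eq_square)
        then have "(real H ^ k)\<^sup>2 \<le> (200 * t\<^sup>2 * Q\<^sup>2)\<^sup>2" by (intro power_mono) auto
        moreover have "real H ^ Suc k \<le> real H ^ (k * 2)" using H k by (intro power_increasing) auto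
        moreover have "(200 * t\<^sup>2 * Q\<^sup>2)\<^sup>2 = real 40000 * t ^ 4 * Q ^ 4" by (simp add: power_mult_distrib flip: power_mult)
        ultimately have "real H ^ Suc k \<le> real 40000 * t ^ 4 * Q ^ 4" by (simp add: power_mult)
        moreover have "real 40000 * t ^ 4 * Q ^ 4 \<le> real D * t ^ D" by (rule Qpow) auto
        ultimately show ?thesis using trivial_approx[OF H] by blast
      qed
    qed
  qed
  then show ?thesis by (rule that)
qed

lemma weyl_const_exists: "k \<ge> 1 \<Longrightarrow> \<exists>C. weyl_const k C"
proof (induction k rule: dec_induct)
  case base then show ?case using weyl_const_1 by auto
next
  case (step n) then show ?case using weyl_const_step by metis
qed

section \<open>Large values of exponential sums\<close>

text \<open>Exponential sums over the moment curve. The frequencies are integers divided by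
  \<open>H ^ j\<close>, so modulo 1 they form a finite group, over which orthogonality is a finite
  sum.\<close>

definition curve_sum :: "nat \<Rightarrow> nat \<Rightarrow> (nat \<Rightarrow> int) \<Rightarrow> complex" where
  "curve_sum k H a = (\<Sum>y\<in>{1..int H}. ee (\<Sum>j=1..k. of_int (a j) * of_int y ^ j / real H ^ j))"

lemma norm_curve_sum_le: "norm (curve_sum k H a) \<le> real H"
proof -
  have "norm (curve_sum k H a) \<le> (\<Sum>y\<in>{1..int H}. norm (ee (\<Sum>j=1..k. of_int (a j) * of_int y ^ j / real H ^ j)))"
    unfolding curve_sum_def by (rule norm_sum)
  then show ?thesis by simp
qed

lemma curve_sum_Suc_dvd:
  assumes "int H ^ Suc k dvd a (Suc k)" "H \<ge> 1"
  shows "curve_sum (Suc k) H a = curve_sum k H a"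
  unfolding curve_sum_def
proof (rule sum.cong[OF refl])
  fix y :: int
  obtain n where n: "a (Suc k) = int H ^ Suc k * n" using assms(1) by auto
  have "(\<Sum>j=1..Suc k. of_int (a j) * of_int y ^ j / real H ^ j) - (\<Sum>j=1..k. of_int (a j) * of_int y ^ j / real H ^ j)
     = of_int (a (Suc k)) * of_int y ^ Suc k / real H ^ Suc k" by simp
  also have "\<dots> = of_int (n * y ^ Suc k)" unfolding n using assms(2) by simp
  finally show "ee (\<Sum>j=1..Suc k. of_int (a j) * of_int y ^ j / real H ^ j) = ee (\<Sum>j=1..k. of_int (a j) * of_int y ^ j / real H ^ j)"
    by (rule ee_eq_of_int_diff)
qed

text \<open>Duality: weights of modulus at most 1 turn the sum of absolute values into a double sum
  over \<open>a\<close> and \<open>y\<close>. Cauchy-Schwarz in \<open>y\<close> and expansion of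
  the square leave the correlations of pairs of frequencies, which are curve sums of the
  differences.\<close>

lemma curve_sum_large_pairs:
  assumes fin: "finite F" and H: "H \<ge> 1" and t: "t > 0" and large: "\<And>a. a \<in> F \<Longrightarrow> real H / t \<le> norm (curve_sum k H a)"
  shows "(real (card F))\<^sup>2 * real H / t\<^sup>2 \<le> (\<Sum>a\<in>F. \<Sum>a'\<in>F. norm (curve_sum k H (\<lambda>j. a j - a' j)))"
proof -
  define w where "w = (\<lambda>a. cnj (sgn (curve_sum k H a)))"
  define p where "p = (\<lambda>a (y::int). (\<Sum>j=1..k. of_int (a j) * of_int y ^ j / real H ^ j))"
  have p: "curve_sum k H a = (\<Sum>y\<in>{1..int H}. ee (p a y))" for a unfolding curve_sum_def p_def ..
  have w: "w a * curve_sum k H a = of_real (norm (curve_sum k H a))" "norm (w a) \<le> 1" for a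
  proof -
    show "w a * curve_sum k H a = of_real (norm (curve_sum k H a))"
      unfolding w_def sgn_eq by (simp add: mult.commute flip: complex_norm_square) (simp add: complex_norm_square[symmetric] power2_eq_square)
    show "norm (w a) \<le> 1" unfolding w_def by (simp add: norm_sgn)
  qed
  have "real (card F) * (real H / t) \<le> (\<Sum>a\<in>F. norm (curve_sum k H a))"
    using sum_bounded_below[of F "real H / t" "\<lambda>a. norm (curve_sum k H a)"] large by simp
  also have "\<dots> = norm (\<Sum>a\<in>F. w a * curve_sum k H a)"
    unfolding w(1) by (simp add: sum_nonneg flip: of_real_sum)
  also have "(\<Sum>a\<in>F. w a * curve_sum k H a) = (\<Sum>y\<in>{1..int H}. \<Sum>a\<in>F. w a * ee (p a y))"
    unfolding p sum_distrib_left by (rule sum.swap)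
  also have "norm \<dots> \<le> (\<Sum>y\<in>{1..int H}. norm (\<Sum>a\<in>F. w a * ee (p a y)))" by (rule norm_sum)
  finally have "(real (card F) * (real H / t))\<^sup>2 \<le> (\<Sum>y\<in>{1..int H}. 1 * norm (\<Sum>a\<in>F. w a * ee (p a y)))\<^sup>2"
    using t by (intro power_mono) auto
  also have "\<dots> \<le> (\<Sum>y\<in>{1..int H}. 1\<^sup>2) * (\<Sum>y\<in>{1..int H}. (norm (\<Sum>a\<in>F. w a * ee (p a y)))\<^sup>2)"
    by (rule Cauchy_Schwarz_ineq_sum)
  also have "(\<Sum>y\<in>{1..int H}. (norm (\<Sum>a\<in>F. w a * ee (p a y)))\<^sup>2) \<le> (\<Sum>a\<in>F. \<Sum>a'\<in>F. norm (curve_sum k H (\<lambda>j. a j - a' j)))"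
  proof -
    have "complex_of_real (\<Sum>y\<in>{1..int H}. (norm (\<Sum>a\<in>F. w a * ee (p a y)))\<^sup>2)
        = (\<Sum>y\<in>{1..int H}. (\<Sum>a\<in>F. w a * ee (p a y)) * cnj (\<Sum>a\<in>F. w a * ee (p a y)))"
      by (simp only: of_real_sum complex_norm_square)
    also have "\<dots> = (\<Sum>y\<in>{1..int H}. \<Sum>a\<in>F. \<Sum>a'\<in>F. w a * cnj (w a') * ee (p a y - p a' y))"
      by (simp add: cnj_sum sum_product ee_diff mult_ac)
    also have "\<dots> = (\<Sum>a\<in>F. \<Sum>a'\<in>F. \<Sum>y\<in>{1..int H}. w a * cnj (w a') * ee (p a y - p a' y))"
      by (subst sum.swap) (intro sum.cong refl sum.swap)
    also have "\<dots> = (\<Sum>a\<in>F. \<Sum>a'\<in>F. w a * cnj (w a') * curve_sum k H (\<lambda>j. a j - a' j))"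
      unfolding p sum_distrib_left p_def by (simp add: sum_subtractf[symmetric] algebra_simps diff_divide_distrib)
    finally have "(\<Sum>y\<in>{1..int H}. (norm (\<Sum>a\<in>F. w a * ee (p a y)))\<^sup>2)
      = norm (\<Sum>a\<in>F. \<Sum>a'\<in>F. w a * cnj (w a') * curve_sum k H (\<lambda>j. a j - a' j))"
      by (metis (mono_tags, lifting) abs_of_nonneg norm_of_real sum_nonneg zero_le_power2)
    also have "\<dots> \<le> (\<Sum>a\<in>F. \<Sum>a'\<in>F. norm (w a * cnj (w a') * curve_sum k H (\<lambda>j. a j - a' j)))"
      by (intro order.trans[OF norm_sum] sum_mono norm_sum)
    also have "\<dots> \<le> (\<Sum>a\<in>F. \<Sum>a'\<in>F. norm (curve_sum k H (\<lambda>j. a j - a' j)))"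
    proof (intro sum_mono)
      fix a a'
      have "norm (w a) * norm (w a') \<le> 1" using w(2) by (simp add: mult_le_one)
      then show "norm (w a * cnj (w a') * curve_sum k H (\<lambda>j. a j - a' j)) \<le> norm (curve_sum k H (\<lambda>j. a j - a' j))"
        unfolding norm_mult complex_mod_cnj by (metis mult_left_le_one_le norm_ge_zero zero_le_mult_iff)
    qed
    finally show ?thesis .
  qed
  finally have "(real (card F) * (real H / t))\<^sup>2 \<le> real H * (\<Sum>a\<in>F. \<Sum>a'\<in>F. norm (curve_sum k H (\<lambda>j. a j - a' j)))"
    by (simp add: mult_left_mono)
  then show ?thesis using H t by (simp add: field_simps power2_eq_square)
qed

text \<open>Size of the large spectrum, with a bound uniform in \<open>H\<close>. Separation is
  demanded of whole frequency vectors modulo the powers of \<open>H\<close>; two of them may agree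
  in some coordinates.\<close>

definition spec_const :: "nat \<Rightarrow> nat \<Rightarrow> bool" where
  "spec_const k C \<longleftrightarrow> (\<forall>(H::nat) (t::real) F. H \<ge> 1 \<longrightarrow> t \<ge> 1 \<longrightarrow> finite F \<longrightarrow>
     (\<forall>a\<in>F. \<forall>a'\<in>F. (\<forall>j\<in>{1..k}. int H ^ j dvd a j - a' j) \<longrightarrow> a = a') \<longrightarrow>
     (\<forall>a\<in>F. real H / t \<le> norm (curve_sum k H a)) \<longrightarrow> real (card F) \<le> real C * t ^ C)"

lemma spec_const_0: "spec_const 0 1"
  unfolding spec_const_def
proof (intro allI impI)
  fix H :: nat and t :: real and F :: "(nat \<Rightarrow> int) set"
  assume "t \<ge> 1" "\<forall>a\<in>F. \<forall>a'\<in>F. (\<forall>j\<in>{1..0}. int H ^ j dvd a j - a' j) \<longrightarrow> a = a'" "finite F"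
  moreover from this have "card F \<le> Suc 0" by (auto simp: card_le_Suc0_iff_eq)
  ultimately show "real (card F) \<le> real 1 * t ^ 1" by simp
qed

text \<open>The residues on major arcs are few: the triple of \<open>q\<close>, \<open>n\<close> and
  \<open>q * b - n * M\<close> determines \<open>b\<close> and has \<open>O(Q)\<close> choices in
  each entry. The 15 comes from \<open>m * (4 * m + 1) * (2 * m + 1)\<close> with
  \<open>m \<le> Q\<close> and \<open>1 \<le> Q\<close>.\<close>

lemma card_major_residues:
  fixes M :: int and Q :: real
  assumes M: "M \<ge> 1" and Q: "Q \<ge> 1" and R: "R \<subseteq> {0..<M}"
    and R2: "\<And>b. b \<in> R \<Longrightarrow> \<exists>(q::nat) (n::int). 1 \<le> q \<and> real q \<le> Q \<and> \<bar>real q * (of_int b / of_int M) - of_int n\<bar> \<le> Q / of_int M"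
  shows "real (card R) \<le> 15 * Q ^ 3"
proof -
  define m where "m = \<lfloor>Q\<rfloor>"
  have m: "m \<ge> 1" "of_int m \<le> Q" unfolding m_def using Q by auto
  have "\<exists>q n. 1 \<le> q \<and> q \<le> m \<and> \<bar>q * b - n * M\<bar> \<le> m \<and> \<bar>n\<bar> \<le> 2 * m" if b: "b \<in> R" for b
  proof -
    obtain q :: nat and n :: int where q: "1 \<le> q" "real q \<le> Q" "\<bar>real q * (of_int b / of_int M) - of_int n\<bar> \<le> Q / of_int M"
      using R2[OF b] by blast
    have "of_int \<bar>int q * b - n * M\<bar> = \<bar>real q * (of_int b / of_int M) - of_int n\<bar> * of_int M"
    proof -
      have "of_int (int q * b - n * M) = (real q * (of_int b / of_int M) - of_int n) * of_int M"
        using M by (simp add: field_simps)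
      then show ?thesis using M by (simp add: abs_mult)
    qed
    also have "\<dots> \<le> Q" using q(3) M by (simp add: field_simps)
    finally have 1: "\<bar>int q * b - n * M\<bar> \<le> m" unfolding m_def by (simp add: le_floor_iff)
    have qm: "int q \<le> m" unfolding m_def using q(2) by (simp add: le_floor_iff)
    have b2: "0 \<le> b" "b \<le> M" using b R by auto
    have "\<bar>n * M\<bar> \<le> \<bar>int q * b\<bar> + m" using 1 by linarith
    moreover have "\<bar>int q * b\<bar> \<le> m * M" using qm b2 m by (simp add: abs_mult mult_mono)
    moreover have "m \<le> m * M" using m M by simp
    moreover have "\<bar>n * M\<bar> = \<bar>n\<bar> * M" using M by (simp add: abs_mult)
    ultimately have "\<bar>n\<bar> * M \<le> (2 * m) * M" by linarith
    then have "\<bar>n\<bar> \<le> 2 * m" using M by simp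
    then show ?thesis using 1 qm q(1) by (intro exI[of _ "int q"] exI[of _ n]) auto
  qed
  then obtain f g where fg: "\<And>b. b \<in> R \<Longrightarrow> 1 \<le> f b \<and> f b \<le> m \<and> \<bar>f b * b - g b * M\<bar> \<le> m \<and> \<bar>g b\<bar> \<le> 2 * m"
    by metis
  have "card R \<le> card ({1..m} \<times> {-(2 * m)..2 * m} \<times> {-m..m})"
  proof (rule card_inj_on_le[of "\<lambda>b. (f b, g b, f b * b - g b * M)"])
    show "inj_on (\<lambda>b. (f b, g b, f b * b - g b * M)) R"
    proof (rule inj_onI)
      fix b b' assume "b \<in> R" "b' \<in> R" "(f b, g b, f b * b - g b * M) = (f b', g b', f b' * b' - g b' * M)"
      then have "f b * b = f b * b'" "f b \<noteq> 0" using fg[of b] by auto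
      then show "b = b'" by simp
    qed
    show "(\<lambda>b. (f b, g b, f b * b - g b * M)) ` R \<subseteq> {1..m} \<times> {-(2 * m)..2 * m} \<times> {-m..m}"
      using fg by (fastforce simp: abs_le_iff)
  qed auto
  also have "\<dots> = nat m * (nat (4 * m + 1) * nat (2 * m + 1))" by (simp add: card_cartesian_product)
  finally have "real (card R) \<le> real (nat m * (nat (4 * m + 1) * nat (2 * m + 1)))" by linarith
  also have "\<dots> = of_int m * ((4 * of_int m + 1) * (2 * of_int m + 1))" using m by simp
  also have "\<dots> \<le> Q * ((4 * Q + Q) * (2 * Q + Q))" using m Q by (intro mult_mono add_mono) auto
  also have "\<dots> = 15 * Q ^ 3" by (simp add: power3_eq_cube)
  finally show ?thesis .
qed

text \<open>Weyl's inequality confines the top frequency of a large exponential sum to few residues. Frequencies with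
  a common top residue are counted through their differences, many of which are again large by
  \<open>curve_sum_large_pairs\<close> but of degree \<open>k\<close>.\<close>

lemma spec_const_step:
  assumes C: "spec_const k C"
  obtains C' where "spec_const (Suc k) C'"
proof -
  obtain C0 where C0: "weyl_const (Suc k) C0" using weyl_const_exists[of "Suc k"] by auto
  define C1 where "C1 = max 1 C0"
  define A where "A = 15 * C1 ^ 3 * (2 * C * 2 ^ C)"
  define D where "D = A + (3 * C1 + (2 + 2 * C))"
  have "spec_const (Suc k) D" unfolding spec_const_def
  proof (intro allI impI)
    fix H :: nat and t :: real and F :: "(nat \<Rightarrow> int) set"
    assume H: "H \<ge> 1" and t: "t \<ge> 1" and fin: "finite F"
      and sep: "\<forall>a\<in>F. \<forall>a'\<in>F. (\<forall>j\<in>{1..Suc k}. int H ^ j dvd a j - a' j) \<longrightarrow> a = a'"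
      and large: "\<forall>a\<in>F. real H / t \<le> norm (curve_sum (Suc k) H a)"
    define M where "M = int H ^ Suc k"
    define Q where "Q = real C1 * t ^ C1"
    have M: "M \<ge> 1" unfolding M_def using H by (intro one_le_power) auto
    have Q: "Q \<ge> 1" unfolding Q_def C1_def using t by (metis max.cobounded1 mult_mono' mult_1 of_nat_1 of_nat_le_iff one_le_power zero_le_one)
    define R where "R = (\<lambda>a. a (Suc k) mod M) ` F"
    have "real (card R) \<le> 15 * Q ^ 3"
    proof (rule card_major_residues[OF M Q])
      show "R \<subseteq> {0..<M}" unfolding R_def using M by auto
      fix b assume "b \<in> R"
      then obtain a where a: "a \<in> F" "b = a (Suc k) mod M" unfolding R_def by auto
      define c where "c = (\<lambda>j. if j = 0 then 0 else of_int (a j) / real H ^ j)"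
      have ph: "phase (Suc k) (of_int (a (Suc k)) / of_int M) (\<lambda>y. \<Sum>j=1..Suc k. of_int (a j) * of_int y ^ j / real H ^ j)"
      proof -
        have "phase (Suc k) (c (Suc k)) (\<lambda>y. \<Sum>j\<le>Suc k. c j * of_int y ^ j)" by (rule phase_poly)
        moreover have "(\<lambda>y::int. \<Sum>j\<le>Suc k. c j * of_int y ^ j) = (\<lambda>y. \<Sum>j=1..Suc k. of_int (a j) * of_int y ^ j / real H ^ j)"
          by (intro ext sum.mono_neutral_cong_right) (auto simp: c_def)
        moreover have "c (Suc k) = of_int (a (Suc k)) / of_int M" by (simp add: c_def M_def)
        ultimately show ?thesis by (simp only:)
      qed
      have I: "{1..int H} = {1..<int H + 1}" by auto
      have lg: "real H / t \<le> norm (\<Sum>y\<in>{1..<int H + 1}. ee (\<Sum>j=1..Suc k. of_int (a j) * of_int y ^ j / real H ^ j))"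
        using large a(1) unfolding curve_sum_def I by blast
      obtain q :: nat and n :: int where q: "1 \<le> q" "real q \<le> real C0 * t ^ C0"
        "\<bar>real q * (of_int (a (Suc k)) / of_int M) - of_int n\<bar> \<le> real C0 * t ^ C0 / real H ^ Suc k"
        by (rule weyl_constD[OF C0 H t _ ph lg]) simp
      have CQ: "real C0 * t ^ C0 \<le> Q" unfolding Q_def using t by (intro power_bound_mono) (auto simp: C1_def)
      have "of_int (a (Suc k)) / of_int M - of_int b / of_int M = (of_int (a (Suc k) div M) :: real)"
      proof -
        have "a (Suc k) - b = (a (Suc k) div M) * M" unfolding a(2) by (simp add: minus_mod_eq_div_mult)
        then have "(of_int (a (Suc k)) - of_int b :: real) = of_int (a (Suc k) div M) * of_int M"
          by (metis of_int_diff of_int_mult)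
        then show ?thesis using M by (simp add: field_simps)
      qed
      then have e: "real q * (of_int b / of_int M) - of_int (n - int q * (a (Suc k) div M))
         = real q * (of_int (a (Suc k)) / of_int M) - of_int n"
        by (simp add: algebra_simps)
      have "real C0 * t ^ C0 / real H ^ Suc k \<le> Q / of_int M"
        unfolding M_def using CQ by (simp add: divide_right_mono)
      then have "\<bar>real q * (of_int b / of_int M) - of_int (n - int q * (a (Suc k) div M))\<bar> \<le> Q / of_int M"
        unfolding e by (rule order_trans[OF q(3)])
      moreover have "real q \<le> Q" using q(2) CQ by (rule order_trans)
      ultimately show "\<exists>(q::nat) (n::int). 1 \<le> q \<and> real q \<le> Q \<and> \<bar>real q * (of_int b / of_int M) - of_int n\<bar> \<le> Q / of_int M"
        using q(1) by blast
    qed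
    moreover have fibre: "real (card {a\<in>F. a (Suc k) mod M = b}) \<le> 2 * t\<^sup>2 * (real C * (2 * t\<^sup>2) ^ C)" for b
    proof -
      define G where "G = {a\<in>F. a (Suc k) mod M = b}"
      define r where "r = real (card G)"
      have finG: "finite G" unfolding G_def using fin by auto
      have GF: "a \<in> F" if "a \<in> G" for a using that unfolding G_def by auto
      have dvdG: "M dvd a (Suc k) - a' (Suc k)" if "a \<in> G" "a' \<in> G" for a a'
        using that unfolding G_def by (auto simp: mod_eq_dvd_iff[symmetric])
      define B where "B = real C * (2 * t\<^sup>2) ^ C"
      have t2: "2 * t\<^sup>2 \<ge> 1" using t by (metis mult_2 add_increasing2 one_le_power zero_le_power2)
      have inner: "(\<Sum>a'\<in>G. norm (curve_sum (Suc k) H (\<lambda>j. a j - a' j))) \<le> B * real H + r * (real H / (2 * t\<^sup>2))"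
        if a: "a \<in> G" for a
      proof -
        \<comment> \<open>The threshold \<open>H / (2 * t\<^sup>2)\<close> is half of the average
          correlation guaranteed by \<open>curve_sum_large_pairs\<close>, so the pairs below it can
          be absorbed into the left-hand side.\<close>
        define G' where "G' = {a'\<in>G. real H / (2 * t\<^sup>2) \<le> norm (curve_sum (Suc k) H (\<lambda>j. a j - a' j))}"
        define \<Phi> where "\<Phi> = (\<lambda>a' j. a j - a' j :: int)"
        have G'G: "G' \<subseteq> G" unfolding G'_def by auto
        \<comment> \<open>Within a fibre the top entries agree modulo \<open>M\<close>, so their
          difference contributes only integers to the phase and the degree drops to
          \<open>k\<close>.\<close>
        have eqS: "curve_sum (Suc k) H (\<lambda>j. a j - a' j) = curve_sum k H (\<Phi> a')" if "a' \<in> G" for a'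
          unfolding \<Phi>_def using dvdG[OF a that] H unfolding M_def by (intro curve_sum_Suc_dvd) auto
        have inj: "inj_on \<Phi> G'" unfolding \<Phi>_def inj_on_def fun_eq_iff by auto
        have "real (card (\<Phi> ` G')) \<le> real C * (2 * t\<^sup>2) ^ C"
        proof -
          have "\<forall>x\<in>\<Phi> ` G'. \<forall>x'\<in>\<Phi> ` G'. (\<forall>j\<in>{1..k}. int H ^ j dvd x j - x' j) \<longrightarrow> x = x'"
          proof (intro ballI impI, elim imageE)
            fix x x' u u' assume u: "x = \<Phi> u" "u \<in> G'" "x' = \<Phi> u'" "u' \<in> G'" and d: "\<forall>j\<in>{1..k}. int H ^ j dvd x j - x' j"
            have "int H ^ j dvd u j - u' j" if "j \<in> {1..Suc k}" for j
            proof (cases "j = Suc k")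
              case True then show ?thesis using dvdG[of u u'] u G'G unfolding M_def by auto
            next
              case False
              then have "int H ^ j dvd x j - x' j" using that d by auto
              moreover have "x j - x' j = - (u j - u' j)" unfolding u \<Phi>_def by simp
              ultimately show ?thesis by (metis dvd_minus_iff)
            qed
            then have "u = u'" using sep u G'G GF by blast
            then show "x = x'" using u by simp
          qed
          moreover have "\<forall>x\<in>\<Phi> ` G'. real H / (2 * t\<^sup>2) \<le> norm (curve_sum k H x)"
            using eqS unfolding G'_def by auto
          moreover have "finite (\<Phi> ` G')" using finG G'G finite_subset by blast
          ultimately show ?thesis using C H t2 unfolding spec_const_def by blast
        qed
        then have cG': "real (card G') \<le> B" unfolding B_def using card_image[OF inj] by simp
        have "(\<Sum>a'\<in>G. norm (curve_sum (Suc k) H (\<lambda>j. a j - a' j)))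
           \<le> (\<Sum>a'\<in>G. (if a' \<in> G' then real H else 0) + real H / (2 * t\<^sup>2))"
          using norm_curve_sum_le by (intro sum_mono) (auto simp: G'_def intro: add_increasing2)
        also have "\<dots> = real (card G') * real H + r * (real H / (2 * t\<^sup>2))"
        proof -
          have "{a'\<in>G. a' \<in> G'} = G'" using G'G by auto
          then show ?thesis unfolding r_def using finG by (simp add: sum.distrib sum.If_cases Int_def)
        qed
        also have "\<dots> \<le> B * real H + r * (real H / (2 * t\<^sup>2))" using cG' by (intro add_right_mono mult_right_mono) auto
        finally show ?thesis .
      qed
      have "r\<^sup>2 * real H / t\<^sup>2 \<le> (\<Sum>a\<in>G. \<Sum>a'\<in>G. norm (curve_sum (Suc k) H (\<lambda>j. a j - a' j)))"
        unfolding r_def using curve_sum_large_pairs[OF finG H, of t "Suc k"] large GF t by auto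
      also have "\<dots> \<le> (\<Sum>a\<in>G. B * real H + r * (real H / (2 * t\<^sup>2)))" by (intro sum_mono inner)
      also have "\<dots> = r * (B * real H + r * (real H / (2 * t\<^sup>2)))" unfolding r_def by simp
      finally have "r * real H * (r / (2 * t\<^sup>2)) \<le> r * real H * B"
        using t by (simp add: field_simps power2_eq_square)
      then have "r \<le> 2 * t\<^sup>2 * B"
      proof (cases "r = 0")
        case True then show ?thesis unfolding B_def using t by simp
      next
        case False
        then have "r * real H > 0" unfolding r_def using H by simp
        then have "r / (2 * t\<^sup>2) \<le> B" using \<open>r * real H * (r / (2 * t\<^sup>2)) \<le> r * real H * B\<close>
          by (subst (asm) mult_le_cancel_left_pos)
        then show ?thesis using t by (simp add: field_simps)
      qed
      then show ?thesis unfolding r_def G_def B_def .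
    qed
    have "card F = (\<Sum>b\<in>R. card {a\<in>F. a (Suc k) mod M = b})"
      using sum.group[OF fin, of R "\<lambda>a. a (Suc k) mod M" "\<lambda>_. 1::nat"] fin unfolding R_def by simp
    then have "real (card F) = (\<Sum>b\<in>R. real (card {a\<in>F. a (Suc k) mod M = b}))" by simp
    moreover have "\<dots> \<le> (\<Sum>b\<in>R. 2 * t\<^sup>2 * (real C * (2 * t\<^sup>2) ^ C))" by (intro sum_mono fibre)
    ultimately have "real (card F) \<le> real (card R) * (2 * t\<^sup>2 * (real C * (2 * t\<^sup>2) ^ C))" by simp
    also have "\<dots> \<le> (15 * Q ^ 3) * (2 * t\<^sup>2 * (real C * (2 * t\<^sup>2) ^ C))"
      using \<open>real (card R) \<le> 15 * Q ^ 3\<close> t by (intro mult_right_mono) auto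
    also have "\<dots> = real A * t ^ (3 * C1 + (2 + 2 * C))"
    proof -
      have "Q ^ 3 = real (C1 ^ 3) * t ^ (3 * C1)" unfolding Q_def by (simp add: power_mult_distrib mult.commute flip: power_mult)
      moreover have "(2 * t\<^sup>2) ^ C = 2 ^ C * t ^ (2 * C)" by (simp add: power_mult_distrib flip: power_mult)
      ultimately show ?thesis unfolding A_def power_add by simp
    qed
    also have "\<dots> \<le> real D * t ^ D" by (rule power_bound_mono[OF t]) (auto simp: D_def)
    finally show "real (card F) \<le> real D * t ^ D" .
  qed
  then show ?thesis by (rule that)
qed

lemma spec_const_exists: "\<exists>C. spec_const k C"
  by (induction k) (use spec_const_0 spec_const_step in metis)+

section \<open>Values of power sums\<close>

text \<open>Listing the values in decreasing order, the hypothesis gives \<open>x ^ (2 * C) \<le> (C / n)\<^sup>2\<close> for the \<open>n\<close>-th one;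
  the induction removes the smallest value.\<close>

lemma sum_power_of_spectrum:
  fixes x :: "'a \<Rightarrow> real"
  assumes fin: "finite A" and x: "\<And>a. a \<in> A \<Longrightarrow> 0 \<le> x a \<and> x a \<le> 1"
    and C: "\<And>B t. B \<subseteq> A \<Longrightarrow> t \<ge> 1 \<Longrightarrow> (\<And>a. a \<in> B \<Longrightarrow> 1 / t \<le> x a) \<Longrightarrow> real (card B) \<le> real C * t ^ C"
    and C1: "C \<ge> 1"
  shows "(\<Sum>a\<in>A. x a ^ (2 * C)) \<le> 2 * (real C)\<^sup>2"
proof -
  have "B \<subseteq> A \<Longrightarrow> (\<Sum>a\<in>B. x a ^ (2 * C)) \<le> (real C)\<^sup>2 * (2 - 1 / real (card B))" for B
  proof (induction "card B" arbitrary: B)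
    case 0
    then have "B = {}" using fin finite_subset by fastforce
    then show ?case by simp
  next
    case (Suc n)
    have finB: "finite B" using Suc fin finite_subset by blast
    have ne: "B \<noteq> {}" using Suc by auto
    obtain a where a: "a \<in> B" "\<And>b. b \<in> B \<Longrightarrow> x a \<le> x b"
      using ex_min_if_finite[of "x ` B"] finB ne by (metis arg_min_if_finite(1) arg_min_least)
    have aA: "a \<in> A" using a Suc by auto
    have xa: "x a ^ (2 * C) \<le> (real C)\<^sup>2 / (real (Suc n))\<^sup>2"
    proof (cases "x a = 0")
      case True then show ?thesis using C1 by (simp add: zero_power)
    next
      case False
      then have pos: "x a > 0" using x[OF aA] by linarith
      have "real (card B) \<le> real C * (1 / x a) ^ C"
        by (rule C) (use Suc a x[OF aA] pos in \<open>auto simp: field_simps\<close>)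
      then have "real (Suc n) * x a ^ C \<le> real C" using pos Suc by (simp add: field_simps)
      then have "(real (Suc n) * x a ^ C)\<^sup>2 \<le> (real C)\<^sup>2" using pos by (intro power_mono) auto
      then have "x a ^ (2 * C) * (real (Suc n))\<^sup>2 \<le> (real C)\<^sup>2"
        by (simp only: power_mult_distrib mult_ac flip: power_mult)
      then show ?thesis by (simp add: field_simps)
    qed
    have "n = card (B - {a})" using Suc a finB by simp
    then have IH: "(\<Sum>a\<in>B - {a}. x a ^ (2 * C)) \<le> (real C)\<^sup>2 * (2 - 1 / real n)"
      using Suc.hyps(1)[of "B - {a}"] Suc.prems by auto
    have "(\<Sum>a\<in>B. x a ^ (2 * C)) = x a ^ (2 * C) + (\<Sum>a\<in>B - {a}. x a ^ (2 * C))"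
      using finB a by (simp add: sum.remove)
    \<comment> \<open>By convention \<open>1 / real n\<close> is 0 for \<open>n = 0\<close>, so a
      single element is treated apart; otherwise the increments
      \<open>1 / (real (Suc n))\<^sup>2\<close> are dominated by a telescoping difference.\<close>
    also have "\<dots> \<le> (real C)\<^sup>2 * (2 - 1 / real (Suc n))"
    proof (cases "n = 0")
      case True
      then have "B - {a} = {}" using \<open>n = card (B - {a})\<close> finB by (metis card_0_eq finite_Diff)
      show ?thesis unfolding \<open>B - {a} = {}\<close> using xa True by simp
    next
      case False
      have "1 / (real (Suc n))\<^sup>2 \<le> 1 / real n - 1 / real (Suc n)"
      proof -
        have "1 / real n - 1 / real (Suc n) = 1 / (real n * real (Suc n))" using False by (simp add: field_simps)
        moreover have "1 / (real (Suc n))\<^sup>2 \<le> 1 / (real n * real (Suc n))"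
          unfolding power2_eq_square using False by (intro divide_left_mono mult_right_mono) auto
        ultimately show ?thesis by simp
      qed
      then have "(real C)\<^sup>2 * (1 / (real (Suc n))\<^sup>2) \<le> (real C)\<^sup>2 * (1 / real n - 1 / real (Suc n))"
        by (intro mult_left_mono) auto
      then show ?thesis using xa IH by (simp add: algebra_simps)
    qed
    finally show ?case using Suc by simp
  qed
  from this[of A] have "(\<Sum>a\<in>A. x a ^ (2 * C)) \<le> (real C)\<^sup>2 * (2 - 1 / real (card A))" by simp
  also have "\<dots> \<le> (real C)\<^sup>2 * 2" by (intro mult_left_mono) auto
  finally show ?thesis by simp
qed

lemma sum_ee_dvd:
  assumes "M \<ge> 1"
  shows "(\<Sum>a\<in>{..<M::nat}. ee (real a * of_int d / real M)) = (if int M dvd d then of_nat M else 0)"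
proof (cases "int M dvd d")
  case True
  then obtain m where m: "d = int M * m" by auto
  have "ee (real a * of_int d / real M) = 1" for a
    using ee_of_int[of "int a * m"] assms unfolding m by (simp add: mult_ac)
  then show ?thesis using True by simp
next
  case False
  define w where "w = ee (of_int d / real M)"
  have w: "ee (real a * of_int d / real M) = w ^ a" for a
  proof (induction a)
    case 0 show ?case by simp
  next
    case (Suc a)
    have "ee (real (Suc a) * of_int d / real M) = ee (of_int d / real M + real a * of_int d / real M)"
      by (simp add: algebra_simps add_divide_distrib)
    then show ?case using Suc by (simp add: ee_add w_def)
  qed
  have "w ^ M = 1" using w[of M] assms by simp
  moreover have "w \<noteq> 1"
  proof
    assume "w = 1"
    then have "\<bar>of_int d / real M - of_int (round (of_int d / real M))\<bar> \<le> 0"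
      using norm_ee_minus_one_ge[of "of_int d / real M"] unfolding w_def by simp
    then have "of_int d = real M * of_int (round (of_int d / real M))" using assms by (simp add: field_simps)
    then have "d = int M * round (of_int d / real M)" by (metis of_int_eq_iff of_int_mult of_int_of_nat_eq)
    then show False using False by (metis dvd_triv_left)
  qed
  ultimately show ?thesis unfolding w using False by (simp add: geometric_sum sum_gp_strict)
qed

text \<open>Cauchy-Schwarz over the fibres of \<open>V\<close>: few coincidences force many
  values.\<close>

lemma card_image_ge_of_energy:
  assumes fin: "finite Y"
  shows "(real (card Y))\<^sup>2 \<le> real (card (V ` Y)) * real (card {(y, y'). y \<in> Y \<and> y' \<in> Y \<and> V y = V y'})"
proof -
  define r where "r = (\<lambda>v. real (card {y\<in>Y. V y = v}))"
  have "real (card Y) = (\<Sum>v\<in>V ` Y. 1 * r v)"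
    using sum.group[OF fin, of "V ` Y" V "\<lambda>_. 1::real"] fin unfolding r_def by simp
  then have "(real (card Y))\<^sup>2 \<le> (\<Sum>v\<in>V ` Y. 1\<^sup>2) * (\<Sum>v\<in>V ` Y. (r v)\<^sup>2)"
    using Cauchy_Schwarz_ineq_sum[of "\<lambda>_. 1" r "V ` Y"] by simp
  also have "(\<Sum>v\<in>V ` Y. (r v)\<^sup>2) = real (card {(y, y'). y \<in> Y \<and> y' \<in> Y \<and> V y = V y'})"
  proof -
    have e: "{(y, y'). y \<in> Y \<and> y' \<in> Y \<and> V y = V y'} = (SIGMA y:Y. {y'\<in>Y. V y' = V y})" by auto
    have "real (card {(y, y'). y \<in> Y \<and> y' \<in> Y \<and> V y = V y'}) = (\<Sum>y\<in>Y. r (V y))"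
      unfolding e r_def using fin by (subst card_SigmaI) auto
    also have "\<dots> = (\<Sum>v\<in>V ` Y. \<Sum>y\<in>{y\<in>Y. V y = v}. r (V y))"
      using fin by (subst sum.group) auto
    also have "\<dots> = (\<Sum>v\<in>V ` Y. (r v)\<^sup>2)"
      by (intro sum.cong refl) (simp add: r_def power2_eq_square)
    finally show ?thesis by simp
  qed
  finally show ?thesis by simp
qed

text \<open>Vinogradov's mean value for many variables in its exact order. Orthogonality over
  \<open>G\<close> writes the number of solutions of the congruences as a mean of
  \<open>norm (S a) ^ (2 * s)\<close>. The spectrum bound makes the normalised moment at most
  \<open>2 * s\<^sup>2\<close> as soon as \<open>s\<close> reaches the spectral exponent, and few
  coincidences then mean many distinct vectors.\<close>

lemma power_sum_vectors:
  obtains s C :: nat where "s \<ge> 1" "C \<ge> 1"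
    "\<And>H. H \<ge> 1 \<Longrightarrow> real (\<Prod>j=1..k. H ^ j)
      \<le> real C * real (card ((\<lambda>y. \<lambda>j\<in>{1..k}. \<Sum>i<s. y i ^ j) ` (PiE {..<s} (\<lambda>_. {1..H}))))"
proof -
  obtain C0 where C0: "spec_const k C0" using spec_const_exists by blast
  \<comment> \<open>One number is used as constant and exponent of the spectrum bound and as the
    number of variables.\<close>
  define s where "s = max 1 C0"
  have C: "real (card F) \<le> real s * t ^ s" if "H \<ge> 1" "t \<ge> 1" "finite F"
     "\<forall>a\<in>F. \<forall>a'\<in>F. (\<forall>j\<in>{1..k}. int H ^ j dvd a j - a' j) \<longrightarrow> a = a'"
     "\<forall>a\<in>F. real H / t \<le> norm (curve_sum k H a)" for H and t :: real and F
  proof -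
    have "real (card F) \<le> real C0 * t ^ C0" using C0 that unfolding spec_const_def by blast
    also have "\<dots> \<le> real s * t ^ s" by (rule power_bound_mono) (use that in \<open>auto simp: s_def\<close>)
    finally show ?thesis .
  qed
  have "real (\<Prod>j=1..k. H ^ j) \<le> real (2 * s\<^sup>2) * real (card ((\<lambda>y. \<lambda>j\<in>{1..k}. \<Sum>i<s. y i ^ j) ` (PiE {..<s} (\<lambda>_. {1..H}))))"
    if H: "H \<ge> 1" for H :: nat
  proof -
    define Y where "Y = PiE {..<s} (\<lambda>_. {1..H})"
    define G where "G = PiE {1..k} (\<lambda>j. {..<H ^ j})"
    define V where "V = (\<lambda>y::nat \<Rightarrow> nat. \<lambda>j\<in>{1..k}. \<Sum>i<s. y i ^ j)"
    define d where "d = (\<lambda>y y' j. (\<Sum>i<s. int (y i) ^ j) - (\<Sum>i<s. int (y' i) ^ j))"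
    define \<phi> where "\<phi> = (\<lambda>(a::nat \<Rightarrow> nat) (y::nat). \<Sum>j=1..k. real (a j) * real y ^ j / real H ^ j)"
    define S where "S = (\<lambda>a::nat \<Rightarrow> nat. curve_sum k H (\<lambda>j. int (a j)))"
    have finY: "finite Y" and finG: "finite G" unfolding Y_def G_def by (auto intro!: finite_PiE)
    have cY: "card Y = H ^ s" unfolding Y_def by (simp add: card_PiE)
    have cG: "card G = (\<Prod>j=1..k. H ^ j)" unfolding G_def by (simp add: card_PiE)
    have S: "S a = (\<Sum>y\<in>{1..H}. ee (\<phi> a y))" for a
    proof -
      have "{1..int H} = int ` {1..H}" by (simp add: image_int_atLeastAtMost)
      then show ?thesis unfolding S_def curve_sum_def \<phi>_def by (simp add: sum.reindex)
    qed
    have Sp: "S a ^ s = (\<Sum>y\<in>Y. ee (\<Sum>i<s. \<phi> a (y i)))" for a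
    proof -
      have "S a ^ s = (\<Prod>i\<in>{..<s}. \<Sum>y\<in>{1..H}. ee (\<phi> a y))" unfolding S by simp
      also have "\<dots> = (\<Sum>y\<in>Y. \<Prod>i\<in>{..<s}. ee (\<phi> a (y i)))" unfolding Y_def by (rule prod_sum_PiE) auto
      finally show ?thesis by (simp add: ee_sum)
    qed
    have detect: "(\<Sum>a\<in>G. ee (\<Sum>j=1..k. real (a j) * of_int (d y y' j) / real (H ^ j))) = (if \<forall>j\<in>{1..k}. int (H ^ j) dvd d y y' j then of_nat (card G) else 0)" for y y'
    proof -
      have "(\<Sum>a\<in>G. ee (\<Sum>j=1..k. real (a j) * of_int (d y y' j) / real (H ^ j)))
        = (\<Sum>a\<in>G. \<Prod>j\<in>{1..k}. ee (real (a j) * of_int (d y y' j) / real (H ^ j)))" by (simp add: ee_sum)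
      also have "\<dots> = (\<Prod>j\<in>{1..k}. \<Sum>a\<in>{..<H ^ j}. ee (real a * of_int (d y y' j) / real (H ^ j)))"
        unfolding G_def by (rule prod_sum_PiE[symmetric]) auto
      also have "\<dots> = (\<Prod>j\<in>{1..k}. if int (H ^ j) dvd d y y' j then of_nat (H ^ j) else 0)"
        using H by (intro prod.cong refl sum_ee_dvd) (simp add: Suc_le_eq)
      also have "\<dots> = (if \<forall>j\<in>{1..k}. int (H ^ j) dvd d y y' j then of_nat (card G) else 0)"
      proof (cases "\<forall>j\<in>{1..k}. int (H ^ j) dvd d y y' j")
        case True then show ?thesis unfolding cG by simp
      next
        case False
        then obtain j where "j \<in> {1..k}" "\<not> int (H ^ j) dvd d y y' j" by blast
        then have "(\<Prod>j\<in>{1..k}. if int (H ^ j) dvd d y y' j then of_nat (H ^ j) else 0) = (0::complex)"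
          by (intro prod_zero) auto
        then show ?thesis using False by auto
      qed
      finally show ?thesis .
    qed
    \<comment> \<open>For an upper bound the equations may be relaxed to congruences modulo
      \<open>H ^ j\<close>, and these are detected exactly by the finite group
      \<open>G\<close>.\<close>
    define E where "E = {(y, y'). y \<in> Y \<and> y' \<in> Y \<and> (\<forall>j\<in>{1..k}. int (H ^ j) dvd d y y' j)}"
    have E_eq: "real (card E) * real (card G) = (\<Sum>a\<in>G. norm (S a) ^ (2 * s))"
    proof -
      have ph: "(\<Sum>i<s. \<phi> a (y i)) - (\<Sum>i<s. \<phi> a (y' i)) = (\<Sum>j=1..k. real (a j) * of_int (d y y' j) / real (H ^ j))" for a y y'
      proof -
        have "(\<Sum>i<s. \<phi> a (y i)) = (\<Sum>j=1..k. real (a j) * of_int (\<Sum>i<s. int (y i) ^ j) / real (H ^ j))" for y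
          unfolding \<phi>_def by (subst sum.swap) (simp add: sum_distrib_left sum_divide_distrib)
        then show ?thesis unfolding d_def by (simp add: algebra_simps diff_divide_distrib sum_subtractf)
      qed
      have "complex_of_real (norm z ^ (2 * s)) = z ^ s * cnj (z ^ s)" for z
      proof -
        have "complex_of_real (norm z ^ (2 * s)) = (complex_of_real ((norm z)\<^sup>2)) ^ s" by (simp add: power_mult)
        also have "\<dots> = z ^ s * cnj (z ^ s)" unfolding complex_norm_square by (simp add: power_mult_distrib)
        finally show ?thesis .
      qed
      then have "complex_of_real (\<Sum>a\<in>G. norm (S a) ^ (2 * s)) = (\<Sum>a\<in>G. S a ^ s * cnj (S a ^ s))"
        by (simp only: of_real_sum)
      also have "\<dots> = (\<Sum>a\<in>G. \<Sum>y\<in>Y. \<Sum>y'\<in>Y. ee ((\<Sum>i<s. \<phi> a (y i)) - (\<Sum>i<s. \<phi> a (y' i))))"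
        unfolding Sp ee_diff by (simp add: cnj_sum sum_product)
      also have "\<dots> = (\<Sum>y\<in>Y. \<Sum>y'\<in>Y. \<Sum>a\<in>G. ee ((\<Sum>i<s. \<phi> a (y i)) - (\<Sum>i<s. \<phi> a (y' i))))"
        by (subst sum.swap) (intro sum.cong refl sum.swap)
      also have "\<dots> = (\<Sum>y\<in>Y. \<Sum>y'\<in>Y. if \<forall>j\<in>{1..k}. int (H ^ j) dvd d y y' j then of_nat (card G) else 0)"
        unfolding ph detect ..
      also have "\<dots> = (\<Sum>p\<in>Y \<times> Y. if \<forall>j\<in>{1..k}. int (H ^ j) dvd d (fst p) (snd p) j then of_nat (card G) else 0)"
        by (simp add: sum.cartesian_product case_prod_unfold)
      also have "\<dots> = (\<Sum>p\<in>E. of_nat (card G))"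
        using finY by (intro sum.mono_neutral_cong_right) (auto simp: E_def)
      also have "\<dots> = complex_of_real (real (card E) * real (card G))" by simp
      finally show ?thesis using of_real_eq_iff by metis
    qed
    have "(\<Sum>a\<in>G. (norm (S a) / real H) ^ (2 * s)) \<le> 2 * (real s)\<^sup>2"
    proof (rule sum_power_of_spectrum[OF finG])
      show "0 \<le> norm (S a) / real H \<and> norm (S a) / real H \<le> 1" for a
        using norm_curve_sum_le[of k H "\<lambda>j. int (a j)"] H unfolding S_def by simp
      show "1 \<le> s" unfolding s_def by simp
      fix B and t :: real
      assume B: "B \<subseteq> G" and t: "1 \<le> t" and l: "\<And>a. a \<in> B \<Longrightarrow> 1 / t \<le> norm (S a) / real H"
      define F where "F = (\<lambda>a j. int (a j)) ` B"
      have inj: "inj_on (\<lambda>a j. int (a j)) B" by (auto simp: inj_on_def fun_eq_iff)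
      have "real (card F) \<le> real s * t ^ s"
      proof (rule C[OF H t])
        show "finite F" unfolding F_def using B finG finite_subset by blast
        show "\<forall>a\<in>F. real H / t \<le> norm (curve_sum k H a)"
          unfolding F_def using l H t unfolding S_def by (auto simp: field_simps)
        show "\<forall>a\<in>F. \<forall>a'\<in>F. (\<forall>j\<in>{1..k}. int H ^ j dvd a j - a' j) \<longrightarrow> a = a'"
        proof (intro ballI impI)
          fix u u' assume u: "u \<in> F" "u' \<in> F" "\<forall>j\<in>{1..k}. int H ^ j dvd u j - u' j"
          then obtain a a' where a: "a \<in> B" "a' \<in> B" "u = (\<lambda>j. int (a j))" "u' = (\<lambda>j. int (a' j))"
            unfolding F_def by auto
          have "a j = a' j" for j
          proof (cases "j \<in> {1..k}")
            case True
            have "a \<in> G" "a' \<in> G" using a B by auto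
            then have "a j \<in> {..<H ^ j}" "a' j \<in> {..<H ^ j}" using True unfolding G_def by (blast intro: PiE_mem)+
            then have "a j < H ^ j" "a' j < H ^ j" by auto
            moreover have "int (H ^ j) dvd int (a j) - int (a' j)" using u(3) True unfolding a by auto
            then have "int (a j) mod int (H ^ j) = int (a' j) mod int (H ^ j)" by (simp add: mod_eq_dvd_iff)
            then have "a j mod H ^ j = a' j mod H ^ j" by (metis of_nat_eq_iff of_nat_mod)
            ultimately show ?thesis by simp
          next
            case False
            then show ?thesis using a B unfolding G_def by (metis PiE_arb subsetD)
          qed
          then show "u = u'" unfolding a by simp
        qed
      qed
      then show "real (card B) \<le> real s * t ^ s" unfolding F_def using card_image[OF inj] by simp
    qed
    then have "(\<Sum>a\<in>G. norm (S a) ^ (2 * s)) \<le> 2 * (real s)\<^sup>2 * real H ^ (2 * s)"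
      using H by (simp add: power_divide sum_divide_distrib[symmetric] field_simps)
    then have energy: "real (card E) * real (card G) \<le> 2 * (real s)\<^sup>2 * real H ^ (2 * s)" using E_eq by simp
    define E' where "E' = {(y, y'). y \<in> Y \<and> y' \<in> Y \<and> V y = V y'}"
    have "E' \<subseteq> E"
    proof (clarsimp simp: E'_def E_def)
      fix y y' j assume "V y = V y'" "Suc 0 \<le> j" "j \<le> k"
      then have "V y j = V y' j" by simp
      then have "(\<Sum>i<s. y i ^ j) = (\<Sum>i<s. y' i ^ j)" using \<open>Suc 0 \<le> j\<close> \<open>j \<le> k\<close> unfolding V_def by simp
      then have "int (\<Sum>i<s. y i ^ j) = int (\<Sum>i<s. y' i ^ j)" by simp
      then show "int H ^ j dvd d y y' j" unfolding d_def by simp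
    qed
    moreover have "finite E" using finite_subset[of E "Y \<times> Y"] finY unfolding E_def by auto
    ultimately have "card E' \<le> card E" by (intro card_mono)
    have "(real (card Y))\<^sup>2 * real (card G) \<le> real (card (V ` Y)) * real (card E') * real (card G)"
      using card_image_ge_of_energy[OF finY, of V] unfolding E'_def by (intro mult_right_mono) auto
    also have "\<dots> \<le> real (card (V ` Y)) * (real (card E) * real (card G))"
      using \<open>card E' \<le> card E\<close> by (simp add: mult_left_mono mult_right_mono mult.assoc)
    also have "\<dots> \<le> real (card (V ` Y)) * (2 * (real s)\<^sup>2 * real H ^ (2 * s))"
      by (intro mult_left_mono energy) auto
    finally have "real H ^ (2 * s) * real (card G) \<le> real H ^ (2 * s) * (2 * (real s)\<^sup>2 * real (card (V ` Y)))"
      unfolding cY by (simp add: power_mult mult_ac flip: power_mult)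
    moreover have "real H ^ (2 * s) > 0" using H by simp
    ultimately have "real (card G) \<le> 2 * (real s)\<^sup>2 * real (card (V ` Y))"
      by (subst (asm) mult_le_cancel_left_pos)
    then show ?thesis unfolding cG V_def Y_def by simp
  qed
  then show ?thesis using that[of s "2 * s\<^sup>2"] unfolding s_def by simp
qed

text \<open>The power sums below the top one take at most \<open>s ^ (k - 1)\<close> times the
  product of the \<open>H ^ j\<close> with \<open>j < k\<close> values. Since the number of full
  vectors has exact order, some choice of lower power sums is completed by at least
  \<open>\<delta> * H ^ k\<close> top values; \<open>B\<close> holds one tuple for each of
  them.\<close>

lemma power_sum_fibre:
  assumes k: "k \<ge> 1"
  obtains s :: nat and \<delta> :: real where "s \<ge> 1" "\<delta> > 0"
    "\<And>H. H \<ge> 1 \<Longrightarrow> \<exists>B. B \<subseteq> PiE {..<s} (\<lambda>_. {1..H}) \<and> \<delta> * real H ^ k \<le> real (card B) \<and> inj_on (\<lambda>y. \<Sum>i<s. y i ^ k) B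
       \<and> (\<forall>y\<in>B. \<forall>y'\<in>B. \<forall>j\<in>{1..<k}. (\<Sum>i<s. y i ^ j) = (\<Sum>i<s. y' i ^ j))"
proof -
  obtain s C :: nat where s: "s \<ge> 1" "C \<ge> 1"
    and sC: "\<And>H. H \<ge> 1 \<Longrightarrow> real (\<Prod>j=1..k. H ^ j)
      \<le> real C * real (card ((\<lambda>y. \<lambda>j\<in>{1..k}. \<Sum>i<s. y i ^ j) ` (PiE {..<s} (\<lambda>_. {1..H}))))"
    using power_sum_vectors[of k] by metis
  define \<delta> where "\<delta> = 1 / (real C * real s ^ (k - 1))"
  have "\<exists>B. B \<subseteq> PiE {..<s} (\<lambda>_. {1..H}) \<and> \<delta> * real H ^ k \<le> real (card B) \<and> inj_on (\<lambda>y. \<Sum>i<s. y i ^ k) B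
       \<and> (\<forall>y\<in>B. \<forall>y'\<in>B. \<forall>j\<in>{1..<k}. (\<Sum>i<s. y i ^ j) = (\<Sum>i<s. y' i ^ j))" if H: "H \<ge> 1" for H
  proof -
    define Y where "Y = PiE {..<s} (\<lambda>_. {1..H})"
    define V where "V = (\<lambda>y::nat \<Rightarrow> nat. \<lambda>j\<in>{1..k}. \<Sum>i<s. y i ^ j)"
    define L where "L = PiE {1..<k} (\<lambda>j. {1..s * H ^ j})"
    have finV: "finite (V ` Y)" unfolding Y_def by (intro finite_imageI finite_PiE) auto
    have finL: "finite L" unfolding L_def by (intro finite_PiE) auto
    have "(\<lambda>v. restrict v {1..<k}) ` V ` Y \<subseteq> L"
    proof -
      have "(\<Sum>i<s. y i ^ j) \<in> {1..s * H ^ j}" if y: "y \<in> Y" for y j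
      proof -
        have "y i \<in> {1..H}" if "i < s" for i
          using PiE_mem[OF y[unfolded Y_def], of i] that by simp
        then have yi: "1 \<le> y i" "y i \<le> H" if "i < s" for i using that by simp_all
        have "1 \<le> y 0 ^ j" using yi[of 0] s by (simp add: Suc_le_eq)
        also have "\<dots> \<le> (\<Sum>i<s. y i ^ j)" using s by (intro member_le_sum) auto
        finally have 1: "1 \<le> (\<Sum>i<s. y i ^ j)" .
        have "(\<Sum>i<s. y i ^ j) \<le> (\<Sum>i<s. H ^ j)" using yi by (intro sum_mono power_mono) auto
        then show ?thesis using 1 by simp
      qed
      then have "restrict (V y) {1..<k} \<in> L" if "y \<in> Y" for y
      proof -
        have "V y j = (\<Sum>i<s. y i ^ j)" if "j \<in> {1..<k}" for j using that unfolding V_def by auto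
        then show ?thesis using \<open>\<And>y j. y \<in> Y \<Longrightarrow> (\<Sum>i<s. y i ^ j) \<in> {1..s * H ^ j}\<close>[OF that]
          unfolding L_def PiE_iff by (auto simp del: atLeastAtMost_iff)
      qed
      then show ?thesis by blast
    qed
    moreover have "L \<noteq> {}" unfolding L_def using s H by (auto simp: PiE_eq_empty_iff Suc_le_eq)
    ultimately obtain b where b: "b \<in> L" "card (V ` Y) \<le> card L * card {v \<in> V ` Y. restrict v {1..<k} = b}"
      using pigeonhole_fibre[OF finV finL] by blast
    define W where "W = {v \<in> V ` Y. restrict v {1..<k} = b}"
    define B where "B = inv_into Y V ` W"
    have WY: "W \<subseteq> V ` Y" unfolding W_def by auto
    have BY: "B \<subseteq> Y" unfolding B_def using WY by (auto intro: inv_into_into)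
    have cB: "card B = card W" unfolding B_def using WY by (intro card_image inj_on_inv_into)
    have VB: "V y \<in> W" if "y \<in> B" for y using that WY unfolding B_def by (auto simp: f_inv_into_f subset_iff)
    have invB: "inv_into Y V (V y) = y" if "y \<in> B" for y using that WY unfolding B_def by (auto simp: f_inv_into_f subset_iff)
    have eqs: "(\<Sum>i<s. y i ^ j) = b j" if "y \<in> B" "j \<in> {1..<k}" for y j
    proof -
      have "restrict (V y) {1..<k} j = b j" using VB[OF that(1)] unfolding W_def by auto
      then show ?thesis using that(2) unfolding V_def by simp
    qed
    have inj: "inj_on (\<lambda>y. \<Sum>i<s. y i ^ k) B"
    proof (rule inj_onI)
      fix y y' assume y: "y \<in> B" "y' \<in> B" "(\<Sum>i<s. y i ^ k) = (\<Sum>i<s. y' i ^ k)"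
      have "V y = V y'" unfolding V_def
      proof (intro restrict_ext)
        fix j assume "j \<in> {1..k}"
        then show "(\<Sum>i<s. y i ^ j) = (\<Sum>i<s. y' i ^ j)" using y eqs[of y j] eqs[of y' j] by (cases "j = k") auto
      qed
      then show "y = y'" using invB y by metis
    qed
    have cL: "real (card L) = real s ^ (k - 1) * (\<Prod>j\<in>{1..<k}. real H ^ j)"
      unfolding L_def by (simp add: card_PiE prod.distrib)
    have ins: "{1..k} = insert k {1..<k}" using k by auto
    have "real H ^ k * (\<Prod>j\<in>{1..<k}. real H ^ j) = real (\<Prod>j=1..k. H ^ j)"
      unfolding ins by simp
    also have "\<dots> \<le> real C * real (card (V ` Y))" using sC[OF H] unfolding V_def Y_def .
    also have "\<dots> \<le> real C * (real (card L) * real (card B))"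
      using b(2) unfolding cB W_def by (intro mult_left_mono) (auto simp flip: of_nat_mult)
    also have "\<dots> = (\<Prod>j\<in>{1..<k}. real H ^ j) * (real C * real s ^ (k - 1) * real (card B))" unfolding cL by simp
    finally have "(\<Prod>j\<in>{1..<k}. real H ^ j) * real H ^ k \<le> (\<Prod>j\<in>{1..<k}. real H ^ j) * (real C * real s ^ (k - 1) * real (card B))"
      by (simp add: mult.commute)
    moreover have "(\<Prod>j\<in>{1..<k}. real H ^ j) > 0" using H by (intro prod_pos) auto
    ultimately have "real H ^ k \<le> real C * real s ^ (k - 1) * real (card B)" by (subst (asm) mult_le_cancel_left_pos)
    then have "\<delta> * real H ^ k \<le> real (card B)" unfolding \<delta>_def using s by (simp add: field_simps)
    moreover have "\<forall>y\<in>B. \<forall>y'\<in>B. \<forall>j\<in>{1..<k}. (\<Sum>i<s. y i ^ j) = (\<Sum>i<s. y' i ^ j)" using eqs by simp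
    ultimately show ?thesis using BY inj unfolding Y_def by blast
  qed
  moreover have "\<delta> > 0" unfolding \<delta>_def using s by simp
  ultimately show ?thesis using that[of s \<delta>] s by blast
qed

section \<open>Hardy fields\<close>

definition ev_signed :: "(real \<Rightarrow> real) \<Rightarrow> bool" where
  "ev_signed f \<longleftrightarrow> (\<forall>\<^sub>F x in at_top. f x > 0) \<or> (\<forall>\<^sub>F x in at_top. f x = 0) \<or> (\<forall>\<^sub>F x in at_top. f x < 0)"

lemma ev_signed_cong: "\<forall>\<^sub>F x in at_top. f x = g x \<Longrightarrow> ev_signed f \<Longrightarrow> ev_signed g"
proof -
  assume e: "\<forall>\<^sub>F x in at_top. f x = g x" and f: "ev_signed f"
  have "\<forall>\<^sub>F x in at_top. P (g x)" if "\<forall>\<^sub>F x in at_top. P (f x)" for P :: "real \<Rightarrow> bool"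
    using e that by eventually_elim simp
  from this[of "\<lambda>u. u > 0"] this[of "\<lambda>u. u = 0"] this[of "\<lambda>u. u < 0"] f show ?thesis
    unfolding ev_signed_def by blast
qed

lemma ev_signed_minus: "ev_signed f \<Longrightarrow> ev_signed (\<lambda>x. - f x)"
  unfolding ev_signed_def by auto

lemma ev_signed_mult: "ev_signed f \<Longrightarrow> ev_signed g \<Longrightarrow> ev_signed (\<lambda>x. f x * g x)"
proof -
  have *: "\<forall>\<^sub>F x in at_top. Q (f x * g x)"
    if "\<forall>\<^sub>F x in at_top. P1 (f x)" "\<forall>\<^sub>F x in at_top. P2 (g x)" "\<And>u v. P1 u \<Longrightarrow> P2 v \<Longrightarrow> Q (u * v)" for P1 P2 Q :: "real \<Rightarrow> bool"
    using that(1,2) by eventually_elim (rule that(3))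
  assume "ev_signed f" "ev_signed g"
  then show ?thesis
    unfolding ev_signed_def
    using *[of "\<lambda>u. u > 0" "\<lambda>u. u > 0" "\<lambda>u. u > 0"] *[of "\<lambda>u. u > 0" "\<lambda>u. u < 0" "\<lambda>u. u < 0"]
      *[of "\<lambda>u. u < 0" "\<lambda>u. u > 0" "\<lambda>u. u < 0"] *[of "\<lambda>u. u < 0" "\<lambda>u. u < 0" "\<lambda>u. u > 0"]
      *[of "\<lambda>u. u = 0" "\<lambda>_. True" "\<lambda>u. u = 0"] *[of "\<lambda>_. True" "\<lambda>u. u = 0" "\<lambda>u. u = 0"]
    by (auto simp: mult_neg_neg mult_pos_neg mult_neg_pos)
qed

lemma ev_deriv_nonneg_mono:
  fixes f :: "real \<Rightarrow> real"
  assumes "\<forall>\<^sub>F x in at_top. (f has_real_derivative f' x) (at x)" "\<forall>\<^sub>F x in at_top. f' x \<ge> 0"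
  obtains a where "\<And>x y. a \<le> x \<Longrightarrow> x \<le> y \<Longrightarrow> f x \<le> f y"
proof -
  have "\<forall>\<^sub>F x in at_top. (f has_real_derivative f' x) (at x) \<and> f' x \<ge> 0"
    using assms by eventually_elim auto
  then obtain a where a: "\<And>x. x \<ge> a \<Longrightarrow> (f has_real_derivative f' x) (at x) \<and> f' x \<ge> 0"
    by (auto simp: eventually_at_top_linorder)
  have "f x \<le> f y" if "a \<le> x" "x \<le> y" for x y
    using that by (intro DERIV_nonneg_imp_nondecreasing[OF that(2)]) (meson a order_trans)
  then show ?thesis using that by blast
qed

lemma ev_deriv_pos_strict_mono:
  fixes f :: "real \<Rightarrow> real"
  assumes "\<forall>\<^sub>F x in at_top. (f has_real_derivative f' x) (at x)" "\<forall>\<^sub>F x in at_top. f' x > 0"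
  obtains a where "\<And>x y. a \<le> x \<Longrightarrow> x < y \<Longrightarrow> f x < f y"
proof -
  have "\<forall>\<^sub>F x in at_top. (f has_real_derivative f' x) (at x) \<and> f' x > 0"
    using assms by eventually_elim auto
  then obtain a where a: "\<And>x. x \<ge> a \<Longrightarrow> (f has_real_derivative f' x) (at x) \<and> f' x > 0"
    by (auto simp: eventually_at_top_linorder)
  have "f x < f y" if "a \<le> x" "x < y" for x y
    using that by (intro DERIV_pos_imp_increasing[OF that(2)]) (meson a order_trans)
  then show ?thesis using that by blast
qed

lemma ev_signed_of_deriv_pos:
  fixes f :: "real \<Rightarrow> real"
  assumes "\<forall>\<^sub>F x in at_top. (f has_real_derivative f' x) (at x)" "\<forall>\<^sub>F x in at_top. f' x > 0"
  shows "ev_signed f"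
proof -
  obtain a where a: "\<And>x y. a \<le> x \<Longrightarrow> x < y \<Longrightarrow> f x < f y" by (rule ev_deriv_pos_strict_mono[OF assms]) blast
  show ?thesis
  proof (cases "\<exists>x\<ge>a. f x \<ge> 0")
    case True
    then obtain x where "x \<ge> a" "f x \<ge> 0" by blast
    then have "\<forall>y>x. f y > 0" using a by fastforce
    then show ?thesis unfolding ev_signed_def using eventually_at_top_dense by blast
  next
    case False
    then have "\<forall>y\<ge>a. f y < 0" by force
    then show ?thesis unfolding ev_signed_def using eventually_at_top_linorder by blast
  qed
qed

lemma ev_signed_of_deriv:
  fixes f :: "real \<Rightarrow> real"
  assumes d: "\<forall>\<^sub>F x in at_top. (f has_real_derivative f' x) (at x)" and s: "ev_signed f'"
  shows "ev_signed f"
  using s unfolding ev_signed_def[of f']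
proof (elim disjE)
  assume "\<forall>\<^sub>F x in at_top. 0 < f' x"
  then show ?thesis using ev_signed_of_deriv_pos d by blast
next
  assume "\<forall>\<^sub>F x in at_top. f' x < 0"
  moreover have "\<forall>\<^sub>F x in at_top. ((\<lambda>x. - f x) has_real_derivative - f' x) (at x)"
    using d by eventually_elim (rule DERIV_minus)
  ultimately have "ev_signed (\<lambda>x. - f x)" using ev_signed_of_deriv_pos[of "\<lambda>x. - f x" "\<lambda>x. - f' x"] by simp
  then show ?thesis using ev_signed_minus by fastforce
next
  assume "\<forall>\<^sub>F x in at_top. f' x = 0"
  with d have "\<forall>\<^sub>F x in at_top. (f has_real_derivative 0) (at x)" by eventually_elim auto
  then obtain a where a: "\<And>x. x \<ge> a \<Longrightarrow> (f has_real_derivative 0) (at x)"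
    by (auto simp: eventually_at_top_linorder)
  have const: "f x = f a" if "x > a" for x
  proof -
    have "\<exists>z>a. z < x \<and> f x - f a = (x - a) * 0" using a that by (intro MVT2) auto
    then show ?thesis by auto
  qed
  then have "\<forall>\<^sub>F x in at_top. f a = f x" unfolding eventually_at_top_dense by metis
  then show ?thesis
    by (rule ev_signed_cong) (auto simp: ev_signed_def)
qed

text \<open>What the analysis uses of a Hardy field, for functions in place of germs. With a ring
  instead of a field, adjoining the identity function only introduces polynomials; growth rates are
  compared through the signs of ring expressions.\<close>

locale hardy_ring =
  fixes R :: "(real \<Rightarrow> real) set"
  assumes R_rat: "(\<lambda>_. of_rat c) \<in> R"
    and R_id: "(\<lambda>x. x) \<in> R"
    and R_add: "f \<in> R \<Longrightarrow> g \<in> R \<Longrightarrow> (\<lambda>x. f x + g x) \<in> R"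
    and R_mult: "f \<in> R \<Longrightarrow> g \<in> R \<Longrightarrow> (\<lambda>x. f x * g x) \<in> R"
    and R_deriv: "f \<in> R \<Longrightarrow> \<exists>f'\<in>R. \<forall>\<^sub>F x in at_top. (f has_real_derivative f' x) (at x)"
    and R_signed: "f \<in> R \<Longrightarrow> ev_signed f"

section \<open>Functions with germs in a Hardy field, and polynomials over them\<close>

context
  fixes H :: "germ set"
  assumes H: "hardy_field H"
begin

definition "HF = {h. germ_of h \<in> H}"

lemma subfield_H: "subfield H germ_ring"
  using H by (simp add: hardy_field_def)

lemma H_subring: "subring H germ_ring"
  using subfieldE(1)[OF subfield_H] .

lemma HF_add: "f \<in> HF \<Longrightarrow> g \<in> HF \<Longrightarrow> (\<lambda>x. f x + g x) \<in> HF"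
  using subringE(7)[OF H_subring, of "germ_of f" "germ_of g"]
  by (simp add: HF_def germ_ring_def plus_germ.abs_eq)

lemma HF_mult: "f \<in> HF \<Longrightarrow> g \<in> HF \<Longrightarrow> (\<lambda>x. f x * g x) \<in> HF"
  using subringE(6)[OF H_subring, of "germ_of f" "germ_of g"]
  by (simp add: HF_def germ_ring_def times_germ.abs_eq)

lemma HF_0: "(\<lambda>_. 0) \<in> HF"
  using subringE(2)[OF H_subring] by (simp add: HF_def germ_ring_def zero_germ_def)

lemma HF_1: "(\<lambda>_. 1) \<in> HF"
  using subringE(3)[OF H_subring] by (simp add: HF_def germ_ring_def one_germ_def)

lemma HF_cong: "\<forall>\<^sub>F x in at_top. f x = g x \<Longrightarrow> f \<in> HF \<Longrightarrow> g \<in> HF"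
proof -
  assume "\<forall>\<^sub>F x in at_top. f x = g x" "f \<in> HF"
  moreover from this have "germ_of f = germ_of g" by (simp add: germ.abs_eq_iff germ_eq_def)
  ultimately show ?thesis by (simp add: HF_def)
qed

lemma HF_inverse:
  assumes f: "f \<in> HF" and nz: "\<not> (\<forall>\<^sub>F x in at_top. f x = 0)"
  obtains g where "g \<in> HF" "\<forall>\<^sub>F x in at_top. f x * g x = 1"
proof -
  interpret cring germ_ring by (rule cring_germ_ring)
  have ne: "germ_of f \<in> H - {\<zero>\<^bsub>germ_ring\<^esub>}"
    using f nz by (simp add: HF_def germ_ring_def zero_germ_def germ.abs_eq_iff germ_eq_def)
  have "inv\<^bsub>germ_ring\<^esub> (germ_of f) \<in> H - {\<zero>\<^bsub>germ_ring\<^esub>}"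
    and i: "germ_of f \<otimes>\<^bsub>germ_ring\<^esub> inv\<^bsub>germ_ring\<^esub> (germ_of f) = \<one>\<^bsub>germ_ring\<^esub>"
    using subfield_m_inv[OF subfield_H ne] by blast+
  moreover obtain g where g: "inv\<^bsub>germ_ring\<^esub> (germ_of f) = germ_of g"
    by (metis Quotient3_abs_rep Quotient3_germ)
  ultimately have "g \<in> HF" "germ_of (\<lambda>x. f x * g x) = germ_of (\<lambda>_. 1)"
    by (simp_all add: HF_def germ_ring_def times_germ.abs_eq one_germ_def)
  then show ?thesis using that by (simp add: germ.abs_eq_iff germ_eq_def)
qed

lemma HF_deriv:
  assumes "f \<in> HF"
  obtains f' where "f' \<in> HF" "\<forall>\<^sub>F x in at_top. (f has_real_derivative f' x) (at x)"
proof -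
  obtain g where g: "g \<in> H" "germ_has_derivative (germ_of f) g"
    using H assms unfolding hardy_field_def HF_def by auto
  obtain f' where "g = germ_of f'" by (metis Quotient3_abs_rep Quotient3_germ)
  then show ?thesis using that g by (simp add: HF_def germ_has_derivative.abs_eq)
qed

text \<open>A germ that is not zero has an inverse, so its representative has no zeros near
  infinity; continuity and the intermediate value theorem then fix the sign.\<close>

lemma HF_signed:
  assumes f: "f \<in> HF"
  shows "ev_signed f"
proof (cases "\<forall>\<^sub>F x in at_top. f x = 0")
  case True then show ?thesis by (simp add: ev_signed_def)
next
  case False
  obtain g where "\<forall>\<^sub>F x in at_top. f x * g x = 1" using HF_inverse[OF f False] by blast
  then have "\<forall>\<^sub>F x in at_top. f x \<noteq> 0" by eventually_elim auto
  then obtain b where b: "\<And>x. x \<ge> b \<Longrightarrow> f x \<noteq> 0" by (auto simp: eventually_at_top_linorder)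
  have "germ_of f \<in> carrier germ_ring"
    using f subringE(1)[OF H_subring] by (auto simp: HF_def)
  then obtain a where a: "continuous_on {a<..} f"
    by (auto simp: germ_ring_def continuous_germ.abs_eq)
  define c where "c = max a b + 1"
  have cont: "continuous_on {c..x} f" for x
    by (rule continuous_on_subset[OF a]) (auto simp: c_def)
  have nz: "f x \<noteq> 0" if "x \<ge> c" for x using b that by (auto simp: c_def)
  show ?thesis
  proof (cases "f c > 0")
    case True
    have "f x > 0" if xc: "c \<le> x" for x
    proof (rule ccontr)
      assume "\<not> f x > 0"
      then obtain z where "c \<le> z" "f z = 0" using IVT2'[of f x 0 c, OF _ _ xc cont] True by auto
      then show False using nz by blast
    qed
    then show ?thesis unfolding ev_signed_def eventually_at_top_linorder by blast
  next
    case False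
    then have neg: "f c < 0" using nz[of c] by simp
    have "f x < 0" if xc: "c \<le> x" for x
    proof (rule ccontr)
      assume "\<not> f x < 0"
      then obtain z where "c \<le> z" "f z = 0" using IVT'[of f c 0 x, OF _ _ xc cont] neg by auto
      then show False using nz by blast
    qed
    then show ?thesis unfolding ev_signed_def eventually_at_top_linorder by blast
  qed
qed

lemma HF_uminus_1: "(\<lambda>_. - 1) \<in> HF"
proof -
  have "\<ominus>\<^bsub>germ_ring\<^esub> \<one>\<^bsub>germ_ring\<^esub> \<in> H"
    using subringE(5)[OF H_subring subringE(3)[OF H_subring]] .
  moreover have "\<ominus>\<^bsub>germ_ring\<^esub> \<one>\<^bsub>germ_ring\<^esub> = germ_of (\<lambda>_. - 1)"
  proof -
    interpret cring germ_ring by (rule cring_germ_ring)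
    have "germ_of (\<lambda>_. - 1) \<oplus>\<^bsub>germ_ring\<^esub> \<one>\<^bsub>germ_ring\<^esub> = \<zero>\<^bsub>germ_ring\<^esub>"
      by (simp add: germ_ring_def one_germ_def zero_germ_def plus_germ.abs_eq)
    moreover have "germ_of (\<lambda>_. - 1) \<in> carrier germ_ring"
      by (auto simp: germ_ring_def continuous_germ.abs_eq)
    ultimately show ?thesis using minus_equality one_closed by metis
  qed
  ultimately show ?thesis by (simp add: HF_def)
qed

lemma HF_of_nat: "(\<lambda>_. of_nat n) \<in> HF"
proof (induction n)
  case 0 then show ?case using HF_0 by simp
next
  case (Suc n) then show ?case using HF_add[OF HF_1 Suc] by simp
qed

lemma HF_rat: "(\<lambda>_. of_rat c) \<in> HF"
proof -
  obtain a b where ab: "quotient_of c = (a, b)" by fastforce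
  have b: "b > 0" using quotient_of_denom_pos[OF ab] .
  have int: "(\<lambda>_. of_int a) \<in> HF" for a
  proof (cases "a \<ge> 0")
    case True then show ?thesis using HF_of_nat[of "nat a"] by simp
  next
    case False then show ?thesis using HF_mult[OF HF_uminus_1 HF_of_nat[of "nat (- a)"]] by simp
  qed
  have "\<not> (\<forall>\<^sub>F x::real in at_top. of_int b = (0::real))" using b by simp
  then obtain g where g: "g \<in> HF" "\<forall>\<^sub>F x in at_top. of_int b * g x = 1" using HF_inverse[OF int[of b]] by metis
  have "of_rat c = (of_int a / of_int b :: real)"
    using quotient_of_div[OF ab] by (simp add: of_rat_divide)
  have "\<forall>\<^sub>F x in at_top. of_int a * g x = of_rat c"
    using g(2)
  proof eventually_elim
    case (elim x)
    then have "g x = 1 / of_int b" using b by (simp add: field_simps)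
    then show ?case using \<open>of_rat c = of_int a / of_int b\<close> by simp
  qed
  then show ?thesis by (rule HF_cong[OF _ HF_mult[OF int[of a] g(1)]])
qed

text \<open>The ring \<open>H[x]\<close>: it contains the rational polynomials, which need not have germs in \<open>H\<close>.\<close>

inductive_set HR where
  base: "h \<in> HF \<Longrightarrow> h \<in> HR"
| step: "h \<in> HF \<Longrightarrow> G \<in> HR \<Longrightarrow> \<forall>\<^sub>F x in at_top. F x = h x + x * G x \<Longrightarrow> F \<in> HR"

lemma HR_cong: "F \<in> HR \<Longrightarrow> \<forall>\<^sub>F x in at_top. F x = G x \<Longrightarrow> G \<in> HR"
proof (induction arbitrary: G rule: HR.induct)
  case (base h) then show ?case using HF_cong HR.base by blast
next
  case (step h G F F')
  have "\<forall>\<^sub>F x in at_top. F' x = h x + x * G x" using step.hyps(3) step.prems by eventually_elim simp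
  then show ?case using HR.step step by blast
qed

lemma HR_horner: "h \<in> HF \<Longrightarrow> G \<in> HR \<Longrightarrow> (\<lambda>x. h x + x * G x) \<in> HR"
  by (rule HR.step) auto

lemma HR_add: "F \<in> HR \<Longrightarrow> G \<in> HR \<Longrightarrow> (\<lambda>x. F x + G x) \<in> HR"
proof (induction arbitrary: G rule: HR.induct)
  case (base h)
  from base(2,1) show ?case
  proof (cases rule: HR.cases)
    case base then show ?thesis using HF_add \<open>h \<in> HF\<close> HR.base by blast
  next
    case (step h' G')
    have "\<forall>\<^sub>F x in at_top. (h x + h' x) + x * G' x = h x + G x" using step(3) by eventually_elim simp
    then show ?thesis by (rule HR_cong[OF HR_horner[OF HF_add[OF \<open>h \<in> HF\<close> step(1)] step(2)]])
  qed
next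
  case (step h F' F)
  from step.prems show ?case
  proof (cases rule: HR.cases)
    case base
    have "\<forall>\<^sub>F x in at_top. (h x + G x) + x * F' x = F x + G x" using step.hyps(3) by eventually_elim simp
    then show ?thesis by (rule HR_cong[OF HR_horner[OF HF_add[OF step.hyps(1) base] step.hyps(2)]])
  next
    case (step h' G')
    have "\<forall>\<^sub>F x in at_top. (h x + h' x) + x * (F' x + G' x) = F x + G x"
      using \<open>\<forall>\<^sub>F x in at_top. F x = h x + x * F' x\<close> step(3) by eventually_elim (simp add: algebra_simps)
    then show ?thesis
      by (rule HR_cong[OF HR_horner[OF HF_add[OF \<open>h \<in> HF\<close> step(1)] \<open>\<And>G. G \<in> HR \<Longrightarrow> (\<lambda>x. F' x + G x) \<in> HR\<close>[OF step(2)]]])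
  qed
qed

lemma HR_HF_mult: "F \<in> HR \<Longrightarrow> h \<in> HF \<Longrightarrow> (\<lambda>x. h x * F x) \<in> HR"
proof (induction rule: HR.induct)
  case (base g) then show ?case using HF_mult HR.base by blast
next
  case (step g G F)
  have "\<forall>\<^sub>F x in at_top. (h x * g x) + x * (h x * G x) = h x * F x"
    using step.hyps(3) by eventually_elim (simp add: algebra_simps)
  then show ?case by (rule HR_cong[OF HR_horner[OF HF_mult[OF step.prems step.hyps(1)] step.IH[OF step.prems]]])
qed

lemma HR_mult: "F \<in> HR \<Longrightarrow> G \<in> HR \<Longrightarrow> (\<lambda>x. F x * G x) \<in> HR"
proof (induction rule: HR.induct)
  case (base h) then show ?case using HR_HF_mult by blast
next
  case (step h F' F)
  have "(\<lambda>x. h x * G x + (0 + x * (F' x * G x))) \<in> HR"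
    using HR_add[OF HR_HF_mult[OF step.prems step.hyps(1)] HR_horner[OF HF_0 step.IH[OF step.prems]]] .
  moreover have "\<forall>\<^sub>F x in at_top. h x * G x + (0 + x * (F' x * G x)) = F x * G x"
    using step.hyps(3) by eventually_elim (simp add: algebra_simps)
  ultimately show ?case by (rule HR_cong)
qed

lemma HR_deriv: "F \<in> HR \<Longrightarrow> \<exists>F'\<in>HR. \<forall>\<^sub>F x in at_top. (F has_real_derivative F' x) (at x)"
proof (induction rule: HR.induct)
  case (base h) then show ?case using HF_deriv HR.base by metis
next
  case (step h G F)
  obtain h' where h': "h' \<in> HF" "\<forall>\<^sub>F x in at_top. (h has_real_derivative h' x) (at x)" using HF_deriv step.hyps by metis
  obtain G' where G': "G' \<in> HR" "\<forall>\<^sub>F x in at_top. (G has_real_derivative G' x) (at x)" using step.IH by blast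
  have "\<forall>\<^sub>F x in at_top. (F has_real_derivative G x + (h' x + x * G' x)) (at x)"
  proof -
    obtain a where a: "\<And>x. x \<ge> a \<Longrightarrow> F x = h x + x * G x" using step.hyps(3) by (auto simp: eventually_at_top_linorder)
    from h'(2) G'(2) eventually_gt_at_top[of a] show ?thesis
    proof eventually_elim
      case (elim x)
      have "((\<lambda>x. h x + x * G x) has_real_derivative G x + (h' x + x * G' x)) (at x)"
        using elim by (auto intro!: derivative_eq_intros)
      then show ?case
        by (rule has_field_derivative_transform_within_open[where S = "{a<..}"]) (use elim a in auto)
    qed
  qed
  moreover have "(\<lambda>x. G x + (h' x + x * G' x)) \<in> HR"
    by (intro HR_add HR_horner step.hyps h' G')
  ultimately show ?case by (rule bexI[of _ "\<lambda>x. G x + (h' x + x * G' x)", rotated, rotated]) 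
qed

text \<open>Rolle-type induction on the degree: after division by the leading coefficient the
  polynomial is monic, its derivative is again a polynomial over the field but of smaller degree,
  and a function whose derivative has an eventual sign has one itself.\<close>

lemma HF_poly_signed: "(\<And>i. i \<le> n \<Longrightarrow> h i \<in> HF) \<Longrightarrow> ev_signed (\<lambda>x. \<Sum>i\<le>n. h i x * x ^ i)"
proof (induction n arbitrary: h)
  case 0 then show ?case using HF_signed by simp
next
  case (Suc n)
  show ?case
  proof (cases "\<forall>\<^sub>F x in at_top. h (Suc n) x = 0")
    case True
    have "ev_signed (\<lambda>x. \<Sum>i\<le>n. h i x * x ^ i)" using Suc by simp
    moreover have "\<forall>\<^sub>F x in at_top. (\<Sum>i\<le>n. h i x * x ^ i) = (\<Sum>i\<le>Suc n. h i x * x ^ i)"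
      using True by eventually_elim simp
    ultimately show ?thesis by (rule ev_signed_cong[rotated])
  next
    case False
    obtain g where g: "g \<in> HF" "\<forall>\<^sub>F x in at_top. h (Suc n) x * g x = 1"
      using HF_inverse[OF Suc.prems[of "Suc n"] False] by auto
    \<comment> \<open>The leading coefficient becomes the constant 1; its vanishing derivative is
      what lowers the degree.\<close>
    define k where "k = (\<lambda>i x. if i \<le> n then h i x * g x else 1)"
    have k: "k i \<in> HF" if "i \<le> Suc n" for i
      using that HF_mult[OF Suc.prems g(1)] HF_1 unfolding k_def by (cases "i \<le> n") auto
    have "\<forall>i. \<exists>d. i \<le> n \<longrightarrow> d \<in> HF \<and> (\<forall>\<^sub>F x in at_top. (k i has_real_derivative d x) (at x))"
      using HF_deriv k by (metis le_SucI)
    then obtain d where d: "\<And>i. i \<le> n \<Longrightarrow> d i \<in> HF" "\<And>i. i \<le> n \<Longrightarrow> \<forall>\<^sub>F x in at_top. (k i has_real_derivative d i x) (at x)"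
      by metis
    define F where "F = (\<lambda>x::real. (\<Sum>i\<le>n. k i x * x ^ i) + x ^ Suc n)"
    define c where "c = (\<lambda>i x. real (Suc i) * k (Suc i) x + d i x)"
    have c: "c i \<in> HF" if "i \<le> n" for i
      unfolding c_def by (intro HF_add HF_mult HF_of_nat k d) (use that in auto)
    have "\<forall>\<^sub>F x in at_top. \<forall>i\<in>{..n}. (k i has_real_derivative d i x) (at x)"
      using d(2) by (intro eventually_ball_finite) auto
    then have "\<forall>\<^sub>F x in at_top. (F has_real_derivative (\<Sum>i\<le>n. c i x * x ^ i)) (at x)"
    proof eventually_elim
      case (elim x)
      have "(F has_real_derivative (\<Sum>i\<le>n. k i x * (real i * x ^ (i - 1)) + d i x * x ^ i) + real (Suc n) * x ^ n) (at x)"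
        unfolding F_def
      proof (rule DERIV_add)
        show "((\<lambda>x. \<Sum>i\<le>n. k i x * x ^ i) has_real_derivative (\<Sum>i\<le>n. k i x * (real i * x ^ (i - 1)) + d i x * x ^ i)) (at x)"
          by (rule DERIV_sum) (use elim in \<open>auto intro!: derivative_eq_intros\<close>)
        show "((\<lambda>x. x ^ Suc n) has_real_derivative real (Suc n) * x ^ n) (at x)"
          using DERIV_pow[of "Suc n" x] by simp
      qed
      moreover have "(\<Sum>i\<le>n. k i x * (real i * x ^ (i - 1))) + real (Suc n) * x ^ n = (\<Sum>i\<le>n. real (Suc i) * k (Suc i) x * x ^ i)"
      proof -
        have "(\<Sum>i\<le>n. k i x * (real i * x ^ (i - 1))) + real (Suc n) * x ^ n = (\<Sum>i\<le>Suc n. k i x * (real i * x ^ (i - 1)))"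
          by (simp add: k_def)
        also have "\<dots> = (\<Sum>i\<le>n. k (Suc i) x * (real (Suc i) * x ^ i))"
          by (subst sum.atMost_Suc_shift) simp
        finally show ?thesis by (simp add: mult_ac)
      qed
      then have "(\<Sum>i\<le>n. k i x * (real i * x ^ (i - 1)) + d i x * x ^ i) + real (Suc n) * x ^ n = (\<Sum>i\<le>n. c i x * x ^ i)"
        unfolding c_def by (simp only: sum.distrib distrib_right)
      ultimately show ?case by (rule DERIV_cong)
    qed
    then have "ev_signed F" by (rule ev_signed_of_deriv) (use c in \<open>rule Suc.IH\<close>)
    then have "ev_signed (\<lambda>x. h (Suc n) x * F x)" using ev_signed_mult[OF HF_signed[OF Suc.prems[of "Suc n"]]] by auto
    moreover have "\<forall>\<^sub>F x in at_top. h (Suc n) x * F x = (\<Sum>i\<le>Suc n. h i x * x ^ i)"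
      using g(2)
    proof eventually_elim
      case (elim x)
      have "h (Suc n) x * (\<Sum>i\<le>n. k i x * x ^ i) = (\<Sum>i\<le>n. h i x * x ^ i)"
      proof -
        have "h (Suc n) x * (k i x * x ^ i) = h i x * x ^ i" if "i \<le> n" for i
        proof -
          have "h (Suc n) x * (k i x * x ^ i) = (h (Suc n) x * g x) * (h i x * x ^ i)"
            using that unfolding k_def by (simp add: mult_ac)
          then show ?thesis using elim by simp
        qed
        then show ?thesis unfolding sum_distrib_left by (intro sum.cong) auto
      qed
      then show ?case unfolding F_def by (simp add: distrib_left)
    qed
    ultimately show ?thesis by (rule ev_signed_cong[rotated])
  qed
qed

lemma HR_signed: "F \<in> HR \<Longrightarrow> ev_signed F"
proof -
  assume "F \<in> HR"
  then have "\<exists>n h. (\<forall>i. h i \<in> HF) \<and> (\<forall>\<^sub>F x in at_top. F x = (\<Sum>i\<le>n. h i x * x ^ i))"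
  proof (induction rule: HR.induct)
    case (base h) then show ?case by (intro exI[of _ 0] exI[of _ "\<lambda>_. h"]) auto
  next
    case (step g G F)
    then obtain n h where h: "\<And>i. h i \<in> HF" "\<forall>\<^sub>F x in at_top. G x = (\<Sum>i\<le>n. h i x * x ^ i)" by blast
    have "\<forall>\<^sub>F x in at_top. F x = (\<Sum>i\<le>Suc n. case_nat g h i x * x ^ i)"
      using step.hyps(3) h(2)
      by eventually_elim (simp add: sum.atMost_Suc_shift sum_distrib_left mult_ac del: sum.atMost_Suc)
    moreover have "case_nat g h i \<in> HF" for i using h step.hyps by (cases i) auto
    ultimately show ?case by blast
  qed
  then obtain n h where h: "\<And>i. h i \<in> HF" "\<forall>\<^sub>F x in at_top. F x = (\<Sum>i\<le>n. h i x * x ^ i)" by blast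
  have "ev_signed (\<lambda>x. \<Sum>i\<le>n. h i x * x ^ i)" using h by (intro HF_poly_signed)
  then show ?thesis by (rule ev_signed_cong[rotated]) (use h(2) in \<open>auto elim: eventually_mono\<close>)
qed

lemma hardy_ring_HR: "hardy_ring HR"
proof
  show "(\<lambda>_. of_rat c) \<in> HR" for c using HF_rat HR.base by blast
  show "(\<lambda>x. x) \<in> HR" using HR_horner[OF HF_0 HR.base[OF HF_1]] by simp
qed (use HR_add HR_mult HR_deriv HR_signed in auto)

lemma hardy_field_in_hardy_ring: "germ_of f \<in> H \<Longrightarrow> \<exists>R. hardy_ring R \<and> f \<in> R"
  using hardy_ring_HR HR.base by (auto simp: HF_def)

end

section \<open>Growth and decay of iterated derivatives\<close>

lemma not_at_top_of_ev_nonpos_deriv: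
  fixes f :: "real \<Rightarrow> real"
  assumes "\<forall>\<^sub>F x in at_top. (f has_real_derivative f' x) (at x)" "\<forall>\<^sub>F x in at_top. f' x \<le> 0"
    and lim: "filterlim f at_top at_top"
  shows False
proof -
  have "\<forall>\<^sub>F x in at_top. ((\<lambda>x. - f x) has_real_derivative - f' x) (at x)"
    using assms(1) by eventually_elim (rule DERIV_minus)
  moreover have "\<forall>\<^sub>F x in at_top. - f' x \<ge> 0" using assms(2) by eventually_elim simp
  ultimately obtain a where a: "\<And>x y. a \<le> x \<Longrightarrow> x \<le> y \<Longrightarrow> - f x \<le> - f y"
    by (rule ev_deriv_nonneg_mono) blast
  have "\<forall>\<^sub>F x in at_top. f x \<ge> f a + 1" using lim by (simp add: filterlim_at_top)
  with eventually_ge_at_top[of a] have "\<forall>\<^sub>F x::real in at_top. False"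
  proof eventually_elim
    case (elim x)
    then show ?case using a[of a x] by simp
  qed
  then show ?thesis by simp
qed

lemma ev_signed_cases_le:
  assumes "ev_signed f"
  obtains "\<forall>\<^sub>F x in at_top. f x > 0" | "\<forall>\<^sub>F x in at_top. f x \<le> 0"
  using assms unfolding ev_signed_def
proof (elim disjE)
  assume "\<forall>\<^sub>F x in at_top. f x = 0"
  then have "\<forall>\<^sub>F x in at_top. f x \<le> 0" by eventually_elim simp
  then show ?thesis using that by blast
next
  assume "\<forall>\<^sub>F x in at_top. f x < 0"
  then have "\<forall>\<^sub>F x in at_top. f x \<le> 0" by eventually_elim simp
  then show ?thesis using that by blast
qed (use that in blast)

lemma deriv_pos_of_at_top:
  fixes f :: "real \<Rightarrow> real"
  assumes "\<forall>\<^sub>F x in at_top. (f has_real_derivative f' x) (at x)" "ev_signed f'" "filterlim f at_top at_top"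
  shows "\<forall>\<^sub>F x in at_top. f' x > 0"
  using assms(2) by (cases rule: ev_signed_cases_le) (use not_at_top_of_ev_nonpos_deriv[OF assms(1) _ assms(3)] in auto)

lemma mono_limit_cases:
  fixes f :: "real \<Rightarrow> real"
  assumes mono: "\<And>x y. a \<le> x \<Longrightarrow> x \<le> y \<Longrightarrow> f x \<le> f y"
  shows "(\<exists>L. (f \<longlongrightarrow> L) at_top) \<or> filterlim f at_top at_top"
proof (cases "\<exists>B. \<forall>x\<ge>a. f x \<le> B")
  case True
  then have bdd: "bdd_above (f ` {a..})" by (auto simp: bdd_above_def)
  have "(f \<longlongrightarrow> Sup (f ` {a..})) at_top"
  proof (rule increasing_tendsto)
    show "\<forall>\<^sub>F x in at_top. f x \<le> Sup (f ` {a..})"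
      unfolding eventually_at_top_linorder using bdd by (intro exI[of _ a]) (auto intro: cSup_upper)
    fix l assume "l < Sup (f ` {a..})"
    then obtain x where "x \<ge> a" "l < f x" by (subst (asm) less_cSup_iff) (use bdd in auto)
    then show "\<forall>\<^sub>F x in at_top. l < f x" unfolding eventually_at_top_linorder
      using mono by (intro exI[of _ x]) (auto intro: less_le_trans)
  qed
  then show ?thesis by blast
next
  case False
  have "\<forall>\<^sub>F x in at_top. f x \<ge> B" for B
  proof -
    obtain x where "x \<ge> a" "\<not> f x \<le> B" using False by blast
    then show ?thesis unfolding eventually_at_top_linorder using mono[of x] by (intro exI[of _ x]) force
  qed
  then show ?thesis by (simp add: filterlim_at_top)
qed

text \<open>The sign of \<open>h\<close> makes \<open>g\<close> eventually monotone. An increasing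
  positive \<open>g\<close> would make \<open>f\<close> grow linearly, so \<open>g\<close>
  decreases. The mean value theorem between \<open>x / 2\<close> and \<open>x\<close> then bounds
  \<open>x * g x\<close> by \<open>2 * (f x - f (x / 2))\<close>, which tends to 0.\<close>

lemma decay_pos:
  fixes f g h :: "real \<Rightarrow> real"
  assumes f: "\<forall>\<^sub>F x in at_top. (f has_real_derivative g x) (at x)"
    and g: "\<forall>\<^sub>F x in at_top. (g has_real_derivative h x) (at x)"
    and pos: "\<forall>\<^sub>F x in at_top. g x > 0" and h: "ev_signed h" and lim: "(f \<longlongrightarrow> L) at_top"
  shows "(\<exists>a. \<forall>x\<ge>a. \<forall>y\<ge>x. \<bar>g y\<bar> \<le> \<bar>g x\<bar>) \<and> ((\<lambda>x. x * g x) \<longlongrightarrow> 0) at_top"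
proof -
  from f pos have "\<forall>\<^sub>F x in at_top. (f has_real_derivative g x) (at x) \<and> g x > 0" by eventually_elim auto
  then obtain b where b: "\<And>x. x \<ge> b \<Longrightarrow> (f has_real_derivative g x) (at x) \<and> g x > 0"
    by (auto simp: eventually_at_top_linorder)
  have "\<exists>a. \<forall>x\<ge>a. \<forall>y\<ge>x. g y \<le> g x"
    using ev_signed_minus[OF h]
  proof (cases rule: ev_signed_cases_le)
    case 1
    have "\<forall>\<^sub>F x in at_top. ((\<lambda>x. - g x) has_real_derivative - h x) (at x)"
      using g by eventually_elim (rule DERIV_minus)
    moreover have "\<forall>\<^sub>F x in at_top. - h x \<ge> 0" using 1 by eventually_elim simp
    ultimately obtain a where "\<And>x y. a \<le> x \<Longrightarrow> x \<le> y \<Longrightarrow> - g x \<le> - g y" by (rule ev_deriv_nonneg_mono) blast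
    then show ?thesis by (intro exI[of _ a]) auto
  next
    case 2
    then have "\<forall>\<^sub>F x in at_top. h x \<ge> 0" by eventually_elim simp
    then obtain a where a: "\<And>x y. a \<le> x \<Longrightarrow> x \<le> y \<Longrightarrow> g x \<le> g y" using ev_deriv_nonneg_mono[OF g] by blast
    define c where "c = max a b"
    have gc: "g c > 0" using b by (simp add: c_def)
    have low: "f x \<ge> f c + g c * (x - c)" if "x > c" for x
    proof -
      have "\<exists>z>c. z < x \<and> f x - f c = (x - c) * g z" using b that by (intro MVT2) (auto simp: c_def)
      then obtain z where z: "z > c" "f x - f c = (x - c) * g z" by blast
      have "(x - c) * g c \<le> (x - c) * g z" using a[of c z] z that by (intro mult_left_mono) (auto simp: c_def)
      then show ?thesis using z by (simp add: algebra_simps)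
    qed
    have "\<forall>\<^sub>F x in at_top. f x < L + 1" using lim by (rule order_tendstoD) simp
    with eventually_gt_at_top[of "c + \<bar>L + 1 - f c\<bar> / g c"] have "\<forall>\<^sub>F x::real in at_top. False"
    proof eventually_elim
      case (elim x)
      have "\<bar>L + 1 - f c\<bar> / g c \<ge> 0" using gc by simp
      then have "x > c" using elim by linarith
      have "\<bar>L + 1 - f c\<bar> < (x - c) * g c" using elim gc by (simp add: field_simps)
      then show ?case using low[OF \<open>x > c\<close>] elim by (simp add: mult.commute)
    qed
    then show ?thesis by simp
  qed
  then obtain a0 where a0: "\<And>x y. x \<ge> a0 \<Longrightarrow> y \<ge> x \<Longrightarrow> g y \<le> g x" by blast
  define a where "a = max 1 (max a0 b)"
  have gpos: "g x > 0" if "x \<ge> a" for x using b that by (simp add: a_def)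
  have mono: "g y \<le> g x" if "x \<ge> a" "y \<ge> x" for x y using a0 that by (simp add: a_def)
  have half: "filterlim (\<lambda>x::real. x / 2) at_top at_top" by real_asymp
  have "((\<lambda>x. 2 * (f x - f (x / 2))) \<longlongrightarrow> 2 * (L - L)) at_top"
    by (intro tendsto_intros lim filterlim_compose[OF lim half])
  then have up: "((\<lambda>x. 2 * (f x - f (x / 2))) \<longlongrightarrow> 0) at_top" by simp
  have "((\<lambda>x. x * g x) \<longlongrightarrow> 0) at_top"
  proof (rule tendsto_sandwich[OF _ _ tendsto_const up])
    show "\<forall>\<^sub>F x in at_top. 0 \<le> x * g x"
      using eventually_ge_at_top[of a] by eventually_elim (use gpos in \<open>auto simp: a_def less_imp_le\<close>)
    show "\<forall>\<^sub>F x in at_top. x * g x \<le> 2 * (f x - f (x / 2))"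
      using eventually_ge_at_top[of "2 * a"]
    proof eventually_elim
      case (elim x)
      have a1: "a \<ge> 1" by (simp add: a_def)
      have "\<exists>z>x/2. z < x \<and> f x - f (x/2) = (x - x/2) * g z"
        by (rule MVT2) (use elim a1 b in \<open>auto simp: a_def\<close>)
      then obtain z where z: "z > x/2" "z < x" "f x - f (x/2) = (x - x/2) * g z" by blast
      have "x * g x \<le> x * g z" using mono[of z x] z elim a1 by (intro mult_left_mono) auto
      also have "x * g z = 2 * (f x - f (x / 2))" using z by simp
      finally show ?case .
    qed
  qed
  moreover have "\<bar>g y\<bar> \<le> \<bar>g x\<bar>" if "x \<ge> a" "y \<ge> x" for x y
    using gpos[of x] gpos[of y] mono[OF that] that by auto
  ultimately show ?thesis by blast
qed

lemma ev_power_lower: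
  fixes f g :: "real \<Rightarrow> real"
  assumes f: "\<forall>\<^sub>F x in at_top. (f has_real_derivative g x) (at x)" and c: "c > 0"
    and low: "\<forall>\<^sub>F x in at_top. g x \<ge> c * x ^ m"
  shows "\<exists>c'>0. \<forall>\<^sub>F x in at_top. f x \<ge> c' * x ^ Suc m"
proof -
  define d where "d = c / real (Suc m)"
  have d: "d > 0" using c by (simp add: d_def)
  have "\<forall>\<^sub>F x in at_top. ((\<lambda>x. f x - d * x ^ Suc m) has_real_derivative g x - c * x ^ m) (at x)"
    using f
  proof eventually_elim
    case (elim x)
    have "((\<lambda>x. f x - d * x ^ Suc m) has_real_derivative g x - d * (real (Suc m) * x ^ (Suc m - Suc 0))) (at x)"
      by (intro DERIV_diff elim DERIV_cmult DERIV_pow)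
    then show ?case using c by (simp add: d_def)
  qed
  moreover have "\<forall>\<^sub>F x in at_top. g x - c * x ^ m \<ge> 0" using low by eventually_elim simp
  ultimately obtain a where a: "\<And>x y. a \<le> x \<Longrightarrow> x \<le> y \<Longrightarrow> f x - d * x ^ Suc m \<le> f y - d * y ^ Suc m"
    by (rule ev_deriv_nonneg_mono) blast
  define b where "b = f a - d * a ^ Suc m"
  have "filterlim (\<lambda>x::real. d / 2 * x ^ Suc m) at_top at_top"
    using d by (intro filterlim_tendsto_pos_mult_at_top[OF tendsto_const] filterlim_pow_at_top filterlim_ident) auto
  then have "\<forall>\<^sub>F x in at_top. d / 2 * x ^ Suc m \<ge> - b" unfolding filterlim_at_top by blast
  with eventually_ge_at_top[of a] have "\<forall>\<^sub>F x in at_top. f x \<ge> d / 2 * x ^ Suc m"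
  proof eventually_elim
    case (elim x)
    then show ?case using a[of a x] by (simp add: b_def field_simps)
  qed
  then show ?thesis using d by (intro exI[of _ "d / 2"]) auto
qed

context hardy_ring
begin

lemma R_uminus: "f \<in> R \<Longrightarrow> (\<lambda>x. - f x) \<in> R"
  using R_mult[OF R_rat[of "- 1"], of f] by (simp add: of_rat_minus)

lemma R_diff: "f \<in> R \<Longrightarrow> g \<in> R \<Longrightarrow> (\<lambda>x. f x - g x) \<in> R"
  using R_add[OF _ R_uminus, of f g] by simp

lemma R_power: "f \<in> R \<Longrightarrow> (\<lambda>x. f x ^ n) \<in> R"
  by (induction n) (use R_rat[of 1] R_mult in auto)

lemma R_poly: "poly (map_poly of_rat p) \<in> R"
proof (induction p)
  case 0 show ?case using R_rat[of 0] by (simp add: fun_eq_iff[symmetric] flip: poly_0) (simp add: poly_0[abs_def])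
next
  case (pCons a p)
  have "(\<lambda>x. of_rat a + x * poly (map_poly of_rat p) x) \<in> R" by (intro R_add R_mult R_rat R_id pCons)
  moreover have "poly (map_poly of_rat (pCons a p)) = (\<lambda>x::real. of_rat a + x * poly (map_poly of_rat p) x)"
    using pCons by (auto simp: map_poly_pCons)
  ultimately show ?case by simp
qed

text \<open>A derivative in \<open>R\<close> is prescribed only near infinity, so one sequence of
  representatives for all iterated derivatives is fixed once and for all.\<close>

definition chain :: "(nat \<Rightarrow> real \<Rightarrow> real) \<Rightarrow> bool" where
  "chain U \<longleftrightarrow> (\<forall>i. U i \<in> R \<and> (\<forall>\<^sub>F x in at_top. (U i has_real_derivative U (Suc i) x) (at x)))"

lemma chainD: "chain U \<Longrightarrow> U i \<in> R" "chain U \<Longrightarrow> \<forall>\<^sub>F x in at_top. (U i has_real_derivative U (Suc i) x) (at x)"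
  by (auto simp: chain_def)

lemma chain_exists: "f \<in> R \<Longrightarrow> \<exists>U. chain U \<and> U 0 = f"
proof -
  assume f: "f \<in> R"
  obtain D where D: "\<And>g. g \<in> R \<Longrightarrow> D g \<in> R \<and> (\<forall>\<^sub>F x in at_top. (g has_real_derivative D g x) (at x))"
    using R_deriv by metis
  have "(D ^^ i) f \<in> R" for i by (induction i) (use f D in auto)
  then have "chain (\<lambda>i. (D ^^ i) f)" unfolding chain_def using D by simp
  then show ?thesis by (intro exI[of _ "\<lambda>i. (D ^^ i) f"]) simp
qed

lemma chain_uminus: "chain U \<Longrightarrow> chain (\<lambda>i x. - U i x)"
  unfolding chain_def using R_uminus by (auto elim!: eventually_mono intro: DERIV_minus)

lemma chain_poly_diff:
  assumes U: "chain U"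
  shows "chain (\<lambda>i x. U i x - poly (map_poly of_rat ((pderiv ^^ i) p)) x)"
  unfolding chain_def
proof (intro allI conjI)
  fix i
  show "(\<lambda>x. U i x - poly (map_poly of_rat ((pderiv ^^ i) p)) x) \<in> R"
    using R_diff[OF chainD(1)[OF U] R_poly] by simp
  have *: "map_poly of_rat (pderiv q) = (pderiv (map_poly of_rat q) :: real poly)" for q
    by (rule poly_eqI) (simp add: coeff_map_poly coeff_pderiv of_rat_mult of_rat_add)
  show "\<forall>\<^sub>F x in at_top. ((\<lambda>x. U i x - poly (map_poly of_rat ((pderiv ^^ i) p)) x)
      has_real_derivative U (Suc i) x - poly (map_poly of_rat ((pderiv ^^ Suc i) p)) x) (at x)"
    using chainD(2)[OF U, of i] by eventually_elim (auto intro!: DERIV_diff simp: * poly_DERIV)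
qed

lemma limit_cases:
  assumes U: "chain U"
  shows "(\<exists>L. (U i \<longlongrightarrow> L) at_top) \<or> filterlim (U i) at_top at_top \<or> filterlim (U i) at_bot at_top"
  using R_signed[OF chainD(1)[OF U, of "Suc i"]]
proof (cases rule: ev_signed_cases_le)
  case 1
  then have "\<forall>\<^sub>F x in at_top. U (Suc i) x \<ge> 0" by eventually_elim simp
  then obtain a where "\<And>x y. a \<le> x \<Longrightarrow> x \<le> y \<Longrightarrow> U i x \<le> U i y"
    using ev_deriv_nonneg_mono[OF chainD(2)[OF U, of i]] by blast
  then show ?thesis using mono_limit_cases by blast
next
  case 2
  then have "\<forall>\<^sub>F x in at_top. - U (Suc i) x \<ge> 0" by eventually_elim simp
  then obtain a where "\<And>x y. a \<le> x \<Longrightarrow> x \<le> y \<Longrightarrow> - U i x \<le> - U i y"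
    using ev_deriv_nonneg_mono[OF chainD(2)[OF chain_uminus[OF U], of i]] by blast
  then have "(\<exists>L. ((\<lambda>x. - U i x) \<longlongrightarrow> L) at_top) \<or> filterlim (\<lambda>x. - U i x) at_top at_top"
    by (rule mono_limit_cases)
  then show ?thesis
  proof
    assume "\<exists>L. ((\<lambda>x. - U i x) \<longlongrightarrow> L) at_top"
    then show ?thesis using tendsto_minus by fastforce
  next
    assume "filterlim (\<lambda>x. - U i x) at_top at_top"
    then show ?thesis by (simp add: filterlim_uminus_at_bot)
  qed
qed

lemma decay:
  assumes U: "chain U" and lim: "(U i \<longlongrightarrow> L) at_top"
  shows "\<exists>a. \<forall>x\<ge>a. \<forall>y\<ge>x. \<bar>U (Suc i) y\<bar> \<le> \<bar>U (Suc i) x\<bar>" "((\<lambda>x. x * U (Suc i) x) \<longlongrightarrow> 0) at_top"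
proof -
  have "(\<exists>a. \<forall>x\<ge>a. \<forall>y\<ge>x. \<bar>U (Suc i) y\<bar> \<le> \<bar>U (Suc i) x\<bar>) \<and> ((\<lambda>x. x * U (Suc i) x) \<longlongrightarrow> 0) at_top"
    using R_signed[OF chainD(1)[OF U, of "Suc i"]] unfolding ev_signed_def
  proof (elim disjE)
    assume "\<forall>\<^sub>F x in at_top. 0 < U (Suc i) x"
    then show ?thesis
      using decay_pos[OF chainD(2)[OF U, of i] chainD(2)[OF U] _ R_signed[OF chainD(1)[OF U]] lim] by blast
  next
    assume "\<forall>\<^sub>F x in at_top. U (Suc i) x < 0"
    then have "\<forall>\<^sub>F x in at_top. 0 < - U (Suc i) x" by eventually_elim simp
    note * = decay_pos[OF chainD(2)[OF chain_uminus[OF U], of i] chainD(2)[OF chain_uminus[OF U]] this R_signed[OF chainD(1)[OF chain_uminus[OF U]]] tendsto_minus[OF lim]]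
    then have "((\<lambda>x. - (x * - U (Suc i) x)) \<longlongrightarrow> - 0) at_top" by (intro tendsto_minus) auto
    then show ?thesis using * by simp
  next
    assume z: "\<forall>\<^sub>F x in at_top. U (Suc i) x = 0"
    then obtain a where a: "\<And>x. x \<ge> a \<Longrightarrow> U (Suc i) x = 0" by (auto simp: eventually_at_top_linorder)
    have "((\<lambda>x. x * U (Suc i) x) \<longlongrightarrow> 0) at_top"
      by (rule tendsto_eventually) (use z in eventually_elim, auto)
    moreover have "\<forall>x\<ge>a. \<forall>y\<ge>x. \<bar>U (Suc i) y\<bar> \<le> \<bar>U (Suc i) x\<bar>" using a by simp
    ultimately show ?thesis by blast
  qed
  then show "\<exists>a. \<forall>x\<ge>a. \<forall>y\<ge>x. \<bar>U (Suc i) y\<bar> \<le> \<bar>U (Suc i) x\<bar>" "((\<lambda>x. x * U (Suc i) x) \<longlongrightarrow> 0) at_top"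
    by blast+
qed

lemma chain_power_lower:
  assumes U: "chain U" and "c > 0" "\<forall>\<^sub>F x in at_top. U n x \<ge> c * x ^ m"
  shows "\<exists>c'>0. \<forall>\<^sub>F x in at_top. U 0 x \<ge> c' * x ^ (n + m)"
  using assms(2,3)
proof (induction n arbitrary: c m)
  case 0 then show ?case by auto
next
  case (Suc n)
  then obtain c' where "c' > 0" "\<forall>\<^sub>F x in at_top. U n x \<ge> c' * x ^ Suc m"
    using ev_power_lower[OF chainD(2)[OF U, of n]] by blast
  then show ?case using Suc.IH[of c' "Suc m"] by simp
qed

text \<open>If the derivative of order \<open>Suc D\<close> tended to infinity, repeated integration
  would give a lower bound of order \<open>x ^ Suc D\<close> for \<open>U 0\<close> or its
  negative.\<close>

lemma finite_limit_exists:
  assumes U: "chain U" and growth: "\<forall>\<^sub>F x in at_top. \<bar>U 0 x\<bar> \<le> K * x ^ D"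
  shows "\<exists>L. (U (Suc D) \<longlongrightarrow> L) at_top"
proof (rule ccontr)
  assume no: "\<not> ?thesis"
  have *: False if V: "chain V" and top: "filterlim (V (Suc D)) at_top at_top" and gr: "\<forall>\<^sub>F x in at_top. \<bar>V 0 x\<bar> \<le> K * x ^ D" for V
  proof -
    have "\<forall>\<^sub>F x in at_top. V (Suc D) x \<ge> 1 * x ^ 0" using top by (simp add: filterlim_at_top)
    from chain_power_lower[OF V _ this] obtain c where c: "c > 0" "\<forall>\<^sub>F x in at_top. V 0 x \<ge> c * x ^ Suc D" by auto
    from c(2) gr eventually_gt_at_top[of "max 1 (K / c)"] have "\<forall>\<^sub>F x::real in at_top. False"
    proof eventually_elim
      case (elim x)
      then have x: "x > 1" "x > K / c" by auto
      have "(c * x) * x ^ D = c * x ^ Suc D" by simp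
      then have "(c * x) * x ^ D \<le> K * x ^ D" using elim by linarith
      moreover have "x ^ D > 0" using x by simp
      ultimately have "c * x \<le> K" by (metis mult_right_le_imp_le)
      then show ?case using x c by (simp add: field_simps)
    qed
    then show False by simp
  qed
  show False
    using limit_cases[OF U, of "Suc D"] no *[OF U _ growth] *[OF chain_uminus[OF U]] growth
    by (auto simp: filterlim_uminus_at_bot)
qed

text \<open>Descent from a convergent derivative: as long as the limit is 0 and the preceding
  derivative converges too, the order is lowered. The descent ends before \<open>U 0\<close>, which
  is unbounded. A nonzero limit is directly a leading coefficient; in the other alternative the
  progression has to be stretched, or the function grows slowly when \<open>k = 1\<close>.\<close>

lemma type_decomposition:
  assumes U: "chain U" and lim: "(U k \<longlongrightarrow> L) at_top" and inf: "filterlim (\<lambda>x. \<bar>U 0 x\<bar>) at_top at_top"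
  shows "\<exists>k\<ge>1. (\<exists>L. L \<noteq> 0 \<and> (U k \<longlongrightarrow> L) at_top) \<or>
    ((U k \<longlongrightarrow> 0) at_top \<and> (filterlim (U (k - 1)) at_top at_top \<or> filterlim (U (k - 1)) at_bot at_top))"
  using lim
proof (induction k arbitrary: L)
  case 0
  have "((\<lambda>x. \<bar>U 0 x\<bar>) \<longlongrightarrow> \<bar>L\<bar>) at_top" using 0 by (rule tendsto_rabs)
  then show ?case using inf not_tendsto_and_filterlim_at_infinity[of at_top] filterlim_at_top_imp_at_infinity trivial_limit_at_top_linorder by metis
next
  case (Suc k)
  show ?case
  proof (cases "L = 0")
    case False then show ?thesis using Suc.prems by (intro exI[of _ "Suc k"]) auto
  next
    case True
    from limit_cases[OF U, of k] show ?thesis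
    proof
      assume "\<exists>L. (U k \<longlongrightarrow> L) at_top" then show ?thesis using Suc.IH by blast
    next
      assume "filterlim (U k) at_top at_top \<or> filterlim (U k) at_bot at_top"
      then show ?thesis using Suc.prems True by (intro exI[of _ "Suc k"]) auto
    qed
  qed
qed

text \<open>The same descent with \<open>L / fact k\<close>, the limiting Taylor coefficient, tested
  for rationality. If it is rational, subtracting a monomial makes the derivative of order
  \<open>k\<close> tend to 0 and the descent continues. It cannot reach order 0, because the
  distance to every rational polynomial tends to infinity.\<close>

lemma rational_decomposition:
  assumes "chain U" "(U k \<longlongrightarrow> L) at_top"
    and "\<And>p :: rat poly. filterlim (\<lambda>x. \<bar>U 0 x - poly (map_poly of_rat p) x\<bar>) at_top at_top"
  shows "\<exists>(p :: rat poly) W j. chain W \<and> (\<forall>x. W 0 x = U 0 x - poly (map_poly of_rat p) x) \<and> j \<ge> 1 \<and>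
    ((\<exists>L. L / fact j \<notin> \<rat> \<and> (W j \<longlongrightarrow> L) at_top) \<or>
     ((W j \<longlongrightarrow> 0) at_top \<and> (filterlim (W (j - 1)) at_top at_top \<or> filterlim (W (j - 1)) at_bot at_top)))"
  using assms
proof (induction k arbitrary: U L)
  case 0
  have "((\<lambda>x. \<bar>U 0 x\<bar>) \<longlongrightarrow> \<bar>L\<bar>) at_top" using 0(2) by (rule tendsto_rabs)
  moreover have "filterlim (\<lambda>x. \<bar>U 0 x\<bar>) at_top at_top" using 0(3)[of 0] by simp
  ultimately show ?case using not_tendsto_and_filterlim_at_infinity[of at_top] filterlim_at_top_imp_at_infinity trivial_limit_at_top_linorder by metis
next
  case (Suc k)
  show ?case
  proof (cases "L / fact (Suc k) \<in> \<rat>")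
    case False
    then show ?thesis using Suc.prems by (intro exI[of _ "0 :: rat poly"] exI[of _ U] exI[of _ "Suc k"]) auto
  next
    case True
    then obtain r where r: "L / fact (Suc k) = of_rat r" by (auto elim: Rats_cases)
    define q where "q = Polynomial.monom r (Suc k)"
    define W where "W = (\<lambda>i x. U i x - poly (map_poly of_rat ((pderiv ^^ i) q)) x)"
    have W: "chain W" unfolding W_def using chain_poly_diff[OF Suc.prems(1)] .
    have W0: "W 0 x = U 0 x - poly (map_poly of_rat q) x" for x by (simp add: W_def)
    have "(pderiv ^^ i) (Polynomial.monom r m) = Polynomial.monom (of_nat (fact m div fact (m - i)) * r) (m - i)" if "i \<le> m" for i m
      using that
    proof (induction i)
      case (Suc i)
      have "fact m div fact (m - i) * (m - i) = (fact m div fact (m - Suc i) :: nat)"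
      proof -
        obtain n where n: "m - i = Suc n" using Suc.prems by (metis Suc_diff_Suc Suc_le_lessD)
        then have n': "m - Suc i = n" by simp
        have "fact (Suc n) dvd (fact m :: nat)" using n by (intro fact_dvd) auto
        then obtain d where d: "fact m = fact (Suc n) * (d::nat)" by blast
        have "fact (Suc n) * d = fact n * (Suc n * d)" by (simp add: algebra_simps)
        then have "fact (Suc n) * d div fact n = Suc n * d" by (metis fact_nonzero nonzero_mult_div_cancel_left)
        moreover have "fact (Suc n) * d div fact (Suc n) = d" by (metis fact_nonzero nonzero_mult_div_cancel_left)
        ultimately show ?thesis unfolding n n' d by simp
      qed
      then have "of_nat (fact m div fact (m - i)) * of_nat (m - i) = (of_nat (fact m div fact (m - Suc i)) :: rat)"
        by (metis of_nat_mult)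
      then show ?case using Suc by (simp add: pderiv_monom mult_ac) 
    qed simp
    from this[of "Suc k" "Suc k"] have "(pderiv ^^ Suc k) q = Polynomial.monom (of_nat (fact (Suc k)) * r) 0" unfolding q_def by simp
    then have "(pderiv ^^ Suc k) q = [:of_nat (fact (Suc k)) * r:]" by (simp only: monom_0)
    moreover have "poly (map_poly of_rat [:c:]) x = (of_rat c :: real)" for c x by (simp add: map_poly_pCons)
    moreover have "of_rat (of_nat (fact (Suc k)) * r) = L"
    proof -
      have "of_rat (of_nat (fact (Suc k)) * r) = fact (Suc k) * (L / fact (Suc k))"
        unfolding r by (simp only: of_rat_mult of_rat_of_nat_eq) (simp only: of_nat_fact)
      then show ?thesis by (simp del: fact_Suc)
    qed
    ultimately have "poly (map_poly of_rat ((pderiv ^^ Suc k) q)) x = L" for x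
      by (simp only:)
    then have WS: "(W (Suc k) \<longlongrightarrow> L - L) at_top" unfolding W_def by (intro tendsto_diff Suc.prems(2)) simp
    have inf: "filterlim (\<lambda>x. \<bar>W 0 x - poly (map_poly of_rat p) x\<bar>) at_top at_top" for p
    proof -
      have "map_poly of_rat (q + p) = (map_poly of_rat q + map_poly of_rat p :: real poly)"
        by (rule poly_eqI) (simp add: coeff_map_poly of_rat_add)
      then show ?thesis using Suc.prems(3)[of "q + p"] unfolding W0 by (simp add: diff_diff_eq)
    qed
    from limit_cases[OF W, of k] show ?thesis
    proof
      assume "\<exists>L. (W k \<longlongrightarrow> L) at_top"
      then obtain L' where "(W k \<longlongrightarrow> L') at_top" by blast
      from Suc.IH[OF W this inf] obtain p V j where V: "chain V" "\<And>x. V 0 x = W 0 x - poly (map_poly of_rat p) x" "j \<ge> 1"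
        "(\<exists>L. L / fact j \<notin> \<rat> \<and> (V j \<longlongrightarrow> L) at_top) \<or>
          ((V j \<longlongrightarrow> 0) at_top \<and> (filterlim (V (j - 1)) at_top at_top \<or> filterlim (V (j - 1)) at_bot at_top))"
        by blast
      have "V 0 x = U 0 x - poly (map_poly of_rat (q + p)) x" for x
      proof -
        have "map_poly of_rat (q + p) = (map_poly of_rat q + map_poly of_rat p :: real poly)"
          by (rule poly_eqI) (simp add: coeff_map_poly of_rat_add)
        then show ?thesis unfolding V(2) W0 by simp
      qed
      then show ?thesis using V by blast
    next
      assume "filterlim (W k) at_top at_top \<or> filterlim (W k) at_bot at_top"
      then show ?thesis using W W0 WS by (intro exI[of _ q] exI[of _ W] exI[of _ "Suc k"]) auto
    qed
  qed
qed

end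

section \<open>Local approximation by polynomials\<close>

text \<open>Along a progression \<open>X, X + q, X + 2 q, \<dots>\<close> of length \<open>X powr (1 / m)\<close>, the function is a polynomial of degree
  \<open>k\<close> with leading coefficient close to \<open>\<tau>\<close>, up to \<open>\<epsilon>\<close>. Nothing is said about the lower coefficients,
  which are typically unbounded.\<close>

definition local_poly :: "(real \<Rightarrow> real) \<Rightarrow> nat \<Rightarrow> real \<Rightarrow> nat \<Rightarrow> nat \<Rightarrow> bool" where
  "local_poly u k \<tau> m Q \<longleftrightarrow> (\<forall>\<epsilon>>0. \<forall>\<^sub>F X in sequentially. \<exists>q c. 1 \<le> q \<and> Q dvd q \<and> q \<le> X \<and> \<bar>c k - \<tau>\<bar> \<le> \<epsilon> \<and>
     (\<forall>y. y ^ m \<le> X \<longrightarrow> \<bar>u (real X + real q * real y) - (\<Sum>j\<le>k. c j * real y ^ j)\<bar> \<le> \<epsilon>))"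

lemma local_poly_uminus:
  assumes "local_poly (\<lambda>x. - u x) k \<tau> m Q"
  shows "local_poly u k (- \<tau>) m Q"
  unfolding local_poly_def
proof (intro allI impI)
  fix \<epsilon> :: real assume "\<epsilon> > 0"
  with assms have "\<forall>\<^sub>F X in sequentially. \<exists>q c. 1 \<le> q \<and> Q dvd q \<and> q \<le> X \<and> \<bar>c k - \<tau>\<bar> \<le> \<epsilon> \<and>
     (\<forall>y. y ^ m \<le> X \<longrightarrow> \<bar>- u (real X + real q * real y) - (\<Sum>j\<le>k. c j * real y ^ j)\<bar> \<le> \<epsilon>)"
    unfolding local_poly_def by blast
  then show "\<forall>\<^sub>F X in sequentially. \<exists>q c. 1 \<le> q \<and> Q dvd q \<and> q \<le> X \<and> \<bar>c k - - \<tau>\<bar> \<le> \<epsilon> \<and>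
     (\<forall>y. y ^ m \<le> X \<longrightarrow> \<bar>u (real X + real q * real y) - (\<Sum>j\<le>k. c j * real y ^ j)\<bar> \<le> \<epsilon>)"
  proof eventually_elim
    case (elim X)
    then obtain q c where qc: "1 \<le> q" "Q dvd q" "q \<le> X" "\<bar>c k - \<tau>\<bar> \<le> \<epsilon>"
      "\<And>y. y ^ m \<le> X \<Longrightarrow> \<bar>- u (real X + real q * real y) - (\<Sum>j\<le>k. c j * real y ^ j)\<bar> \<le> \<epsilon>" by blast
    have "\<bar>u (real X + real q * real y) - (\<Sum>j\<le>k. - c j * real y ^ j)\<bar> \<le> \<epsilon>" if "y ^ m \<le> X" for y
      using qc(5)[OF that] by (simp add: sum_negf)
    moreover have "\<bar>- c k - - \<tau>\<bar> \<le> \<epsilon>" using qc(4) by simp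
    ultimately show ?case using qc(1-3) by (intro exI[of _ q] exI[of _ "\<lambda>j. - c j"]) auto
  qed
qed

context hardy_ring
begin

text \<open>The remainder is evaluated at an unknown point beyond \<open>x\<close>. Since
  \<open>U (Suc k)\<close> eventually decreases in absolute value, its value at \<open>x\<close>
  serves for all lengths \<open>z\<close> at once.\<close>

lemma taylor_bound:
  assumes U: "chain U" and lim: "(U k \<longlongrightarrow> L) at_top"
  shows "\<forall>\<^sub>F x in at_top. \<forall>z\<ge>0. \<bar>U 0 (x + z) - (\<Sum>j\<le>k. U j x / fact j * z ^ j)\<bar> \<le> \<bar>U (Suc k) x\<bar> * z ^ Suc k"
proof -
  obtain a where a: "\<And>x y. x \<ge> a \<Longrightarrow> y \<ge> x \<Longrightarrow> \<bar>U (Suc k) y\<bar> \<le> \<bar>U (Suc k) x\<bar>"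
    using decay(1)[OF U lim] by blast
  have "\<forall>\<^sub>F x in at_top. \<forall>i\<in>{..k}. (U i has_real_derivative U (Suc i) x) (at x)"
    using chainD(2)[OF U] by (intro eventually_ball_finite) auto
  then obtain b where b: "\<And>x i. x \<ge> b \<Longrightarrow> i \<le> k \<Longrightarrow> (U i has_real_derivative U (Suc i) x) (at x)"
    by (auto simp: eventually_at_top_linorder)
  have "\<bar>U 0 (x + z) - (\<Sum>j\<le>k. U j x / fact j * z ^ j)\<bar> \<le> \<bar>U (Suc k) x\<bar> * z ^ Suc k"
    if x: "x \<ge> max a b" and z: "z \<ge> 0" for x z
  proof (cases "z = 0")
    case True
    have "(\<Sum>j\<le>k. U j x / fact j * 0 ^ j) = (\<Sum>j\<in>{0}. U j x / fact j * 0 ^ j)"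
      by (rule sum.mono_neutral_right) auto
    then show ?thesis using True by simp
  next
    case False
    have "\<exists>t>x. t < x + z \<and> U 0 (x + z) = (\<Sum>m<Suc k. U m x / fact m * (x + z - x) ^ m) + U (Suc k) t / fact (Suc k) * (x + z - x) ^ Suc k"
      by (rule Taylor_up[where a = "max a b"]) (use b x z False in auto)
    then obtain t where t: "t > x" "U 0 (x + z) = (\<Sum>m\<le>k. U m x / fact m * z ^ m) + U (Suc k) t / fact (Suc k) * z ^ Suc k"
      unfolding lessThan_Suc_atMost by auto
    have "\<bar>U 0 (x + z) - (\<Sum>j\<le>k. U j x / fact j * z ^ j)\<bar> = \<bar>U (Suc k) t\<bar> / fact (Suc k) * z ^ Suc k"
      unfolding t(2) using z by (simp add: abs_mult del: fact_Suc)
    also have "\<dots> \<le> \<bar>U (Suc k) x\<bar> / 1 * z ^ Suc k"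
      using a[of x t] x t(1) z by (intro mult_right_mono frac_le) (auto simp: fact_ge_1 simp del: fact_Suc)
    finally show ?thesis by simp
  qed
  then show ?thesis unfolding eventually_at_top_linorder by blast
qed

text \<open>The step \<open>Q\<close> itself serves as \<open>q\<close>. Because
  \<open>x * U (Suc k) x\<close> tends to 0, the remainder is small already for
  \<open>y ^ Suc k \<le> X\<close>; the exponent \<open>8 * Suc k\<close> is chosen to agree with
  the case of an infinite limit.\<close>

lemma local_poly_finite_limit:
  assumes U: "chain U" and lim: "(U k \<longlongrightarrow> L) at_top" and Q: "Q \<ge> 1"
  shows "local_poly (U 0) k (L / fact k * real Q ^ k) (8 * Suc k) Q"
  unfolding local_poly_def
proof (intro allI impI)
  fix \<epsilon> :: real assume \<epsilon>: "\<epsilon> > 0"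
  have real: "filterlim real at_top sequentially" by (rule filterlim_real_sequentially)
  have "((\<lambda>x. U k x / fact k * real Q ^ k) \<longlongrightarrow> L / fact k * real Q ^ k) at_top" by (intro tendsto_intros lim) auto
  then have "\<forall>\<^sub>F x in at_top. \<bar>U k x / fact k * real Q ^ k - L / fact k * real Q ^ k\<bar> < \<epsilon>"
    using \<epsilon> by (auto simp: tendsto_iff dist_real_def)
  then have 1: "\<forall>\<^sub>F X in sequentially. \<bar>U k (real X) / fact k * real Q ^ k - L / fact k * real Q ^ k\<bar> < \<epsilon>"
    using real by (rule eventually_compose_filterlim)
  have "\<forall>\<^sub>F x in at_top. \<bar>x * U (Suc k) x\<bar> < \<epsilon> / real Q ^ Suc k"
    using decay(2)[OF U lim] \<epsilon> Q by (auto simp: tendsto_iff dist_real_def)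
  then have 2: "\<forall>\<^sub>F X in sequentially. \<bar>real X * U (Suc k) (real X)\<bar> < \<epsilon> / real Q ^ Suc k"
    using real by (rule eventually_compose_filterlim)
  have 3: "\<forall>\<^sub>F X in sequentially. \<forall>z\<ge>0. \<bar>U 0 (real X + z) - (\<Sum>j\<le>k. U j (real X) / fact j * z ^ j)\<bar> \<le> \<bar>U (Suc k) (real X)\<bar> * z ^ Suc k"
    using taylor_bound[OF U lim] real by (rule eventually_compose_filterlim)
  from 1 2 3 eventually_ge_at_top[of Q]
  show "\<forall>\<^sub>F X in sequentially. \<exists>q c. 1 \<le> q \<and> Q dvd q \<and> q \<le> X \<and> \<bar>c k - L / fact k * real Q ^ k\<bar> \<le> \<epsilon> \<and>
     (\<forall>y. y ^ (8 * Suc k) \<le> X \<longrightarrow> \<bar>U 0 (real X + real q * real y) - (\<Sum>j\<le>k. c j * real y ^ j)\<bar> \<le> \<epsilon>)"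
  proof eventually_elim
    case (elim X)
    define c where "c = (\<lambda>j. U j (real X) / fact j * real Q ^ j)"
    have "\<bar>U 0 (real X + real Q * real y) - (\<Sum>j\<le>k. c j * real y ^ j)\<bar> \<le> \<epsilon>" if y: "y ^ (8 * Suc k) \<le> X" for y
    proof -
      have "real y ^ Suc k \<le> real X"
      proof (cases "y = 0")
        case False
        then have "y ^ Suc k \<le> y ^ (8 * Suc k)" by (intro power_increasing) auto
        then have "y ^ Suc k \<le> X" using y by linarith
        then show ?thesis by (metis of_nat_le_iff of_nat_power)
      qed simp
      then have "\<bar>U (Suc k) (real X)\<bar> * (real Q * real y) ^ Suc k \<le> \<bar>U (Suc k) (real X)\<bar> * (real Q ^ Suc k * real X)"
        unfolding power_mult_distrib by (intro mult_left_mono) auto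
      also have "\<dots> = \<bar>real X * U (Suc k) (real X)\<bar> * real Q ^ Suc k" by (simp add: abs_mult)
      also have "\<dots> \<le> \<epsilon>" using elim(2) Q by (simp add: field_simps)
      finally have "\<bar>U 0 (real X + real Q * real y) - (\<Sum>j\<le>k. U j (real X) / fact j * (real Q * real y) ^ j)\<bar> \<le> \<epsilon>"
        using elim(3) by (meson mult_nonneg_nonneg of_nat_0_le_iff order_trans)
      then show ?thesis unfolding c_def by (simp add: power_mult_distrib mult.assoc)
    qed
    then show ?case using elim Q by (intro exI[of _ Q] exI[of _ c]) (auto simp: c_def)
  qed
qed

end

text \<open>The function \<open>6 * (x / 2) powr (- 1 / 3)\<close> has derivative
  \<open>- ((x / 2) powr (- 4 / 3))\<close>; adding it to \<open>G\<close> yields a function that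
  eventually does not increase and yet tends to infinity.\<close>

lemma bounded_of_deriv_le:
  fixes G g :: "real \<Rightarrow> real"
  assumes G: "\<forall>\<^sub>F x in at_top. (G has_real_derivative g x) (at x)"
    and le: "\<forall>\<^sub>F x in at_top. g x \<le> (x / 2) powr (- 4 / 3)" and top: "filterlim G at_top at_top"
  shows False
proof -
  define F where "F = (\<lambda>x. G x + 6 * (x / 2) powr (- 1 / 3))"
  have "filterlim F at_top at_top"
    by (rule filterlim_at_top_mono[OF top]) (auto simp: F_def)
  moreover have "\<forall>\<^sub>F x in at_top. (F has_real_derivative g x - (x / 2) powr (- 4 / 3)) (at x)"
    using G eventually_gt_at_top[of 0]
  proof eventually_elim
    case (elim x)
    have "((\<lambda>x. (x / 2) powr (- 1 / 3)) has_real_derivative (- 1 / 3) * (x / 2) powr (- 1 / 3 - of_nat 1) * (1 / 2)) (at x)"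
      by (rule DERIV_fun_powr) (use elim in \<open>auto intro!: derivative_eq_intros\<close>)
    then have "(F has_real_derivative g x + 6 * ((- 1 / 3) * (x / 2) powr (- 1 / 3 - of_nat 1) * (1 / 2))) (at x)"
      unfolding F_def by (intro DERIV_add elim DERIV_cmult)
    then show ?case by simp
  qed
  moreover have "\<forall>\<^sub>F x in at_top. g x - (x / 2) powr (- 4 / 3) \<le> 0" using le by eventually_elim simp
  ultimately show False by (rule not_at_top_of_ev_nonpos_deriv[rotated 2])
qed

lemma ev_ge_linear_of_deriv_ge:
  fixes w :: "real \<Rightarrow> real"
  assumes w: "\<forall>\<^sub>F x in at_top. (w has_real_derivative w' x) (at x)" and ge: "\<forall>\<^sub>F x in at_top. w' x \<ge> c" and "d < c"
  shows "\<forall>\<^sub>F x in at_top. w x \<ge> d * x"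
proof -
  have "\<forall>\<^sub>F x in at_top. ((\<lambda>x. w x - c * x) has_real_derivative w' x - c) (at x)"
    using w by eventually_elim (auto intro!: derivative_eq_intros)
  moreover have "\<forall>\<^sub>F x in at_top. w' x - c \<ge> 0" using ge by eventually_elim simp
  ultimately obtain a where a: "\<And>x y. a \<le> x \<Longrightarrow> x \<le> y \<Longrightarrow> w x - c * x \<le> w y - c * y"
    by (rule ev_deriv_nonneg_mono) blast
  have "filterlim (\<lambda>x. (c - d) * x) at_top at_top"
    using assms(3) by (intro filterlim_tendsto_pos_mult_at_top[OF tendsto_const _ filterlim_ident]) auto
  then have "\<forall>\<^sub>F x in at_top. (c - d) * x \<ge> - (w a - c * a)" unfolding filterlim_at_top by blast
  with eventually_ge_at_top[of a] show ?thesis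
  proof eventually_elim
    case (elim x)
    then show ?case using a[of a x] by (simp add: algebra_simps)
  qed
qed

text \<open>If \<open>- g' > g powr (7/4)\<close> eventually, then \<open>g powr (- 3/4)\<close> would grow linearly and \<open>g\<close> would be integrable,
  contradicting the divergence of its primitive \<open>G\<close>. Comparability of germs excludes any other behaviour.\<close>

lemma slow_decay_estimates:
  fixes G g g' :: "real \<Rightarrow> real"
  assumes G: "\<forall>\<^sub>F x in at_top. (G has_real_derivative g x) (at x)"
    and g: "\<forall>\<^sub>F x in at_top. (g has_real_derivative g' x) (at x)"
    and top: "filterlim G at_top at_top" and pos: "\<forall>\<^sub>F x in at_top. g x > 0"
    and neg: "\<forall>\<^sub>F x in at_top. g' x < 0"
    and signed: "ev_signed (\<lambda>x. (- g' x) ^ 4 - g x ^ 7)" and small: "((\<lambda>x. x * g' x) \<longlongrightarrow> 0) at_top"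
  shows "\<forall>\<^sub>F x in at_top. g x powr (- 3 / 4) \<le> x \<and> - g' x \<le> g x powr (3 / 2) * x powr (- 1 / 7)"
proof -
  \<comment> \<open>The exponent 7/4 obeys two constraints. Below 2, linear growth of
    \<open>g powr (1 - 7 / 4)\<close> makes \<open>g\<close> integrable; above 3/2, there is
    something to spare over \<open>g powr (3 / 2)\<close>. Fourth powers turn the comparison into
    the sign of a polynomial expression.\<close>
  define w where "w = (\<lambda>x. g x powr (- 3 / 4))"
  define w' where "w' = (\<lambda>x. 3 / 4 * (g x powr (- 7 / 4) * - g' x))"
  have w: "\<forall>\<^sub>F x in at_top. (w has_real_derivative w' x) (at x)"
    using g pos
  proof eventually_elim
    case (elim x)
    have "(w has_real_derivative (- 3 / 4) * g x powr (- 3 / 4 - of_nat 1) * g' x) (at x)"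
      unfolding w_def by (rule DERIV_fun_powr) (use elim in auto)
    then show ?case unfolding w'_def by (simp add: mult_ac)
  qed
  have pw: "(u powr (7 / 4)) ^ 4 = u ^ 7" "u powr (- 7 / 4) * u powr (7 / 4) = 1" "(u powr (- 3 / 4)) powr (- 4 / 3) = u" if "u > 0" for u :: real
    using that powr_realpow[of u 7] by (simp_all add: powr_power powr_powr flip: powr_add)
  from signed show ?thesis
  proof (cases rule: ev_signed_cases_le)
    case 1
    have "\<forall>\<^sub>F x in at_top. w' x \<ge> 3 / 4" using 1 pos neg
    proof eventually_elim
      case (elim x)
      have "(g x powr (7 / 4)) ^ 4 < (- g' x) ^ 4" using elim pw by simp
      then have "g x powr (7 / 4) < - g' x" by (rule power_less_imp_less_base) (use elim in auto)
      then have "g x powr (- 7 / 4) * g x powr (7 / 4) \<le> g x powr (- 7 / 4) * - g' x" by (intro mult_left_mono) auto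
      then have "1 \<le> g x powr (- 7 / 4) * - g' x" unfolding pw(2)[OF \<open>0 < g x\<close>] .
      then have "3 / 4 * 1 \<le> 3 / 4 * (g x powr (- 7 / 4) * - g' x)" by (intro mult_left_mono) auto
      then show ?case unfolding w'_def by linarith
    qed
    from ev_ge_linear_of_deriv_ge[OF w this, of "1/2"] have "\<forall>\<^sub>F x in at_top. w x \<ge> 1/2 * x" by simp
    with pos eventually_gt_at_top[of 0] have "\<forall>\<^sub>F x in at_top. g x \<le> (x / 2) powr (- 4 / 3)"
    proof eventually_elim
      case (elim x)
      have "(w x) powr (- 4 / 3) \<le> (x / 2) powr (- 4 / 3)" using elim by (intro powr_mono2') auto
      then show ?case unfolding w_def using pw(3)[of "g x"] elim by simp
    qed
    then show ?thesis using bounded_of_deriv_le[OF G _ top] by blast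
  next
    case 2
    have le: "\<forall>\<^sub>F x in at_top. (- g' x) ^ 4 \<le> g x ^ 7" using 2 by eventually_elim simp
    have "\<forall>\<^sub>F x in at_top. - w' x \<ge> - (3 / 4)" using le pos neg
    proof eventually_elim
      case (elim x)
      have "(- g' x) ^ 4 \<le> (g x powr (7 / 4)) ^ 4" using elim pw by simp
      then have "- g' x \<le> g x powr (7 / 4)" by (subst (asm) power_mono_iff) (use elim in auto)
      then have "g x powr (- 7 / 4) * - g' x \<le> g x powr (- 7 / 4) * g x powr (7 / 4)" by (intro mult_left_mono) auto
      then have "g x powr (- 7 / 4) * - g' x \<le> 1" unfolding pw(2)[OF \<open>0 < g x\<close>] .
      then have "3 / 4 * (g x powr (- 7 / 4) * - g' x) \<le> 3 / 4 * 1" by (intro mult_left_mono) auto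
      then show ?case unfolding w'_def by linarith
    qed
    moreover have "\<forall>\<^sub>F x in at_top. ((\<lambda>x. - w x) has_real_derivative - w' x) (at x)"
      using w by eventually_elim (rule DERIV_minus)
    ultimately have "\<forall>\<^sub>F x in at_top. - w x \<ge> (- 1) * x" using ev_ge_linear_of_deriv_ge[of "\<lambda>x. - w x" "\<lambda>x. - w' x" "- (3/4)" "- 1"] by simp
    moreover have "\<forall>\<^sub>F x in at_top. \<bar>x * g' x\<bar> < 1" using small by (auto simp: tendsto_iff dist_real_def)
    ultimately show ?thesis using le pos neg eventually_gt_at_top[of 0]
    proof eventually_elim
      case (elim x)
      \<comment> \<open>Twelve factors bounded by \<open>g powr (7 / 4)\<close> and two bounded by
        \<open>1 / x\<close> give \<open>g ^ 21 * x powr (- 2)\<close>; the fourteenth root trades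
        the surplus in the exponent of \<open>g\<close> for the factor
        \<open>x powr (- 1 / 7)\<close>.\<close>
      have "(- g' x) ^ 12 = ((- g' x) ^ 4) ^ 3" by (simp flip: power_mult)
      also have "\<dots> \<le> (g x ^ 7) ^ 3" using elim by (intro power_mono) auto
      also have "\<dots> = g x ^ 21" by (simp flip: power_mult)
      finally have a: "(- g' x) ^ 12 \<le> g x ^ 21" .
      have "x * - g' x \<le> 1" using elim by (auto simp: abs_if split: if_splits)
      then have "- g' x \<le> 1 / x" using elim by (simp add: field_simps)
      then have "(- g' x)\<^sup>2 \<le> (1 / x)\<^sup>2" using elim by (intro power_mono) auto
      then have b: "(- g' x)\<^sup>2 \<le> x powr (- 2)" using elim by (simp add: powr_minus powr_numeral divide_inverse power_inverse)
      have "(- g' x) ^ 14 = (- g' x) ^ 12 * (- g' x)\<^sup>2" by (simp flip: power_add)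
      also have "\<dots> \<le> g x ^ 21 * x powr (- 2)" using a b elim by (intro mult_mono) auto
      also have "\<dots> = (g x powr (3 / 2) * x powr (- 1 / 7)) ^ 14"
        using elim powr_realpow[of "g x" 21] by (simp add: power_mult_distrib powr_power)
      finally have "(- g' x) ^ 14 \<le> (g x powr (3 / 2) * x powr (- 1 / 7)) ^ 14" .
      then have "- g' x \<le> g x powr (3 / 2) * x powr (- 1 / 7)" using elim by (subst (asm) power_mono_iff) auto
      then show ?case using elim unfolding w_def by simp
    qed
  qed
qed

context hardy_ring
begin

text \<open>The Taylor coefficient \<open>g X / fact k\<close> tends to 0, so a step
  \<open>q\<close> with \<open>q ^ k * g X / fact k\<close> close to any prescribed positive
  \<open>\<tau>\<close> exists and tends to infinity. As \<open>k \<ge> 2\<close>, this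
  \<open>q\<close> is \<open>O(g powr (- 1 / 2))\<close>, hence \<open>O(X powr (2 / 3))\<close> and
  eventually at most \<open>X\<close>. The remainder \<open>g' * q ^ Suc k\<close> is
  \<open>O(X powr (- 1 / 7))\<close>, and \<open>y ^ Suc k \<le> X powr (1 / 8)\<close> still leaves
  it small: this is the origin of \<open>8 * Suc k\<close>.\<close>

lemma local_poly_infinite_limit:
  assumes U: "chain U" and k: "k \<ge> 2" and lim: "(U k \<longlongrightarrow> 0) at_top" and top: "filterlim (U (k - 1)) at_top at_top"
    and Q: "Q \<ge> 1" and \<tau>: "\<tau> > 0"
  shows "local_poly (U 0) k \<tau> (8 * Suc k) Q"
proof -
  define g where "g = U k"
  define g' where "g' = U (Suc k)"
  have k1: "Suc (k - 1) = k" using k by simp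
  have G: "\<forall>\<^sub>F x in at_top. (U (k - 1) has_real_derivative g x) (at x)"
    using chainD(2)[OF U, of "k - 1"] unfolding k1 g_def .
  have g: "\<forall>\<^sub>F x in at_top. (g has_real_derivative g' x) (at x)"
    using chainD(2)[OF U, of k] unfolding g_def g'_def .
  have gR: "g \<in> R" "g' \<in> R" using chainD(1)[OF U] unfolding g_def g'_def by auto
  have pos: "\<forall>\<^sub>F x in at_top. g x > 0" by (rule deriv_pos_of_at_top[OF G R_signed[OF gR(1)] top])
  have g0: "(g \<longlongrightarrow> 0) at_top" using lim unfolding g_def .
  have neg: "\<forall>\<^sub>F x in at_top. g' x < 0"
    using R_signed[OF R_uminus[OF gR(2)]]
  proof (cases rule: ev_signed_cases_le)
    case 1 then show ?thesis by eventually_elim simp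
  next
    case 2
    then have "\<forall>\<^sub>F x in at_top. g' x \<ge> 0" by eventually_elim simp
    then obtain a where a: "\<And>x y. a \<le> x \<Longrightarrow> x \<le> y \<Longrightarrow> g x \<le> g y" by (rule ev_deriv_nonneg_mono[OF g]) blast
    obtain b where b: "\<And>x. x \<ge> b \<Longrightarrow> g x > 0" using pos by (auto simp: eventually_at_top_linorder)
    define c where "c = max a b"
    have "\<forall>\<^sub>F x in at_top. g x < g c" using g0 by (rule order_tendstoD) (use b in \<open>simp add: c_def\<close>)
    with eventually_ge_at_top[of c] have "\<forall>\<^sub>F x::real in at_top. False"
    proof eventually_elim
      case (elim x) then show ?case using a[of c x] by (simp add: c_def)
    qed
    then show ?thesis by simp
  qed
  have small: "((\<lambda>x. x * g' x) \<longlongrightarrow> 0) at_top" using decay(2)[OF U lim] unfolding g'_def .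
  have est: "\<forall>\<^sub>F x in at_top. g x powr (- 3 / 4) \<le> x \<and> - g' x \<le> g x powr (3 / 2) * x powr (- 1 / 7)"
    by (rule slow_decay_estimates[OF G g top pos neg _ small]) (intro R_signed R_diff R_power R_uminus gR)
  define A where "A = fact k * \<tau>"
  define A' where "A' = max 1 A"
  have A: "A > 0" "A' \<ge> 1" "A \<le> A'" using \<tau> by (auto simp: A_def A'_def)
  define z where "z = (\<lambda>x. (A / g x) powr (1 / real k))"
  have "filterlim (\<lambda>x. inverse (g x)) at_top at_top"
    using g0 pos by (rule filterlim_inverse_at_top)
  then have "filterlim (\<lambda>x. A * inverse (g x)) at_top at_top"
    using A by (intro filterlim_tendsto_pos_mult_at_top[OF tendsto_const]) auto
  then have ztop: "filterlim z at_top at_top"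
    unfolding z_def divide_inverse using k
    by (intro filterlim_compose[OF real_powr_at_top]) auto
  \<comment> \<open>Rounding down to a multiple of \<open>Q\<close> is harmless because
    \<open>z\<close> tends to infinity.\<close>
  define q where "q = (\<lambda>x. Q * nat \<lfloor>z x / real Q\<rfloor>)"
  have qz: "\<forall>\<^sub>F x in at_top. real (q x) \<le> z x \<and> z x - real Q \<le> real (q x)"
  proof -
    have "\<forall>\<^sub>F x in at_top. z x \<ge> 0" by (simp add: z_def)
    then show ?thesis
    proof eventually_elim
      case (elim x)
      have "real (nat \<lfloor>z x / real Q\<rfloor>) \<le> z x / real Q" using elim by (simp add: of_nat_nat)
      moreover have "z x / real Q - 1 \<le> real (nat \<lfloor>z x / real Q\<rfloor>)" using elim by linarith
      ultimately show ?case unfolding q_def using Q by (simp add: field_simps)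
    qed
  qed
  have qr: "((\<lambda>x. real (q x) / z x) \<longlongrightarrow> 1) at_top"
  proof (rule tendsto_sandwich)
    have "((\<lambda>x. 1 - real Q * inverse (z x)) \<longlongrightarrow> 1 - real Q * 0) at_top"
      by (intro tendsto_intros filterlim_compose[OF tendsto_inverse_0_at_top[OF filterlim_ident] ztop])
    then show "((\<lambda>x. 1 - real Q * inverse (z x)) \<longlongrightarrow> 1) at_top" by simp
    show "((\<lambda>x. 1::real) \<longlongrightarrow> 1) at_top" by simp
    have zpos: "\<forall>\<^sub>F x in at_top. z x > 0" using ztop by (simp add: filterlim_at_top_dense)
    show "\<forall>\<^sub>F x in at_top. 1 - real Q * inverse (z x) \<le> real (q x) / z x" using qz zpos
    proof eventually_elim
      case (elim x)
      have "1 - real Q * inverse (z x) = (z x - real Q) / z x" using elim by (simp add: field_simps)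
      also have "\<dots> \<le> real (q x) / z x" using elim by (intro divide_right_mono) auto
      finally show ?case .
    qed
    show "\<forall>\<^sub>F x in at_top. real (q x) / z x \<le> 1" using qz zpos
      by eventually_elim (simp add: field_simps)
  qed
  have zk: "\<forall>\<^sub>F x in at_top. z x ^ k = A / g x" using pos
  proof eventually_elim
    case (elim x)
    have "z x ^ k = (A / g x) powr (real k * (1 / real k))"
      unfolding z_def by (rule powr_power) (use k elim A in auto)
    then show ?case using elim A k by simp
  qed
  define c where "c = (\<lambda>x j. U j x / fact j * real (q x) ^ j)"
  have ck: "((\<lambda>x. c x k) \<longlongrightarrow> \<tau>) at_top"
  proof (rule Lim_transform_eventually)
    have "((\<lambda>x. \<tau> * (real (q x) / z x) ^ k) \<longlongrightarrow> \<tau> * 1 ^ k) at_top" by (intro tendsto_intros qr)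
    then show "((\<lambda>x. \<tau> * (real (q x) / z x) ^ k) \<longlongrightarrow> \<tau>) at_top" by simp
    show "\<forall>\<^sub>F x in at_top. \<tau> * (real (q x) / z x) ^ k = c x k" using zk pos
    proof eventually_elim
      case (elim x)
      then show ?case unfolding c_def g_def[symmetric] power_divide elim A_def using \<tau> by (simp add: field_simps)
    qed
  qed
  have zbound: "\<forall>\<^sub>F x in at_top. z x \<le> A' * g x powr (- 1 / 2)"
  proof -
    have "\<forall>\<^sub>F x in at_top. g x < 1" using g0 by (rule order_tendstoD) simp
    with pos show ?thesis
    proof eventually_elim
      case (elim x)
      have "z x = A powr (1 / real k) * (g x) powr (- (1 / real k))"
        unfolding z_def using elim A by (simp add: powr_divide powr_minus_divide)
      also have "\<dots> \<le> A' * g x powr (- 1 / 2)"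
      proof (rule mult_mono)
        have "A powr (1 / real k) \<le> A' powr (1 / real k)" using A by (intro powr_mono2) auto
        also have "\<dots> \<le> A' powr 1" using A k by (intro powr_mono) auto
        finally show "A powr (1 / real k) \<le> A'" using A by simp
        show "g x powr - (1 / real k) \<le> g x powr (- 1 / 2)"
          using elim k by (intro powr_mono') (auto simp: field_simps)
      qed (use A in auto)
      finally show ?case .
    qed
  qed
  have qx: "\<forall>\<^sub>F x in at_top. real (q x) \<le> x"
  proof -
    have "\<forall>\<^sub>F x::real in at_top. A' * x powr (2 / 3) \<le> x" by real_asymp
    with qz zbound est pos eventually_gt_at_top[of 0] show ?thesis
    proof eventually_elim
      case (elim x)
      have "g x powr (- 1 / 2) = (g x powr (- 3 / 4)) powr (2 / 3)" by (simp add: powr_powr)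
      also have "\<dots> \<le> x powr (2 / 3)" using elim by (intro powr_mono2) auto
      finally have "A' * g x powr (- 1 / 2) \<le> A' * x powr (2 / 3)" using A by (intro mult_left_mono) auto
      then show ?case using elim by linarith
    qed
  qed
  have rem: "\<forall>\<^sub>F x in at_top. \<bar>g' x\<bar> * real (q x) ^ Suc k \<le> (A * A') * x powr (- 1 / 7)"
    using qz zbound est pos neg zk
  proof eventually_elim
    case (elim x)
    have q0: "0 \<le> real (q x)" by simp
    have "real (q x) ^ Suc k \<le> z x ^ Suc k" using elim by (intro power_mono) auto
    also have "\<dots> = z x * (A / g x)" using elim by simp
    also have "\<dots> \<le> (A' * g x powr (- 1 / 2)) * (A / g x)" using elim A by (intro mult_right_mono) auto
    finally have "\<bar>g' x\<bar> * real (q x) ^ Suc k \<le> (g x powr (3 / 2) * x powr (- 1 / 7)) * ((A' * g x powr (- 1 / 2)) * (A / g x))"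
      using elim by (intro mult_mono) auto
    also have "\<dots> = (A * A') * x powr (- 1 / 7) * (g x powr (3 / 2) * g x powr (- 1 / 2) / g x)" by simp
    also have "g x powr (3 / 2) * g x powr (- 1 / 2) / g x = 1" using elim by (simp flip: powr_add)
    finally show ?case by simp
  qed
  show ?thesis unfolding local_poly_def
  proof (intro allI impI)
    fix \<epsilon> :: real assume \<epsilon>: "\<epsilon> > 0"
    have q1: "\<forall>\<^sub>F x in at_top. q x \<ge> 1"
    proof -
      have "\<forall>\<^sub>F x in at_top. z x \<ge> real Q + 1" using ztop unfolding filterlim_at_top by blast
      with qz show ?thesis by eventually_elim linarith
    qed
    have ce: "\<forall>\<^sub>F x in at_top. \<bar>c x k - \<tau>\<bar> < \<epsilon>" using ck \<epsilon> by (auto simp: tendsto_iff dist_real_def)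
    have "((\<lambda>x::real. (A * A') * x powr (- 1 / 7) * x powr (1 / 8)) \<longlongrightarrow> 0) at_top" by real_asymp
    then have "\<forall>\<^sub>F x in at_top. (A * A') * x powr (- 1 / 7) * x powr (1 / 8) < \<epsilon>" using \<epsilon> by (rule order_tendstoD)
    with q1 ce qx rem taylor_bound[OF U lim] eventually_gt_at_top[of 0]
    have "\<forall>\<^sub>F x in at_top. 1 \<le> q x \<and> real (q x) \<le> x \<and> \<bar>c x k - \<tau>\<bar> \<le> \<epsilon> \<and>
        (\<forall>y::nat. real y ^ (8 * Suc k) \<le> x \<longrightarrow> \<bar>U 0 (x + real (q x) * real y) - (\<Sum>j\<le>k. c x j * real y ^ j)\<bar> \<le> \<epsilon>)"
    proof eventually_elim
      case (elim x)
      have "\<bar>U 0 (x + real (q x) * real y) - (\<Sum>j\<le>k. c x j * real y ^ j)\<bar> \<le> \<epsilon>" if y: "real y ^ (8 * Suc k) \<le> x" for y :: nat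
      proof -
        have "real y ^ Suc k \<le> x powr (1 / 8)"
        proof -
          have "(real y ^ Suc k) ^ 8 \<le> (x powr (1 / 8)) ^ 8"
          proof -
            have "(real y ^ Suc k) ^ 8 = real y ^ (8 * Suc k)" by (simp only: mult.commute[of 8] power_mult)
            moreover have "(x powr (1 / 8)) ^ 8 = x" using elim by (simp add: powr_power)
            ultimately show ?thesis using y by simp
          qed
          then show ?thesis by (subst (asm) power_mono_iff) auto
        qed
        have "\<bar>U 0 (x + real (q x) * real y) - (\<Sum>j\<le>k. U j x / fact j * (real (q x) * real y) ^ j)\<bar> \<le> \<bar>g' x\<bar> * (real (q x) * real y) ^ Suc k"
          using elim unfolding g'_def by simp
        also have "\<dots> = (\<bar>g' x\<bar> * real (q x) ^ Suc k) * real y ^ Suc k" by (simp add: power_mult_distrib)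
        also have "\<dots> \<le> ((A * A') * x powr (- 1 / 7)) * x powr (1 / 8)"
          by (rule mult_mono) (use elim \<open>real y ^ Suc k \<le> x powr (1 / 8)\<close> A in auto)
        also have "\<dots> \<le> \<epsilon>" using elim by simp
        finally show ?thesis unfolding c_def by (simp add: power_mult_distrib mult.assoc)
      qed
      then show ?case using elim by auto
    qed
    then have "\<forall>\<^sub>F X in sequentially. 1 \<le> q (real X) \<and> real (q (real X)) \<le> real X \<and> \<bar>c (real X) k - \<tau>\<bar> \<le> \<epsilon> \<and>
        (\<forall>y::nat. real y ^ (8 * Suc k) \<le> real X \<longrightarrow> \<bar>U 0 (real X + real (q (real X)) * real y) - (\<Sum>j\<le>k. c (real X) j * real y ^ j)\<bar> \<le> \<epsilon>)"
      using filterlim_real_sequentially by (rule eventually_compose_filterlim)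
    then show "\<forall>\<^sub>F X in sequentially. \<exists>q c. 1 \<le> q \<and> Q dvd q \<and> q \<le> X \<and> \<bar>c k - \<tau>\<bar> \<le> \<epsilon> \<and>
     (\<forall>y. y ^ (8 * Suc k) \<le> X \<longrightarrow> \<bar>U 0 (real X + real q * real y) - (\<Sum>j\<le>k. c j * real y ^ j)\<bar> \<le> \<epsilon>)"
    proof eventually_elim
      case (elim X)
      have "Q dvd q (real X)" unfolding q_def by simp
      moreover have "real y ^ (8 * Suc k) \<le> real X" if "y ^ (8 * Suc k) \<le> X" for y
        using that by (metis of_nat_le_iff of_nat_power)
      ultimately show ?case using elim by (intro exI[of _ "q (real X)"] exI[of _ "c (real X)"]) auto
    qed
  qed
qed

text \<open>Let \<open>p = Suc D\<close>. If \<open>f' ^ p > f ^ D\<close> held eventually, then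
  \<open>f powr (1 / p)\<close> would grow at least linearly and \<open>f\<close> at least like
  \<open>x ^ p\<close>, against the growth condition. By comparability the reverse inequality holds
  eventually; it says that \<open>f powr (1 / p)\<close> has derivative at most
  \<open>1 / p\<close>.\<close>

lemma gap_bound:
  assumes U: "chain U" and top: "filterlim (U 0) at_top at_top" and growth: "\<forall>\<^sub>F x in at_top. \<bar>U 0 x\<bar> \<le> K * x ^ D"
  shows "\<forall>\<^sub>F x in at_top. U 0 (x + 1) powr (1 / real (Suc D)) \<le> U 0 x powr (1 / real (Suc D)) + 1"
proof -
  define p where "p = Suc D"
  define r where "r = 1 / real p"
  define f where "f = U 0"
  define f' where "f' = U (Suc 0)"
  have f: "\<forall>\<^sub>F x in at_top. (f has_real_derivative f' x) (at x)" using chainD(2)[OF U, of 0] unfolding f_def f'_def .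
  have fR: "f \<in> R" "f' \<in> R" using chainD(1)[OF U] unfolding f_def f'_def by auto
  have f'pos: "\<forall>\<^sub>F x in at_top. f' x > 0" using deriv_pos_of_at_top[OF f R_signed[OF fR(2)]] top unfolding f_def by simp
  have fpos: "\<forall>\<^sub>F x in at_top. f x > 0" using top unfolding f_def by (simp add: filterlim_at_top_dense)
  define w where "w = (\<lambda>x. f x powr r)"
  define w' where "w' = (\<lambda>x. r * f x powr (r - 1) * f' x)"
  have w: "\<forall>\<^sub>F x in at_top. (w has_real_derivative w' x) (at x)"
    using f fpos
  proof eventually_elim
    case (elim x)
    have "(w has_real_derivative r * f x powr (r - of_nat 1) * f' x) (at x)"
      unfolding w_def by (rule DERIV_fun_powr) (use elim in auto)
    then show ?case unfolding w'_def by simp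
  qed
  have r: "r > 0" "r \<le> 1" "r * real p = 1" unfolding r_def p_def by auto
  have pw: "(u powr (1 - r)) ^ p = u ^ D" "u powr (r - 1) * u powr (1 - r) = 1" if "u > 0" for u :: real
  proof -
    have "real p * (1 - r) = real D" using r(3) by (simp add: right_diff_distrib mult.commute) (simp add: p_def)
    moreover have "(u powr (1 - r)) ^ p = u powr (real p * (1 - r))" using that by (simp add: powr_power)
    ultimately show "(u powr (1 - r)) ^ p = u ^ D" using that by (simp add: powr_realpow)
    show "u powr (r - 1) * u powr (1 - r) = 1" using that by (simp flip: powr_add)
  qed
  have "ev_signed (\<lambda>x. f' x ^ p - f x ^ D)" by (intro R_signed R_diff R_power fR)
  then have "\<forall>\<^sub>F x in at_top. f' x ^ p \<le> f x ^ D"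
  proof (cases rule: ev_signed_cases_le)
    case 1
    have "\<forall>\<^sub>F x in at_top. w' x \<ge> r" using 1 fpos f'pos
    proof eventually_elim
      case (elim x)
      have "(f x powr (1 - r)) ^ p < f' x ^ p" using elim pw by simp
      then have "f x powr (1 - r) < f' x" by (rule power_less_imp_less_base) (use elim in auto)
      then have "f x powr (r - 1) * f x powr (1 - r) \<le> f x powr (r - 1) * f' x" by (intro mult_left_mono) auto
      then have "r * 1 \<le> r * (f x powr (r - 1) * f' x)" using pw(2)[of "f x"] elim r by (intro mult_left_mono) auto
      then show ?case unfolding w'_def by (simp add: mult.assoc)
    qed
    from ev_ge_linear_of_deriv_ge[OF w this, of "r / 2"] r have "\<forall>\<^sub>F x in at_top. w x \<ge> r / 2 * x" by simp
    with fpos growth eventually_gt_at_top[of "max 1 (K / (r / 2) ^ p)"] have "\<forall>\<^sub>F x::real in at_top. False"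
    proof eventually_elim
      case (elim x)
      have x: "x > 1" "x > K / (r / 2) ^ p" using elim by auto
      have rp: "(r / 2) ^ p > 0" using r by simp
      have "(r / 2 * x) ^ p \<le> w x ^ p" using elim x r by (intro power_mono) auto
      also have "\<dots> = f x powr (real p * r)" unfolding w_def by (rule powr_power) (use elim in \<open>simp add: p_def\<close>)
      also have "\<dots> = f x" using elim r(3) by (simp add: mult.commute)
      also have "\<dots> \<le> K * x ^ D" using elim unfolding f_def by simp
      finally have le: "((r / 2) ^ p * x) * x ^ D \<le> K * x ^ D" unfolding power_mult_distrib by (simp add: p_def mult.assoc)
      have "(r / 2) ^ p * x \<le> K" using le x by (metis mult_right_le_imp_le zero_less_power less_trans zero_less_one)
      then show ?case using x(2) rp by (simp add: field_simps)
    qed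
    then show ?thesis by simp
  next
    case 2 then show ?thesis by eventually_elim simp
  qed
  with fpos f'pos have "\<forall>\<^sub>F x in at_top. w' x \<le> 1"
  proof eventually_elim
    case (elim x)
    have "f' x ^ p \<le> (f x powr (1 - r)) ^ p" using elim pw by simp
    then have "f' x \<le> f x powr (1 - r)" using elim by (subst (asm) power_mono_iff) (auto simp: p_def)
    then have "f x powr (r - 1) * f' x \<le> f x powr (r - 1) * f x powr (1 - r)" by (intro mult_left_mono) auto
    then have "f x powr (r - 1) * f' x \<le> 1" using pw(2)[of "f x"] elim by simp
    then have "r * (f x powr (r - 1) * f' x) \<le> 1 * 1" using r elim by (intro mult_mono) auto
    then show ?case unfolding w'_def by (simp add: mult.assoc)
  qed
  with w have "\<forall>\<^sub>F x in at_top. (w has_real_derivative w' x) (at x) \<and> w' x \<le> 1" by eventually_elim auto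
  then obtain a where a: "\<And>x. x \<ge> a \<Longrightarrow> (w has_real_derivative w' x) (at x) \<and> w' x \<le> 1"
    by (auto simp: eventually_at_top_linorder)
  have "w (x + 1) \<le> w x + 1" if "x \<ge> a" for x
  proof -
    have "\<exists>t>x. t < x + 1 \<and> w (x + 1) - w x = (x + 1 - x) * w' t" by (rule MVT2) (use a that in auto)
    then obtain t where "t > x" "w (x + 1) - w x = w' t" by auto
    then show ?thesis using a[of t] that by simp
  qed
  then have "\<forall>\<^sub>F x in at_top. w (x + 1) \<le> w x + 1" unfolding eventually_at_top_linorder by blast
  then show ?thesis unfolding w_def f_def r_def p_def .
qed

end

section \<open>Positive density\<close>

text \<open>Each greedy subtraction replaces a remainder of order \<open>m\<close> by one of order
  \<open>m powr \<rho>\<close>, so \<open>t\<close> of them bring the exponent down to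
  \<open>\<rho> ^ t\<close>.\<close>

lemma greedy_iterate:
  fixes \<rho> K :: real
  assumes A0: "0 \<in> A" and \<rho>: "0 \<le> \<rho>" "\<rho> \<le> 1" and K: "K \<ge> 0"
    and greedy: "\<And>m. \<exists>a\<in>A. a \<le> m \<and> real (m - a) \<le> K * (real m + 1) powr \<rho>"
  shows "\<exists>K'\<ge>0. \<forall>N\<ge>1. \<forall>m\<le>N. \<exists>a\<in>sums_of t A. a \<le> m \<and> real (m - a) \<le> K' * real N powr (\<rho> ^ t)"
proof (induction t)
  case 0
  have "0 \<in> sums_of 0 A" by (auto simp: sums_of_def)
  then show ?case by (intro exI[of _ 1]) auto
next
  case (Suc t)
  then obtain K' where K': "K' \<ge> 0" "\<And>N m. N \<ge> 1 \<Longrightarrow> m \<le> N \<Longrightarrow> \<exists>a\<in>sums_of t A. a \<le> m \<and> real (m - a) \<le> K' * real N powr (\<rho> ^ t)"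
    by blast
  have "\<exists>a\<in>sums_of (Suc t) A. a \<le> m \<and> real (m - a) \<le> (K * (K' + 1)) * real N powr (\<rho> ^ Suc t)"
    if N: "N \<ge> 1" and m: "m \<le> N" for N m :: nat
  proof -
    obtain a where a: "a \<in> sums_of t A" "a \<le> m" "real (m - a) \<le> K' * real N powr (\<rho> ^ t)"
      using K'(2)[OF N m] by blast
    obtain b where b: "b \<in> A" "b \<le> m - a" "real (m - a - b) \<le> K * (real (m - a) + 1) powr \<rho>"
      using greedy[of "m - a"] by blast
    have N1: "1 \<le> real N powr (\<rho> ^ t)" using N \<rho> by (intro ge_one_powr_ge_zero) auto
    have "real (m - a) + 1 \<le> (K' + 1) * real N powr (\<rho> ^ t)" using a(3) N1 by (simp add: algebra_simps)
    then have "(real (m - a) + 1) powr \<rho> \<le> ((K' + 1) * real N powr (\<rho> ^ t)) powr \<rho>"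
      using \<rho> by (intro powr_mono2) auto
    also have "\<dots> = (K' + 1) powr \<rho> * real N powr (\<rho> ^ Suc t)"
      using K' by (simp add: powr_mult powr_powr mult.commute)
    also have "\<dots> \<le> (K' + 1) powr 1 * real N powr (\<rho> ^ Suc t)"
      using K' \<rho> by (intro mult_right_mono powr_mono) auto
    finally have "K * (real (m - a) + 1) powr \<rho> \<le> K * ((K' + 1) * real N powr (\<rho> ^ Suc t))"
      using K K' by (intro mult_left_mono) auto
    then have "real (m - (a + b)) \<le> (K * (K' + 1)) * real N powr (\<rho> ^ Suc t)" using b by (simp add: mult.assoc)
    moreover have "a + b \<in> sums_of (Suc t) A" using sums_of_addI[OF a(1), of b "Suc 0"] b(1) by (simp add: sums_of_1)
    ultimately show ?thesis using a b by (intro bexI[of _ "a + b"]) auto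
  qed
  then show ?case using K K' by (intro exI[of _ "K * (K' + 1)"]) auto
qed

text \<open>The base points lie within \<open>L\<close> below distinct multiples of
  \<open>3 * L\<close>, hence at least \<open>2 * L\<close> apart, while \<open>E\<close> fits into
  a window of length \<open>L\<close>: the translates are disjoint.\<close>

lemma card_translates:
  fixes L e0 :: nat
  assumes L: "L \<ge> 1" and E: "E \<subseteq> {e0..e0 + L}" and a: "\<And>i. i < n \<Longrightarrow> a i \<le> 3 * L * (i + 1) \<and> 3 * L * (i + 1) \<le> a i + L"
  shows "card ((\<lambda>(i, x). a i + x) ` ({..<n} \<times> E)) = n * card E"
proof -
  have lt: "a i + x < a i' + x'" if "i < i'" "i' < n" "x \<in> E" "x' \<in> E" for i i' x x'
  proof -
    have x: "x \<le> e0 + L" "e0 \<le> x'" using E that by auto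
    have "a i \<le> 3 * L * (i + 1)" "3 * L * (i' + 1) \<le> a i' + L" using a that by auto
    moreover have "3 * L * (i + 1) + 3 * L \<le> 3 * L * (i' + 1)"
      using mult_le_mono2[of "i + 2" "i' + 1" "3 * L"] that by (simp add: algebra_simps)
    ultimately show ?thesis using x L by linarith
  qed
  have "inj_on (\<lambda>(i, x). a i + x) ({..<n} \<times> E)"
  proof (rule inj_onI, clarify)
    fix i i' x x' assume *: "i < n" "i' < n" "x \<in> E" "x' \<in> E" "a i + x = a i' + x'"
    then have "i = i'" using lt[of i i' x x'] lt[of i' i x' x] by (cases i i' rule: linorder_cases) auto
    then show "i = i' \<and> x = x'" using * by simp
  qed
  then show ?thesis by (simp add: card_image card_cartesian_product)
qed

text \<open>For given \<open>N\<close>, the scale \<open>Z\<close> is about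
  \<open>N powr (1 / M')\<close>. Greedy sums of \<open>t\<close> elements reach every target up to
  \<open>N\<close> with an error below the window length, so copies of the local set can be placed
  along the whole interval with density bounded below.\<close>

lemma density_of_local_sets:
  fixes \<rho> K \<delta> K2 :: real and L1 k M :: nat
  assumes A0: "0 \<in> A" and \<rho>: "0 \<le> \<rho>" "\<rho> < 1" and K: "K \<ge> 0"
    and greedy: "\<And>m. \<exists>a\<in>A. a \<le> m \<and> real (m - a) \<le> K * (real m + 1) powr \<rho>"
    and k: "k \<ge> 1" and \<delta>: "\<delta> > 0"
    and loc: "\<forall>\<^sub>F Z in sequentially. \<exists>E e0. E \<subseteq> sums_of s A \<and> E \<subseteq> {e0..e0 + L1 * Z ^ k} \<and> \<delta> * real Z ^ k \<le> real (card E)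
       \<and> real (e0 + L1 * Z ^ k) \<le> K2 * real Z ^ M"
  obtains r \<delta>' N0 where "\<delta>' > 0" "\<And>N. N \<ge> N0 \<Longrightarrow> \<delta>' * real N \<le> real (card (sums_of r A \<inter> {0..N}))"
proof -
  \<comment> \<open>\<open>M\<close> accounts for the height of a local set and \<open>k\<close> for
    its length; the extra 1 provides a factor \<open>Z\<close> that absorbs the constants.\<close>
  define M' where "M' = M + k + 1"
  have "(\<lambda>t. \<rho> ^ t) \<longlonglongrightarrow> 0" using \<rho> by (intro LIMSEQ_realpow_zero) auto
  then have "\<forall>\<^sub>F t in sequentially. \<rho> ^ t < 1 / real M'" by (rule order_tendstoD) (simp add: M'_def)
  then obtain t where t: "\<rho> ^ t < 1 / real M'" by (auto simp: eventually_sequentially)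
  obtain Kt where Kt: "Kt \<ge> 0" "\<And>N m. N \<ge> 1 \<Longrightarrow> m \<le> N \<Longrightarrow> \<exists>a\<in>sums_of t A. a \<le> m \<and> real (m - a) \<le> Kt * real N powr (\<rho> ^ t)"
    using greedy_iterate[OF A0 \<rho>(1) _ K greedy, of t] \<rho>(2) by auto
  define L2 where "L2 = L1 + nat \<lceil>2 * Kt\<rceil> + 1"
  obtain Z0 where Z0: "\<And>Z. Z \<ge> Z0 \<Longrightarrow> \<exists>E e0. E \<subseteq> sums_of s A \<and> E \<subseteq> {e0..e0 + L1 * Z ^ k} \<and> \<delta> * real Z ^ k \<le> real (card E)
       \<and> real (e0 + L1 * Z ^ k) \<le> K2 * real Z ^ M"
    using loc by (auto simp: eventually_sequentially)
  define Z1 where "Z1 = max (max Z0 1) (max (12 * L2) (nat \<lceil>4 * K2\<rceil>))"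
  define \<delta>' where "\<delta>' = \<delta> / (12 * real L2)"
  have main: "\<delta>' * real N \<le> real (card (sums_of (t + s) A \<inter> {0..N}))" if N: "N \<ge> Z1 ^ M'" for N
  proof -
    define Z where "Z = nat \<lfloor>real N powr (1 / real M')\<rfloor>"
    have Z1: "Z1 \<ge> 1" unfolding Z1_def by auto
    have N1: "N \<ge> 1" using N Z1 by (metis le_trans one_le_power)
    have M'0: "M' > 0" unfolding M'_def by simp
    have Np: "(real N powr (1 / real M')) ^ M' = real N" using N1 M'0 by (simp add: powr_power)
    have ZZ: "real Z \<le> real N powr (1 / real M')" "real N powr (1 / real M') < real Z + 1"
      unfolding Z_def by (simp_all add: of_nat_nat)
    have "real Z1 \<le> real N powr (1 / real M')"
    proof -
      have "real Z1 ^ M' \<le> (real N powr (1 / real M')) ^ M'" unfolding Np using N by (metis of_nat_le_iff of_nat_power)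
      then show ?thesis using M'0 by (subst (asm) power_mono_iff) auto
    qed
    then have ZZ1: "Z \<ge> Z1" unfolding Z_def by (simp add: le_nat_floor)
    then have Z: "Z \<ge> Z0" "Z \<ge> 1" "Z \<ge> 12 * L2" "real Z \<ge> 4 * K2" unfolding Z1_def by (auto simp: nat_ceiling_le_eq)
    have ZN: "real Z ^ M' \<le> real N" using power_mono[OF ZZ(1), of M'] Np by simp
    have NZ: "real N powr (1 / real M') \<le> 2 * real Z" using ZZ(2) Z by linarith
    have rem: "Kt * real N powr (\<rho> ^ t) \<le> real (L2 * Z ^ k)"
    proof -
      have "real N powr (\<rho> ^ t) \<le> real N powr (1 / real M')" using t N1 by (intro powr_mono) auto
      then have "Kt * real N powr (\<rho> ^ t) \<le> Kt * (2 * real Z)" using NZ Kt by (intro mult_left_mono) auto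
      also have "\<dots> = (2 * Kt) * real Z" by simp
      also have "\<dots> \<le> real L2 * real Z ^ k"
      proof (rule mult_mono)
        show "2 * Kt \<le> real L2" unfolding L2_def by linarith
        have "real Z ^ 1 \<le> real Z ^ k" using Z k by (intro power_increasing) auto
        then show "real Z \<le> real Z ^ k" by simp
      qed auto
      finally show ?thesis by simp
    qed
    define L where "L = L2 * Z ^ k"
    have L1': "L \<ge> 1" unfolding L_def L2_def using Z by (simp add: Suc_le_eq)
    obtain E e0 where E: "E \<subseteq> sums_of s A" "E \<subseteq> {e0..e0 + L1 * Z ^ k}" "\<delta> * real Z ^ k \<le> real (card E)"
       "real (e0 + L1 * Z ^ k) \<le> K2 * real Z ^ M" using Z0[OF Z(1)] by blast
    have "L1 * Z ^ k \<le> L" unfolding L_def L2_def by (intro mult_le_mono1) simp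
    then have EL: "E \<subseteq> {e0..e0 + L}" using E(2) by fastforce
    have eN: "real (e0 + L1 * Z ^ k) \<le> real N / 4"
    proof -
      have "4 * (K2 * real Z ^ M) = (4 * K2) * real Z ^ M" by simp
      also have "\<dots> \<le> real Z * real Z ^ M" using Z by (intro mult_right_mono) auto
      also have "\<dots> = real Z ^ Suc M" by simp
      also have "\<dots> \<le> real Z ^ M'" using Z unfolding M'_def by (intro power_increasing) auto
      finally show ?thesis using E(4) ZN by linarith
    qed
    have LN: "12 * L \<le> N"
    proof -
      have "real (12 * L) = real (12 * L2) * real Z ^ k" unfolding L_def by simp
      also have "\<dots> \<le> real Z * real Z ^ k" using Z(3) by (intro mult_right_mono) (simp_all only: of_nat_le_iff zero_le_power of_nat_0_le_iff)
      also have "\<dots> = real Z ^ Suc k" by simp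
      also have "\<dots> \<le> real Z ^ M'" using Z unfolding M'_def by (intro power_increasing) auto
      also have "\<dots> \<le> real N" by (rule ZN)
      finally show ?thesis by (simp only: of_nat_le_iff)
    qed
    \<comment> \<open>The targets \<open>3 * L * (i + 1)\<close> then stay below
      \<open>N / 2\<close>; as elements of \<open>E\<close> are at most \<open>N / 4\<close>, all
      translates remain below \<open>N\<close>.\<close>
    define n where "n = N div (6 * L)"
    have n6: "6 * L * n \<le> N" unfolding n_def by (rule times_div_less_eq_dividend)
    have target: "\<exists>a\<in>sums_of t A. a \<le> 3 * L * (i + 1) \<and> 3 * L * (i + 1) \<le> a + L" if i: "i < n" for i
    proof -
      have "3 * L * (i + 1) \<le> 3 * L * n" using i by (intro mult_le_mono2) auto
      then have "3 * L * (i + 1) \<le> N" using n6 by linarith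
      from Kt(2)[OF N1 this] obtain a where a: "a \<in> sums_of t A" "a \<le> 3 * L * (i + 1)"
        "real (3 * L * (i + 1) - a) \<le> Kt * real N powr (\<rho> ^ t)" by blast
      have "real (3 * L * (i + 1) - a) \<le> real L" using a(3) rem unfolding L_def by linarith
      then have "3 * L * (i + 1) - a \<le> L" by (simp only: of_nat_le_iff)
      then show ?thesis using a by (intro bexI[of _ a]) auto
    qed
    then obtain a where a: "\<And>i. i < n \<Longrightarrow> a i \<in> sums_of t A \<and> a i \<le> 3 * L * (i + 1) \<and> 3 * L * (i + 1) \<le> a i + L"
      by metis
    have sub: "(\<lambda>(i, x). a i + x) ` ({..<n} \<times> E) \<subseteq> sums_of (t + s) A \<inter> {0..N}"
    proof (rule image_subsetI)
      fix z assume "z \<in> {..<n} \<times> E"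
      then obtain i x where z: "z = (i, x)" and ix: "i \<in> {..<n}" "x \<in> E" by blast
      have "a i + x \<in> sums_of (t + s) A" using a ix E(1) by (intro sums_of_addI) auto
      moreover have "a i + x \<le> N"
      proof -
        have "3 * L * (i + 1) \<le> 3 * L * n" using ix by (intro mult_le_mono2) auto
        then have "2 * a i \<le> N" using n6 a[of i] ix by auto
        moreover have "4 * x \<le> N"
        proof -
          have "x \<le> e0 + L1 * Z ^ k" using ix E(2) by auto
          then have "real x \<le> real (e0 + L1 * Z ^ k)" by (simp only: of_nat_le_iff)
          then have "4 * real x \<le> real N" using eN by linarith
          then show ?thesis by linarith
        qed
        ultimately show ?thesis by linarith
      qed
      ultimately show "(case z of (i, x) \<Rightarrow> a i + x) \<in> sums_of (t + s) A \<inter> {0..N}" unfolding z by auto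
    qed
    have "n * card E = card ((\<lambda>(i, x). a i + x) ` ({..<n} \<times> E))"
      using card_translates[OF L1' EL, of n a] a by auto
    also have "\<dots> \<le> card (sums_of (t + s) A \<inter> {0..N})" by (intro card_mono sub) auto
    finally have c: "real n * real (card E) \<le> real (card (sums_of (t + s) A \<inter> {0..N}))" by (simp only: of_nat_mult[symmetric] of_nat_le_iff)
    have "real N \<le> 12 * real L * real n"
    proof -
      have "n \<ge> 1" unfolding n_def using LN L1' by (simp add: div_greater_zero_iff Suc_le_eq)
      have "N < 6 * L + 6 * L * (N div (6 * L))" using L1' by (intro dividend_less_times_div) simp
      then have "N < 6 * L * (n + 1)" unfolding n_def by simp
      also have "\<dots> \<le> 6 * L * (n + n)" using \<open>n \<ge> 1\<close> by (intro mult_le_mono2) auto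
      also have "6 * L * (n + n) = 12 * L * n" by simp
      finally have "N \<le> 12 * L * n" by simp
      then have "real N \<le> real (12 * L * n)" by (simp only: of_nat_le_iff)
      then show ?thesis by simp
    qed
    then have "\<delta>' * real N \<le> \<delta>' * (12 * real L * real n)" using \<delta> unfolding \<delta>'_def by (intro mult_left_mono) auto
    also have "\<dots> = real n * (\<delta> * real Z ^ k)"
    proof -
      have "real L2 \<noteq> 0" by (simp add: L2_def)
      then show ?thesis unfolding \<delta>'_def L_def by (simp add: field_simps)
    qed
    also have "\<dots> \<le> real n * real (card E)" using E(3) by (intro mult_left_mono) auto
    finally show ?thesis using c by linarith
  qed
  have "\<delta>' > 0" unfolding \<delta>'_def using \<delta> by (simp add: L2_def)
  then show ?thesis using that[of \<delta>' "Z1 ^ M'" "t + s"] main by blast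
qed

text \<open>On tuples with equal power sums below \<open>k\<close> the uncontrolled lower
  coefficients cancel. Differences of sums of values are then \<open>c k\<close> times differences
  of top power sums, up to \<open>O(1)\<close>, so distinct top power sums give integers of bounded
  multiplicity in a window of length \<open>O(Z ^ k)\<close>.\<close>

lemma local_sets_of_local_poly:
  fixes f :: "real \<Rightarrow> real" and n0 :: nat
  defines "A \<equiv> {nat (\<lfloor>f (real n)\<rfloor> - \<lfloor>f (real n0)\<rfloor>) | n. n \<ge> n0}"
  assumes mono: "\<And>n. n \<ge> n0 \<Longrightarrow> f (real n0) \<le> f (real n)" and f0: "f (real n0) \<ge> 0"
    and loc: "local_poly f k \<tau> m 1" and k: "k \<ge> 1" and m: "m \<ge> 1" and \<tau>: "\<tau> \<noteq> 0"
    and growth: "\<And>x. x \<ge> 1 \<Longrightarrow> \<bar>f x\<bar> \<le> K * (\<bar>x\<bar> + 1) ^ D" and K: "K > 0"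
  obtains s :: nat and \<delta> :: real and L1 K2 M where "\<delta> > 0"
    "\<forall>\<^sub>F Z in sequentially. \<exists>E e0. E \<subseteq> sums_of s A \<and> E \<subseteq> {e0..e0 + L1 * Z ^ k} \<and> \<delta> * real Z ^ k \<le> real (card E)
       \<and> real (e0 + L1 * Z ^ k) \<le> K2 * real Z ^ M"
proof -
  obtain s :: nat and \<delta>0 :: real where s: "s \<ge> 1" and \<delta>0: "\<delta>0 > 0" and fib:
    "\<And>H. H \<ge> 1 \<Longrightarrow> \<exists>B. B \<subseteq> PiE {..<s} (\<lambda>_. {1..H}) \<and> \<delta>0 * real H ^ k \<le> real (card B) \<and> inj_on (\<lambda>y. \<Sum>i<s. y i ^ k) B
       \<and> (\<forall>y\<in>B. \<forall>y'\<in>B. \<forall>j\<in>{1..<k}. (\<Sum>i<s. y i ^ j) = (\<Sum>i<s. y' i ^ j))"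
    using power_sum_fibre[OF k] by metis
  define \<epsilon> where "\<epsilon> = min 1 (\<bar>\<tau>\<bar> / 2)"
  have \<epsilon>: "\<epsilon> > 0" "\<epsilon> \<le> 1" "\<epsilon> \<le> \<bar>\<tau>\<bar> / 2" using \<tau> unfolding \<epsilon>_def by auto
  \<comment> \<open>Tuples with the same integer sum have top power sums that differ by at most
    \<open>3 * s\<close> divided by \<open>\<bar>\<tau>\<bar> / 2\<close>, so the residue modulo
    \<open>W + 1\<close> tells them apart.\<close>
  define W where "W = nat \<lfloor>6 * real s / \<bar>\<tau>\<bar>\<rfloor>"
  define L1 where "L1 = nat \<lceil>2 * \<bar>\<tau>\<bar>\<rceil> * s + 3 * s"
  define \<delta> where "\<delta> = \<delta>0 / real (W + 1)"
  define M where "M = Suc m * D + k"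
  define K2 where "K2 = real s * (K * 3 ^ D) + real L1"
  define c0 where "c0 = \<lfloor>f (real n0)\<rfloor>"
  have ev: "\<forall>\<^sub>F X in sequentially. \<exists>q c. 1 \<le> q \<and> 1 dvd q \<and> q \<le> X \<and> \<bar>c k - \<tau>\<bar> \<le> \<epsilon> \<and>
     (\<forall>y. y ^ m \<le> X \<longrightarrow> \<bar>f (real X + real q * real y) - (\<Sum>j\<le>k. c j * real y ^ j)\<bar> \<le> \<epsilon>)"
    using loc \<epsilon> unfolding local_poly_def by blast
  have fl: "filterlim (\<lambda>Z::nat. Z ^ m) sequentially sequentially"
    using m by (intro filterlim_subseq) (auto simp: strict_mono_def intro: power_strict_mono)
  have "\<forall>\<^sub>F Z in sequentially. (\<exists>q c. 1 \<le> q \<and> 1 dvd q \<and> q \<le> Z ^ m \<and> \<bar>c k - \<tau>\<bar> \<le> \<epsilon> \<and>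
     (\<forall>y. y ^ m \<le> Z ^ m \<longrightarrow> \<bar>f (real (Z ^ m) + real q * real y) - (\<Sum>j\<le>k. c j * real y ^ j)\<bar> \<le> \<epsilon>))"
    using eventually_compose_filterlim[OF ev fl] .
  with eventually_ge_at_top[of "max 1 n0"]
  have "\<forall>\<^sub>F Z in sequentially. \<exists>E e0. E \<subseteq> sums_of s A \<and> E \<subseteq> {e0..e0 + L1 * Z ^ k} \<and> \<delta> * real Z ^ k \<le> real (card E)
       \<and> real (e0 + L1 * Z ^ k) \<le> K2 * real Z ^ M"
  proof eventually_elim
    case (elim Z)
    then obtain q c where q: "1 \<le> q" "q \<le> Z ^ m" and ck: "\<bar>c k - \<tau>\<bar> \<le> \<epsilon>"
      and app: "\<And>y. y ^ m \<le> Z ^ m \<Longrightarrow> \<bar>f (real (Z ^ m) + real q * real y) - (\<Sum>j\<le>k. c j * real y ^ j)\<bar> \<le> \<epsilon>"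
      by blast
    have Z: "Z \<ge> 1" "Z \<ge> n0" using elim by auto
    obtain B where B: "B \<subseteq> PiE {..<s} (\<lambda>_. {1..Z})" "\<delta>0 * real Z ^ k \<le> real (card B)" "inj_on (\<lambda>y. \<Sum>i<s. y i ^ k) B"
       "\<forall>y\<in>B. \<forall>y'\<in>B. \<forall>j\<in>{1..<k}. (\<Sum>i<s. y i ^ j) = (\<Sum>i<s. y' i ^ j)"
      using fib[OF Z(1)] by blast
    \<comment> \<open>With this start the condition \<open>y ^ m \<le> X\<close> admits precisely
      the range \<open>y \<le> Z\<close> of the tuples.\<close>
    define X where "X = Z ^ m"
    have XZ: "X \<ge> Z" unfolding X_def using Z m by (metis power_increasing power_one_right)
    define nn where "nn = (\<lambda>y::nat. X + q * y)"
    define V where "V = (\<lambda>y::nat \<Rightarrow> nat. \<Sum>i<s. y i ^ k)"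
    define F where "F = (\<lambda>y::nat \<Rightarrow> nat. \<Sum>i<s. f (real (nn (y i))))"
    define e where "e = (\<lambda>y::nat \<Rightarrow> nat. \<Sum>i<s. nat (\<lfloor>f (real (nn (y i)))\<rfloor> - c0))"
    have yi: "1 \<le> y i \<and> y i \<le> Z" if "y \<in> B" "i < s" for y i
      using PiE_mem[OF subsetD[OF B(1) that(1)], of i] that(2) by simp
    have nn0: "nn y \<ge> n0" for y unfolding nn_def using XZ Z by linarith
    have fl0: "\<lfloor>f (real (nn y))\<rfloor> \<ge> c0" for y unfolding c0_def using mono[OF nn0] by (rule floor_mono)
    have c00: "c0 \<ge> 0" unfolding c0_def using f0 by simp
    have eS: "e y \<in> sums_of s A" for y
    proof -
      have "e y = sum_list (map (\<lambda>i. nat (\<lfloor>f (real (nn (y i)))\<rfloor> - c0)) [0..<s])"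
        unfolding e_def by (simp add: sum_list_distinct_conv_sum_set atLeast0LessThan)
      moreover have "set (map (\<lambda>i. nat (\<lfloor>f (real (nn (y i)))\<rfloor> - c0)) [0..<s]) \<subseteq> A"
        unfolding A_def c0_def using nn0 by auto
      ultimately show ?thesis unfolding sums_of_def by (intro CollectI exI[of _ "map (\<lambda>i. nat (\<lfloor>f (real (nn (y i)))\<rfloor> - c0)) [0..<s]"]) auto
    qed
    have eF: "F y - real s * of_int c0 - real s \<le> real (e y) \<and> real (e y) \<le> F y - real s * of_int c0" for y
    proof -
      have 1: "real (nat (\<lfloor>f (real (nn (y i)))\<rfloor> - c0)) = of_int \<lfloor>f (real (nn (y i)))\<rfloor> - of_int c0" for i
        using fl0[of "y i"] by simp
      have e: "real (e y) = (\<Sum>i<s. of_int \<lfloor>f (real (nn (y i)))\<rfloor> - of_int c0)"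
        unfolding e_def of_nat_sum 1 ..
      have "(\<Sum>i<s. f (real (nn (y i))) - 1 - of_int c0) \<le> real (e y)" unfolding e by (intro sum_mono) linarith
      moreover have "real (e y) \<le> (\<Sum>i<s. f (real (nn (y i))) - of_int c0)" unfolding e by (intro sum_mono) linarith
      ultimately show ?thesis unfolding F_def by (simp add: sum_subtractf)
    qed
    \<comment> \<open>Each \<open>F\<close> is within \<open>s\<close> of its polynomial model, and
      the integer parts cost at most another \<open>s\<close> in the difference: in total
      \<open>3 * s\<close>.\<close>
    have diff: "\<bar>(real (e y) - real (e y')) - c k * (real (V y) - real (V y'))\<bar> \<le> 3 * real s" if y: "y \<in> B" "y' \<in> B" for y y'
    proof -
      define P where "P = (\<lambda>y::nat \<Rightarrow> nat. \<Sum>i<s. \<Sum>j\<le>k. c j * real (y i) ^ j)"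
      have FP: "\<bar>F y - P y\<bar> \<le> real s" if "y \<in> B" for y
      proof -
        have "\<bar>F y - P y\<bar> \<le> (\<Sum>i<s. \<bar>f (real (nn (y i))) - (\<Sum>j\<le>k. c j * real (y i) ^ j)\<bar>)"
          unfolding F_def P_def sum_subtractf[symmetric] by (rule sum_abs)
        also have "\<dots> \<le> (\<Sum>i<s. 1)"
        proof (rule sum_mono)
          fix i assume "i \<in> {..<s}"
          then have "y i ^ m \<le> Z ^ m" using yi[OF that] by (intro power_mono) auto
          from app[OF this] show "\<bar>f (real (nn (y i))) - (\<Sum>j\<le>k. c j * real (y i) ^ j)\<bar> \<le> 1"
            using \<epsilon>(2) unfolding nn_def X_def by simp
        qed
        finally show ?thesis by simp
      qed
      have PV: "P y - P y' = c k * (real (V y) - real (V y'))"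
      proof -
        have sw: "P y = (\<Sum>j\<le>k. c j * real (\<Sum>i<s. y i ^ j))" for y
          unfolding P_def by (subst sum.swap) (simp add: sum_distrib_left)
        have "P y - P y' = (\<Sum>j\<le>k. c j * (real (\<Sum>i<s. y i ^ j) - real (\<Sum>i<s. y' i ^ j)))"
          unfolding sw by (simp add: sum_subtractf right_diff_distrib)
        also have "\<dots> = (\<Sum>j\<in>{k}. c j * (real (\<Sum>i<s. y i ^ j) - real (\<Sum>i<s. y' i ^ j)))"
        proof (rule sum.mono_neutral_right)
          show "\<forall>j\<in>{..k} - {k}. c j * (real (\<Sum>i<s. y i ^ j) - real (\<Sum>i<s. y' i ^ j)) = 0"
          proof
            fix j assume j: "j \<in> {..k} - {k}"
            have "(\<Sum>i<s. y i ^ j) = (\<Sum>i<s. y' i ^ j)"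
            proof (cases "j = 0")
              case False
              then have "j \<in> {1..<k}" using j by auto
              then show ?thesis using B(4) y by blast
            qed simp
            then show "c j * (real (\<Sum>i<s. y i ^ j) - real (\<Sum>i<s. y' i ^ j)) = 0" by simp
          qed
        qed auto
        finally show ?thesis unfolding V_def by simp
      qed
      show ?thesis using FP[OF y(1)] FP[OF y(2)] PV eF[of y] eF[of y'] by linarith
    qed
    have finB: "finite B" using B(1) finite_subset by (metis finite_PiE finite_atLeastAtMost finite_lessThan)
    have "0 < \<delta>0 * real Z ^ k" using \<delta>0 Z by simp
    then have neB: "B \<noteq> {}" using B(2) by (intro notI) simp
    define E where "E = e ` B"
    define e0 where "e0 = Min E"
    have finE: "finite E" and neE: "E \<noteq> {}" unfolding E_def using finB neB by auto
    have Vb: "V y \<le> s * Z ^ k" if "y \<in> B" for y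
    proof -
      have "V y \<le> (\<Sum>i<s. Z ^ k)" unfolding V_def using yi[OF that] by (intro sum_mono power_mono) auto
      then show ?thesis by simp
    qed
    have range: "real (e y) \<le> real (e y') + real (L1 * Z ^ k)" if y: "y \<in> B" "y' \<in> B" for y y'
    proof -
      have "c k * (real (V y) - real (V y')) \<le> \<bar>c k\<bar> * \<bar>real (V y) - real (V y')\<bar>"
        by (metis abs_ge_self abs_mult)
      also have "\<dots> \<le> (2 * \<bar>\<tau>\<bar>) * real (s * Z ^ k)"
      proof (rule mult_mono)
        show "\<bar>c k\<bar> \<le> 2 * \<bar>\<tau>\<bar>" using ck \<epsilon> by linarith
        have "real (V y) \<le> real (s * Z ^ k)" "real (V y') \<le> real (s * Z ^ k)" using Vb y by (simp_all only: of_nat_le_iff)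
        then show "\<bar>real (V y) - real (V y')\<bar> \<le> real (s * Z ^ k)" by linarith
      qed auto
      also have "\<dots> \<le> real (nat \<lceil>2 * \<bar>\<tau>\<bar>\<rceil>) * real (s * Z ^ k)" by (intro mult_right_mono) (auto simp: of_nat_ceiling)
      also have "\<dots> = real (nat \<lceil>2 * \<bar>\<tau>\<bar>\<rceil> * s * Z ^ k)" by simp
      finally have 1: "c k * (real (V y) - real (V y')) \<le> real (nat \<lceil>2 * \<bar>\<tau>\<bar>\<rceil> * s * Z ^ k)" .
      have "3 * s * 1 \<le> 3 * s * Z ^ k" using Z by (intro mult_le_mono2) (simp add: Suc_le_eq)
      then have "3 * real s \<le> real (3 * s * Z ^ k)" by (metis mult_1_right of_nat_le_iff of_nat_mult of_nat_numeral)
      moreover have "real (L1 * Z ^ k) = real (nat \<lceil>2 * \<bar>\<tau>\<bar>\<rceil> * s * Z ^ k) + real (3 * s * Z ^ k)"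
        unfolding L1_def by (simp add: algebra_simps)
      ultimately show ?thesis using 1 diff[OF y] by linarith
    qed
    have e0E: "e0 \<in> E" unfolding e0_def using finE neE by simp
    have "E \<subseteq> {e0..e0 + L1 * Z ^ k}"
    proof
      fix x assume x: "x \<in> E"
      then obtain y y' where y: "y \<in> B" "x = e y" "y' \<in> B" "e0 = e y'" using e0E unfolding E_def by auto
      have "e0 \<le> x" unfolding e0_def using x finE by simp
      moreover have "real x \<le> real (e0 + L1 * Z ^ k)" using range[OF y(1,3)] y by simp
      ultimately show "x \<in> {e0..e0 + L1 * Z ^ k}" by (simp only: of_nat_le_iff) simp
    qed
    moreover have "\<delta> * real Z ^ k \<le> real (card E)"
    proof -
      have inj: "inj_on (\<lambda>y. (e y, V y mod (W + 1))) B"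
      proof (rule inj_onI)
        fix y y' assume y: "y \<in> B" "y' \<in> B" "(e y, V y mod (W + 1)) = (e y', V y' mod (W + 1))"
        have "\<bar>c k\<bar> * \<bar>real (V y) - real (V y')\<bar> \<le> 3 * real s"
          using diff[OF y(1,2)] y(3) by (simp add: abs_mult[symmetric])
        moreover have "\<bar>\<tau>\<bar> / 2 \<le> \<bar>c k\<bar>" using ck \<epsilon> by linarith
        ultimately have "\<bar>\<tau>\<bar> / 2 * \<bar>real (V y) - real (V y')\<bar> \<le> 3 * real s"
          by (meson abs_ge_zero mult_right_mono order_trans)
        then have "\<bar>real (V y) - real (V y')\<bar> \<le> 6 * real s / \<bar>\<tau>\<bar>" using \<tau> by (simp add: field_simps)
        then have le: "\<bar>int (V y) - int (V y')\<bar> \<le> int W" unfolding W_def by (simp add: le_floor_iff)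
        have "int (V y) mod int (W + 1) = int (V y') mod int (W + 1)" using y(3) by (metis Pair_inject of_nat_mod)
        then have "int (W + 1) dvd int (V y) - int (V y')" by (simp add: mod_eq_dvd_iff)
        then have "int (V y) - int (V y') = 0" using le dvd_imp_le_int[of "int (V y) - int (V y')" "int (W + 1)"] by force
        then have "V y = V y'" by simp
        then show "y = y'" using B(3) y unfolding V_def inj_on_def by blast
      qed
      have "card B \<le> card (E \<times> {..<W + 1})"
        by (rule card_inj_on_le[OF inj]) (use finE in \<open>auto simp: E_def\<close>)
      then have "real (card B) \<le> real (card E) * real (W + 1)" by (simp only: card_cartesian_product card_lessThan of_nat_le_iff flip: of_nat_mult)
      then have "\<delta>0 * real Z ^ k \<le> real (card E) * real (W + 1)" using B(2) by linarith
      then show ?thesis unfolding \<delta>_def by (simp add: field_simps)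
    qed
    moreover have "real (e0 + L1 * Z ^ k) \<le> K2 * real Z ^ M"
    proof -
      obtain y where y: "y \<in> B" "e0 = e y" using e0E unfolding E_def by auto
      have "F y \<le> (\<Sum>i<s. (K * 3 ^ D) * real Z ^ M)" unfolding F_def
      proof (rule sum_mono)
        fix i assume i: "i \<in> {..<s}"
        have nb: "nn (y i) + 1 \<le> 3 * Z ^ Suc m"
        proof -
          have "q * y i \<le> Z ^ m * Z" using q yi[OF y(1), of i] i by (intro mult_le_mono) auto
          moreover have "Z ^ m * 1 \<le> Z ^ m * Z" using Z by (intro mult_le_mono2) auto
          moreover have "1 \<le> Z ^ m * Z" using Z by (simp add: Suc_le_eq)
          moreover have "3 * Z ^ Suc m = Z ^ m * Z + Z ^ m * Z + Z ^ m * Z" by simp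
          ultimately show ?thesis unfolding nn_def X_def by linarith
        qed
        have "nn (y i) \<ge> 1" unfolding nn_def using XZ Z by linarith
        then have "real (nn (y i)) \<ge> 1" by simp
        then have "f (real (nn (y i))) \<le> K * (real (nn (y i)) + 1) ^ D" using growth[of "real (nn (y i))"] by simp
        also have "\<dots> \<le> K * (real (3 * Z ^ Suc m)) ^ D"
        proof -
          have "real (nn (y i) + 1) \<le> real (3 * Z ^ Suc m)" using nb of_nat_le_iff by blast
          then have "real (nn (y i)) + 1 \<le> real (3 * Z ^ Suc m)" by (simp only: of_nat_add of_nat_1)
          then show ?thesis using K by (intro mult_left_mono power_mono) auto
        qed
        also have "\<dots> = (K * 3 ^ D) * real Z ^ (Suc m * D)" by (simp add: power_mult_distrib flip: power_mult power_Suc)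
        also have "\<dots> \<le> (K * 3 ^ D) * real Z ^ M" using K Z by (intro mult_left_mono power_increasing) (auto simp: M_def)
        finally show "f (real (nn (y i))) \<le> (K * 3 ^ D) * real Z ^ M" .
      qed
      then have "F y \<le> real s * (K * 3 ^ D) * real Z ^ M" by (simp add: mult.assoc)
      moreover have "real s * of_int c0 \<ge> 0" using c00 by simp
      ultimately have "real e0 \<le> real s * (K * 3 ^ D) * real Z ^ M" using eF[of y] y(2) by linarith
      moreover have "real (L1 * Z ^ k) \<le> real L1 * real Z ^ M"
      proof -
        have "real Z ^ k \<le> real Z ^ M" using Z by (intro power_increasing) (auto simp: M_def)
        then show ?thesis by (simp add: mult_left_mono)
      qed
      ultimately show ?thesis unfolding K2_def by (simp add: distrib_right)
    qed
    moreover have "E \<subseteq> sums_of s A" unfolding E_def using eS by auto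
    ultimately show ?case by blast
  qed
  moreover have "\<delta> > 0" unfolding \<delta>_def using \<delta>0 by simp
  ultimately show ?thesis using that by blast
qed

text \<open>Take the last \<open>n\<close> with \<open>f n\<close> below the target. Since
  \<open>f (Suc n)\<close> reaches it, the gap hypothesis bounds the deficit of
  \<open>f n powr (1 / p)\<close> by 1, and Bernoulli's inequality turns this into a deficit of
  \<open>f n\<close> of order \<open>M powr (1 - 1 / p)\<close>.\<close>

lemma greedy_step:
  fixes f :: "real \<Rightarrow> real" and n0 p :: nat
  defines "A \<equiv> {nat (\<lfloor>f (real n)\<rfloor> - \<lfloor>f (real n0)\<rfloor>) | n. n \<ge> n0}"
  assumes f1: "\<And>n. n \<ge> n0 \<Longrightarrow> f (real n) \<ge> 1" and p: "p \<ge> 1"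
    and gap: "\<And>n. n \<ge> n0 \<Longrightarrow> f (real (Suc n)) powr (1 / real p) \<le> f (real n) powr (1 / real p) + 1"
    and lim: "filterlim f at_top at_top" and mono: "\<And>n. n \<ge> n0 \<Longrightarrow> f (real n0) \<le> f (real n)"
  shows "\<exists>K\<ge>0. \<forall>m. \<exists>a\<in>A. a \<le> m \<and> real (m - a) \<le> K * (real m + 1) powr (1 - 1 / real p)"
proof -
  define c0 where "c0 = \<lfloor>f (real n0)\<rfloor>"
  have c0: "c0 \<ge> 1" unfolding c0_def using f1[of n0] by simp
  define r where "r = 1 / real p"
  have r: "0 < r" "r \<le> 1" unfolding r_def using p by auto
  have "\<exists>a\<in>A. a \<le> m \<and> real (m - a) \<le> (real p * (of_int c0 + 1)) * (real m + 1) powr (1 - r)" for m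
  proof -
    \<comment> \<open>The shift by \<open>c0 + 1\<close> makes \<open>f n < M\<close> equivalent to
      the integer part of \<open>f n\<close>, diminished by \<open>c0\<close>, being at most
      \<open>m\<close>.\<close>
    define M :: real where "M = real m + of_int c0 + 1"
    have M1: "M \<ge> 1" unfolding M_def using c0 by simp
    have "\<forall>\<^sub>F x in at_top. f x \<ge> M" using lim unfolding filterlim_at_top by blast
    then have "\<forall>\<^sub>F n in sequentially. f (real n) \<ge> M" using filterlim_real_sequentially by (rule eventually_compose_filterlim)
    then obtain b where b: "\<And>n. n \<ge> b \<Longrightarrow> f (real n) \<ge> M" by (auto simp: eventually_sequentially)
    define S where "S = {n. n \<ge> n0 \<and> f (real n) < M}"
    have "S \<subseteq> {..<b}" unfolding S_def using b by (auto simp: not_le[symmetric])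
    then have finS: "finite S" using finite_subset by blast
    have n0S: "n0 \<in> S" unfolding S_def M_def c0_def by simp linarith
    define n where "n = Max S"
    have nS: "n \<in> S" unfolding n_def using finS n0S by (intro Max_in) auto
    have "Suc n \<notin> S" using Max_ge[OF finS, of "Suc n"] unfolding n_def by auto
    then have fS: "f (real (Suc n)) \<ge> M" using nS unfolding S_def by auto
    have n: "n \<ge> n0" "f (real n) < M" using nS unfolding S_def by auto
    define a where "a = nat (\<lfloor>f (real n)\<rfloor> - c0)"
    have aA: "a \<in> A" unfolding a_def A_def c0_def using n by auto
    have fl: "\<lfloor>f (real n)\<rfloor> \<ge> c0" unfolding c0_def using mono[OF n(1)] by (rule floor_mono)
    have "\<lfloor>f (real n)\<rfloor> < int m + c0 + 1" using n(2) unfolding M_def by linarith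
    then have am: "a \<le> m" unfolding a_def by linarith
    have "real (m - a) = real m - (of_int \<lfloor>f (real n)\<rfloor> - of_int c0)" using am fl unfolding a_def by (simp add: of_nat_diff)
    also have "\<dots> \<le> M - f (real n)" unfolding M_def by linarith
    also have "\<dots> \<le> real p * M powr (1 - r)"
    proof -
      have "M powr r \<le> f (real (Suc n)) powr r" using fS M1 r by (intro powr_mono2) auto
      also have "\<dots> \<le> f (real n) powr r + 1" using gap[OF n(1)] unfolding r_def .
      finally have w: "M powr r - 1 \<le> f (real n) powr r" by simp
      have Mr1: "M powr r \<ge> 1" using M1 r by (intro ge_one_powr_ge_zero) auto
      have Mp: "(M powr r) ^ p = M"
      proof -
        have "(M powr r) ^ p = M powr (real p * r)" by (rule powr_power) (use p M1 in auto)
        then show ?thesis using p M1 unfolding r_def by simp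
      qed
      have fp: "(f (real n) powr r) ^ p = f (real n)"
      proof -
        have "(f (real n) powr r) ^ p = f (real n) powr (real p * r)" by (rule powr_power) (use p f1[OF n(1)] in auto)
        then show ?thesis using p f1[OF n(1)] unfolding r_def by simp
      qed
      have "1 + real p * (- (1 / M powr r)) \<le> (1 + (- (1 / M powr r))) ^ p"
        using Mr1 by (intro Bernoulli_inequality) (simp add: divide_le_eq_1)
      then have "M * (1 - real p / M powr r) \<le> M * (1 - 1 / M powr r) ^ p" using M1 by (intro mult_left_mono) auto
      also have "\<dots> = (M powr r * (1 - 1 / M powr r)) ^ p" unfolding power_mult_distrib Mp ..
      also have "M powr r * (1 - 1 / M powr r) = M powr r - 1" using Mr1 M1 by (simp add: field_simps)
      also have "(M powr r - 1) ^ p \<le> (f (real n) powr r) ^ p" using w Mr1 by (intro power_mono) auto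
      also have "\<dots> = f (real n)" by (rule fp)
      finally have "M - real p * (M / M powr r) \<le> f (real n)" by (simp add: algebra_simps)
      moreover have "M / M powr r = M powr (1 - r)" using M1 by (simp add: powr_diff)
      ultimately show ?thesis by simp
    qed
    also have "\<dots> \<le> real p * ((of_int c0 + 1) * (real m + 1) powr (1 - r))"
    proof (rule mult_left_mono)
      have "M \<le> (of_int c0 + 1) * (real m + 1)" unfolding M_def using c0 by (simp add: algebra_simps)
      then have "M powr (1 - r) \<le> ((of_int c0 + 1) * (real m + 1)) powr (1 - r)" using M1 r by (intro powr_mono2) auto
      also have "\<dots> = (of_int c0 + 1) powr (1 - r) * (real m + 1) powr (1 - r)" by (rule powr_mult)
      also have "\<dots> \<le> (of_int c0 + 1) powr 1 * (real m + 1) powr (1 - r)" using c0 r by (intro mult_right_mono powr_mono) auto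
      finally show "M powr (1 - r) \<le> (of_int c0 + 1) * (real m + 1) powr (1 - r)" using c0 by simp
    qed simp
    finally show ?thesis using aA am by (intro bexI[of _ a]) (auto simp: mult.assoc)
  qed
  then show ?thesis using c0 unfolding r_def by (intro exI[of _ "real p * (of_int c0 + 1)"]) auto
qed

section \<open>Common divisors\<close>

text \<open>The two properties support each other in an induction along Horner's scheme: shifting
  \<open>x * P x\<close> by \<open>h\<close> produces the term \<open>h * P (x + h)\<close>, whose
  denominator must be cleared by \<open>h\<close>.\<close>

lemma rat_poly_periodic:
  fixes p :: "rat poly" and d :: nat
  shows "\<exists>Q\<ge>1. (\<forall>x::int. \<exists>n::int. real Q * poly (map_poly of_rat p) (of_int x) = of_int n) \<and>
    (\<forall>x h :: int. int (Q * d) dvd h \<longrightarrow> (\<exists>n::int. poly (map_poly of_rat p) (of_int (x + h)) - poly (map_poly of_rat p) (of_int x) = real d * of_int n))"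
proof (induction p)
  case 0 show ?case by (intro exI[of _ 1]) auto
next
  case (pCons a p)
  define P where "P = (poly (map_poly of_rat p) :: real \<Rightarrow> real)"
  obtain Q where Q: "Q \<ge> 1" "\<And>x::int. \<exists>n::int. real Q * P (of_int x) = of_int n"
    "\<And>x h :: int. int (Q * d) dvd h \<Longrightarrow> \<exists>n::int. P (of_int (x + h)) - P (of_int x) = real d * of_int n"
    using pCons.IH unfolding P_def by blast
  obtain u v where uv: "quotient_of a = (u, v)" by fastforce
  have v: "v > 0" using quotient_of_denom_pos[OF uv] .
  have a: "of_rat a = (of_int u / of_int v :: real)" using quotient_of_div[OF uv] by (simp add: of_rat_divide)
  have P': "poly (map_poly of_rat (pCons a p)) x = of_rat a + x * P x" for x :: real
    using pCons(1) by (auto simp: map_poly_pCons P_def)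
  define Q' where "Q' = Q * nat v"
  have 1: "Q' \<ge> 1" unfolding Q'_def using Q v by (simp add: Suc_le_eq)
  have 2: "\<exists>n::int. real Q' * poly (map_poly of_rat (pCons a p)) (of_int x) = of_int n" for x :: int
  proof -
    obtain n :: int where n: "real Q * P (of_int x) = of_int n" using Q(2) by blast
    have "real Q' * poly (map_poly of_rat (pCons a p)) (of_int x) = real Q * (of_int v * of_rat a) + of_int v * of_int x * (real Q * P (of_int x))"
      unfolding P' Q'_def using v by (simp add: algebra_simps)
    also have "\<dots> = of_int (int Q * u + v * x * n)" unfolding n a using v by simp
    finally show ?thesis by blast
  qed
  have 3: "\<exists>n::int. poly (map_poly of_rat (pCons a p)) (of_int (x + h)) - poly (map_poly of_rat (pCons a p)) (of_int x) = real d * of_int n"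
    if h: "int (Q' * d) dvd h" for x h :: int
  proof -
    have "int (Q * d) dvd h" using h unfolding Q'_def by (metis dvd_trans dvd_triv_left mult.assoc mult.commute of_nat_mult)
    then obtain n1 :: int where n1: "P (of_int (x + h)) - P (of_int x) = real d * of_int n1" using Q(3) by blast
    obtain w where w: "h = int (Q' * d) * w" using h by blast
    obtain n2 :: int where n2: "real Q * P (of_int (x + h)) = of_int n2" using Q(2) by blast
    have "poly (map_poly of_rat (pCons a p)) (of_int (x + h)) - poly (map_poly of_rat (pCons a p)) (of_int x)
       = of_int x * (P (of_int (x + h)) - P (of_int x)) + of_int h * P (of_int (x + h))"
      unfolding P' by (simp add: algebra_simps)
    also have "of_int h * P (of_int (x + h)) = real d * of_int (v * w) * (real Q * P (of_int (x + h)))"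
      unfolding w Q'_def using v by simp
    also have "of_int x * (P (of_int (x + h)) - P (of_int x)) + real d * of_int (v * w) * (real Q * P (of_int (x + h)))
       = real d * of_int (x * n1 + v * w * n2)"
      unfolding n1 n2 by (simp add: algebra_simps)
    finally show ?thesis by blast
  qed
  show ?case using 1 2 3 by blast
qed

text \<open>Only finitely many denominators occur, so the least distance to an integer is
  positive.\<close>

lemma irrational_away_from_integers:
  fixes \<tau> :: real and N d :: nat
  assumes "\<tau> \<notin> \<rat>" "d \<ge> 1"
  obtains \<kappa> where "\<kappa> > 0" "\<And>q (n::int). 1 \<le> q \<Longrightarrow> q \<le> N \<Longrightarrow> \<kappa> \<le> \<bar>real q * (\<tau> / real d) - of_int n\<bar>"
proof -
  define \<phi> where "\<phi> = (\<lambda>q. \<bar>real q * (\<tau> / real d) - of_int (round (real q * (\<tau> / real d)))\<bar>)"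
  define \<kappa> where "\<kappa> = Min (insert 1 (\<phi> ` {1..N}))"
  have pos: "\<phi> q > 0" if "q \<ge> 1" for q
  proof (rule ccontr)
    assume "\<not> \<phi> q > 0"
    then have "real q * (\<tau> / real d) = of_int (round (real q * (\<tau> / real d)))" unfolding \<phi>_def by simp
    then have "\<tau> = real d * of_int (round (real q * (\<tau> / real d))) / real q" using that assms(2) by (simp add: field_simps)
    also have "\<dots> \<in> \<rat>" by simp
    finally show False using assms(1) by blast
  qed
  have "\<kappa> > 0" unfolding \<kappa>_def using pos by (subst Min_gr_iff) auto
  moreover have "\<kappa> \<le> \<bar>real q * (\<tau> / real d) - of_int n\<bar>" if "1 \<le> q" "q \<le> N" for q and n :: int
  proof -
    have "\<kappa> \<le> \<phi> q" unfolding \<kappa>_def using that by (intro Min_le) auto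
    also have "\<dots> \<le> \<bar>real q * (\<tau> / real d) - of_int n\<bar>" unfolding \<phi>_def by (rule round_diff_minimal)
    finally show ?thesis .
  qed
  ultimately show ?thesis by (rule that)
qed

text \<open>With \<open>u\<close> the sine of the angle, \<open>0 \<le> u \<le> 1\<close> on the
  half circle and the test function equals \<open>1/2 + u - u\<^sup>2\<close>, which is at least
  1/2. Summing over \<open>y\<close>, the two exponential sums cannot both be below
  \<open>H / 4\<close>.\<close>

lemma half_circle_sum:
  fixes r :: "nat \<Rightarrow> real"
  assumes "\<And>y. y \<in> {1..H} \<Longrightarrow> \<exists>n::int. of_int n \<le> r y \<and> r y \<le> of_int n + 1/2"
  shows "\<exists>l\<in>{1, 2::nat}. real H / 4 \<le> norm (\<Sum>y\<in>{1..H}. ee (real l * r y))"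
proof (rule ccontr)
  assume "\<not> ?thesis"
  then have l1: "norm (\<Sum>y\<in>{1..H}. ee (r y)) < real H / 4" and l2: "norm (\<Sum>y\<in>{1..H}. ee (2 * r y)) < real H / 4"
    by auto
  have T: "1/2 \<le> Im (ee (r y)) + Re (ee (2 * r y)) / 2" if y: "y \<in> {1..H}" for y
  proof -
    obtain n :: int where n: "of_int n \<le> r y" "r y \<le> of_int n + 1/2" using assms[OF y] by blast
    define s where "s = r y - of_int n"
    have s: "0 \<le> s" "s \<le> 1/2" using n by (auto simp: s_def)
    have e1: "ee (r y) = ee s" by (rule ee_eq_of_int_diff[of _ _ n]) (simp add: s_def)
    have e2: "ee (2 * r y) = ee (2 * s)" by (rule ee_eq_of_int_diff[of _ _ "2 * n"]) (simp add: s_def)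
    define u where "u = sin (2 * pi * s)"
    have "2 * pi * s \<le> 2 * pi * (1/2)" using s by (intro mult_left_mono) auto
    then have u: "0 \<le> u" "u \<le> 1" unfolding u_def using s by (auto intro!: sin_ge_zero)
    have "Re (ee (2 * s)) = cos (2 * (2 * pi * s))" by (simp add: ee_def mult_ac)
    also have "\<dots> = 1 - 2 * u\<^sup>2" unfolding cos_double_sin u_def ..
    finally have "Im (ee (r y)) + Re (ee (2 * r y)) / 2 = u + (1 - 2 * u\<^sup>2) / 2"
      unfolding e1 e2 by (simp add: ee_def u_def)
    moreover have "u\<^sup>2 \<le> u" using u by (simp add: power2_eq_square mult_left_le)
    ultimately show ?thesis by (simp add: diff_divide_distrib)
  qed
  have "real H * (1/2) \<le> (\<Sum>y\<in>{1..H}. Im (ee (r y)) + Re (ee (2 * r y)) / 2)"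
    using sum_mono[of "{1..H}" "\<lambda>_. 1/2" "\<lambda>y. Im (ee (r y)) + Re (ee (2 * r y)) / 2"] T by simp
  also have "\<dots> = Im (\<Sum>y\<in>{1..H}. ee (r y)) + Re (\<Sum>y\<in>{1..H}. ee (2 * r y)) / 2"
    by (simp add: sum.distrib sum_divide_distrib)
  also have "\<dots> \<le> norm (\<Sum>y\<in>{1..H}. ee (r y)) + norm (\<Sum>y\<in>{1..H}. ee (2 * r y)) / 2"
    using abs_Im_le_cmod[of "\<Sum>y\<in>{1..H}. ee (r y)"] complex_Re_le_cmod[of "\<Sum>y\<in>{1..H}. ee (2 * r y)"] by linarith
  finally show False using l1 l2 by linarith
qed

text \<open>If the integer parts of \<open>f\<close> were constant modulo \<open>d \<ge> 2\<close>, then \<open>(f(n) - c) / d\<close> modulo 1 would stay in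
  \<open>[0, 1/2]\<close>, where \<open>sin (2 \<pi> x) + cos (4 \<pi> x) / 2 \<ge> 1/2\<close>; so one of two exponential sums would be large.\<close>

lemma residues_nonconstant_local_poly:
  fixes f w :: "real \<Rightarrow> real" and P :: "real \<Rightarrow> real" and c :: int
  assumes loc: "local_poly w k \<tau> m Q" and k: "k \<ge> 1" and irr: "\<tau> \<notin> \<rat>" and d: "d \<ge> 2"
    and f: "\<And>x. f x = P x + w x"
    and per: "\<And>x h :: int. int Q dvd h \<Longrightarrow> \<exists>n::int. P (of_int (x + h)) - P (of_int x) = real d * of_int n"
    and const: "\<And>n. n \<ge> n0 \<Longrightarrow> int d dvd \<lfloor>f (real n)\<rfloor> - c"
  shows False
proof -
  obtain C where C: "weyl_const k C" using weyl_const_exists[OF k] by blast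
  define B where "B = real C * 8 ^ C"
  \<comment> \<open>\<open>B\<close> bounds the denominators that Weyl's inequality can return for
    sums of size \<open>H / 8\<close>; the factor 2 accounts for the frequency
    \<open>l \<in> {1, 2}\<close>.\<close>
  define N where "N = 2 * nat \<lfloor>B\<rfloor>"
  obtain \<kappa> where \<kappa>: "\<kappa> > 0" "\<And>q (n::int). 1 \<le> q \<Longrightarrow> q \<le> N \<Longrightarrow> \<kappa> \<le> \<bar>real q * (\<tau> / real d) - of_int n\<bar>"
    using irrational_away_from_integers[of \<tau> d N] irr d by auto
  have B0: "B \<ge> 0" unfolding B_def by simp
  \<comment> \<open>The length \<open>H\<close> is fixed before \<open>X\<close>: Weyl's error
    \<open>B / H\<close> and the error \<open>B * \<epsilon>\<close> from the leading coefficient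
    are each below half of the distance \<open>\<kappa>\<close>.\<close>
  define H where "H = nat \<lceil>2 * B / \<kappa>\<rceil> + 1"
  have H: "H \<ge> 1" "B / real H < \<kappa> / 2"
  proof -
    show "H \<ge> 1" unfolding H_def by simp
    have "2 * B / \<kappa> < real H" unfolding H_def by linarith
    then show "B / real H < \<kappa> / 2" using \<kappa> \<open>H \<ge> 1\<close> by (simp add: field_simps)
  qed
  define \<epsilon> where "\<epsilon> = min (1/64) (\<kappa> / (4 * (B + 1)))"
  have \<epsilon>: "\<epsilon> > 0" "\<epsilon> \<le> 1/64" "B * \<epsilon> < \<kappa> / 2"
  proof -
    show "\<epsilon> > 0" unfolding \<epsilon>_def using \<kappa> B0 by auto
    show "\<epsilon> \<le> 1/64" unfolding \<epsilon>_def by (rule min.cobounded1)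
    have "B * \<epsilon> \<le> B * (\<kappa> / (4 * (B + 1)))" unfolding \<epsilon>_def using B0 by (intro mult_left_mono) auto
    also have "\<dots> \<le> (B + 1) * (\<kappa> / (4 * (B + 1)))" using \<kappa> B0 by (intro mult_right_mono) auto
    also have "\<dots> = \<kappa> / 4" using B0 by (simp add: field_simps)
    also have "\<dots> < \<kappa> / 2" using \<kappa> by simp
    finally show "B * \<epsilon> < \<kappa> / 2" .
  qed
  have "\<forall>\<^sub>F X in sequentially. (\<exists>q c. 1 \<le> q \<and> Q dvd q \<and> q \<le> X \<and> \<bar>c k - \<tau>\<bar> \<le> \<epsilon> \<and>
     (\<forall>y. y ^ m \<le> X \<longrightarrow> \<bar>w (real X + real q * real y) - (\<Sum>j\<le>k. c j * real y ^ j)\<bar> \<le> \<epsilon>)) \<and> X \<ge> max n0 (H ^ m)"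
    using loc \<epsilon>(1) unfolding local_poly_def by (intro eventually_conj eventually_ge_at_top) blast
  then obtain X q b where X: "X \<ge> n0" "X \<ge> H ^ m" and q: "1 \<le> q" "Q dvd q" and b: "\<bar>b k - \<tau>\<bar> \<le> \<epsilon>"
    and app: "\<And>y. y ^ m \<le> X \<Longrightarrow> \<bar>w (real X + real q * real y) - (\<Sum>j\<le>k. b j * real y ^ j)\<bar> \<le> \<epsilon>"
    by (auto simp: eventually_sequentially)
  define r where "r = (\<lambda>y::nat. (f (real (X + q * y)) - of_int c) / real d)"
  have "\<exists>n::int. of_int n \<le> r y \<and> r y \<le> of_int n + 1/2" for y
  proof -
    have "X + q * y \<ge> n0" using X by linarith
    from const[OF this] obtain v where v: "\<lfloor>f (real (X + q * y))\<rfloor> - c = int d * v" by blast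
    define F where "F = f (real (X + q * y))"
    have fl: "of_int \<lfloor>F\<rfloor> = of_int c + real d * of_int v" using v unfolding F_def by (metis add.commute diff_add_cancel of_int_add of_int_mult of_int_of_nat_eq)
    have "F - of_int c \<ge> real d * of_int v" "F - of_int c < real d * of_int v + 1" using fl by linarith+
    moreover have "1 \<le> real d * (1/2)" using d by simp
    ultimately have "real d * of_int v \<le> F - of_int c" "F - of_int c \<le> real d * (of_int v + 1/2)" by (auto simp: distrib_left)
    then show ?thesis unfolding r_def F_def[symmetric] using d by (intro exI[of _ v]) (auto simp: field_simps)
  qed
  then obtain l where l: "l \<in> {1, 2::nat}" "real H / 4 \<le> norm (\<Sum>y\<in>{1..H}. ee (real l * r y))"
    using half_circle_sum[of H r] by blast
  define \<phi> where "\<phi> = (\<lambda>y::int. \<Sum>j\<le>k. (real l / real d * b j) * of_int y ^ j)"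
  define u where "u = real l * (P (real X) - of_int c) / real d"
  have ph: "phase k (real l / real d * b k) \<phi>" unfolding \<phi>_def by (rule phase_poly)
  \<comment> \<open>Since \<open>Q\<close> divides \<open>q\<close>, the values of \<open>P\<close>
    along the progression differ from \<open>P X\<close> by multiples of \<open>d\<close>, which
    vanish modulo 1 after division by \<open>d\<close>. What remains is the constant phase
    \<open>u\<close> and the polynomial \<open>\<phi>\<close>, with error at most
    \<open>8 * \<epsilon>\<close>.\<close>
  have near: "norm (ee (real l * r y) - ee u * ee (\<phi> (int y))) \<le> 1/8" if y: "y \<in> {1..H}" for y
  proof -
    have "y ^ m \<le> H ^ m" using y by (intro power_mono) auto
    then have "y ^ m \<le> X" using X by linarith
    from app[OF this] have a: "\<bar>w (real X + real q * real y) - (\<Sum>j\<le>k. b j * real y ^ j)\<bar> \<le> \<epsilon>" .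
    have "int Q dvd int (q * y)" using q(2) by (metis dvd_mult2 of_nat_dvd_iff)
    then obtain n :: int where n: "P (of_int (int X + int (q * y))) - P (of_int (int X)) = real d * of_int n"
      using per by blast
    define z where "z = real l / real d * w (real X + real q * real y)"
    have "real l * r y = u + z + of_int (int l * n)"
    proof -
      have "f (real (X + q * y)) = P (real X) + real d * of_int n + w (real X + real q * real y)"
        using n unfolding f by simp
      then show ?thesis unfolding r_def u_def z_def using d by (simp add: field_simps)
    qed
    then have "ee (real l * r y) = ee (u + z)" by (intro ee_eq_of_int_diff[of _ _ "int l * n"]) simp
    then have "ee (real l * r y) - ee u * ee (\<phi> (int y)) = ee u * (ee z - ee (\<phi> (int y)))"
      by (simp add: ee_add algebra_simps)
    then have "norm (ee (real l * r y) - ee u * ee (\<phi> (int y))) = norm (ee z - ee (\<phi> (int y)))" by (simp add: norm_mult)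
    also have "\<dots> \<le> 2 * pi * \<bar>z - \<phi> (int y)\<bar>" by (rule norm_ee_diff_le)
    also have "\<dots> \<le> 2 * 4 * \<epsilon>"
    proof (rule mult_mono)
      have \<phi>y: "\<phi> (int y) = real l / real d * (\<Sum>j\<le>k. b j * real y ^ j)" unfolding \<phi>_def by (simp add: sum_distrib_left mult.assoc)
      have "\<bar>z - \<phi> (int y)\<bar> = real l / real d * \<bar>w (real X + real q * real y) - (\<Sum>j\<le>k. b j * real y ^ j)\<bar>"
      proof -
        have "z - \<phi> (int y) = real l / real d * (w (real X + real q * real y) - (\<Sum>j\<le>k. b j * real y ^ j))"
          unfolding \<phi>y z_def by (rule right_diff_distrib[symmetric])
        then show ?thesis by (simp add: abs_mult)
      qed
      also have "\<dots> \<le> 1 * \<epsilon>" using l(1) d a by (intro mult_mono) auto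
      finally show "\<bar>z - \<phi> (int y)\<bar> \<le> \<epsilon>" by simp
      show "2 * pi \<le> 2 * 4" using pi_less_4 by simp
    qed auto
    also have "\<dots> \<le> 1/8" using \<epsilon> by simp
    finally show ?thesis .
  qed
  have "norm (\<Sum>y\<in>{1..H}. ee (real l * r y)) - norm (\<Sum>y\<in>{1..H}. ee u * ee (\<phi> (int y)))
      \<le> norm (\<Sum>y\<in>{1..H}. ee (real l * r y) - ee u * ee (\<phi> (int y)))"
    unfolding sum_subtractf by (rule norm_triangle_ineq2)
  also have "\<dots> \<le> real (card {1..H}) * (1/8)" by (rule sum_norm_bound[OF near])
  finally have "real H / 8 \<le> norm (\<Sum>y\<in>{1..H}. ee u * ee (\<phi> (int y)))" using l(2) by simp
  also have "\<dots> = norm (\<Sum>y\<in>{1..H}. ee (\<phi> (int y)))" by (simp add: norm_mult flip: sum_distrib_left)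
  also have "(\<Sum>y\<in>{1..H}. ee (\<phi> (int y))) = (\<Sum>y\<in>{1..<int H + 1}. ee (\<phi> y))"
  proof -
    have "{1..<int H + 1} = int ` {1..H}" by (simp add: image_int_atLeastAtMost atLeastLessThanPlusOne_atLeastAtMost_int)
    then show ?thesis by (simp add: sum.reindex)
  qed
  finally have large: "real H / 8 \<le> norm (\<Sum>y\<in>{1..<int H + 1}. ee (\<phi> y))" .
  obtain q' :: nat and n :: int where q': "1 \<le> q'" "real q' \<le> real C * 8 ^ C"
    "\<bar>real q' * (real l / real d * b k) - of_int n\<bar> \<le> real C * 8 ^ C / real H ^ k"
    by (rule weyl_constD[OF C H(1) _ _ ph large]) auto
  have "real q' \<le> B" using q' unfolding B_def by simp
  then have "q' \<le> nat \<lfloor>B\<rfloor>" by (simp add: le_nat_floor)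
  then have lq: "l * q' \<le> N" unfolding N_def using l(1) by auto
  have "1 \<le> l * q'" using l(1) q' by auto
  from \<kappa>(2)[OF this lq, of n] have "\<kappa> \<le> \<bar>real (l * q') * (\<tau> / real d) - of_int n\<bar>" .
  also have "\<dots> \<le> \<bar>real q' * (real l / real d * b k) - of_int n\<bar> + \<bar>real q' * (real l / real d) * (\<tau> - b k)\<bar>"
  proof -
    have "real (l * q') * (\<tau> / real d) - of_int n = (real q' * (real l / real d * b k) - of_int n) + real q' * (real l / real d) * (\<tau> - b k)"
      by (simp add: algebra_simps diff_divide_distrib)
    then show ?thesis using abs_triangle_ineq by metis
  qed
  also have "\<bar>real q' * (real l / real d) * (\<tau> - b k)\<bar> \<le> B * \<epsilon>"
  proof -
    have "\<bar>real q' * (real l / real d) * (\<tau> - b k)\<bar> = real q' * (real l / real d) * \<bar>\<tau> - b k\<bar>" by (simp add: abs_mult)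
    also have "\<dots> \<le> (B * 1) * \<epsilon>" using \<open>real q' \<le> B\<close> l(1) d b B0 by (intro mult_mono) (auto simp: abs_minus_commute)
    finally show ?thesis by simp
  qed
  also have "\<bar>real q' * (real l / real d * b k) - of_int n\<bar> \<le> B / real H"
  proof -
    have "real H ^ 1 \<le> real H ^ k" using H(1) k by (intro power_increasing) auto
    then have "B / real H ^ k \<le> B / real H" using H(1) B0 by (intro divide_left_mono) auto
    then show ?thesis using q'(3) unfolding B_def by linarith
  qed
  finally show False using H(2) \<epsilon>(3) by simp
qed

text \<open>Along multiples of \<open>Q\<close> the function \<open>w\<close> moves by less than 1/4
  per step, while constancy of the residue confines it, up to a constant, to intervals of length 1
  starting at multiples of \<open>d\<close>. Consecutive intervals are at least 1 apart, so
  \<open>w\<close> would be trapped in one of them, although it is unbounded.\<close>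

lemma residues_nonconstant_slow:
  fixes f w :: "real \<Rightarrow> real" and P :: "real \<Rightarrow> real" and c :: int
  assumes w: "\<forall>\<^sub>F x in at_top. (w has_real_derivative w' x) (at x)" and w0: "(w' \<longlongrightarrow> 0) at_top"
    and inf: "filterlim (\<lambda>x. \<bar>w x\<bar>) at_top at_top" and d: "d \<ge> 2" and Q: "Q \<ge> 1"
    and f: "\<And>x. f x = P x + w x"
    and per: "\<And>x h :: int. int Q dvd h \<Longrightarrow> \<exists>n::int. P (of_int (x + h)) - P (of_int x) = real d * of_int n"
    and const: "\<And>n. n \<ge> n0 \<Longrightarrow> int d dvd \<lfloor>f (real n)\<rfloor> - c"
  shows False
proof -
  have "\<forall>\<^sub>F x in at_top. \<bar>w' x\<bar> < 1 / (4 * real Q)" using w0 Q by (auto simp: tendsto_iff dist_real_def)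
  with w have "\<forall>\<^sub>F x in at_top. (w has_real_derivative w' x) (at x) \<and> \<bar>w' x\<bar> < 1 / (4 * real Q)" by eventually_elim auto
  then obtain a where a: "\<And>x. x \<ge> a \<Longrightarrow> (w has_real_derivative w' x) (at x) \<and> \<bar>w' x\<bar> < 1 / (4 * real Q)"
    by (auto simp: eventually_at_top_linorder)
  define z0 where "z0 = max n0 (nat \<lceil>a\<rceil>)"
  define g where "g = (\<lambda>z::nat. w (real (Q * z)))"
  have Qz: "Q * z \<ge> z" for z using Q by simp
  have step: "\<bar>g (Suc z) - g z\<bar> < 1/4" if z: "z \<ge> z0" for z
  proof -
    have az: "a \<le> real (Q * z)"
    proof -
      have "a \<le> real z0" unfolding z0_def by linarith
      also have "z0 \<le> Q * z" using z Qz[of z] by linarith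
      finally show ?thesis by simp
    qed
    have "\<exists>t>real (Q * z). t < real (Q * Suc z) \<and> w (real (Q * Suc z)) - w (real (Q * z)) = (real (Q * Suc z) - real (Q * z)) * w' t"
      by (rule MVT2) (use a az Q in \<open>auto intro: order_trans\<close>)
    then obtain t where t: "t > real (Q * z)" "g (Suc z) - g z = real Q * w' t"
      unfolding g_def by (auto simp: algebra_simps)
    have "\<bar>w' t\<bar> < 1 / (4 * real Q)" using a[of t] t az by linarith
    then have "real Q * \<bar>w' t\<bar> < real Q * (1 / (4 * real Q))" using Q by (intro mult_strict_left_mono) auto
    then show ?thesis unfolding t(2) using Q by (simp add: abs_mult)
  qed
  have "\<exists>v::int. real d * of_int v \<le> P 0 + g z - of_int c \<and> P 0 + g z - of_int c < real d * of_int v + 1" if z: "z \<ge> z0" for z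
  proof -
    have "Q * z \<ge> n0" using z Qz[of z] unfolding z0_def by linarith
    from const[OF this] obtain v where v: "\<lfloor>f (real (Q * z))\<rfloor> - c = int d * v" by blast
    have "int Q dvd int (Q * z)" by simp
    from per[OF this, of 0] obtain n :: int where n: "P (real (Q * z)) - P 0 = real d * of_int n" by auto
    have "of_int \<lfloor>f (real (Q * z))\<rfloor> = of_int c + real d * of_int v"
      using v by (metis add.commute diff_add_cancel of_int_add of_int_mult of_int_of_nat_eq)
    moreover have "f (real (Q * z)) = P 0 + real d * of_int n + g z" using n unfolding f g_def by simp
    ultimately have "real d * of_int v \<le> P 0 + real d * of_int n + g z - of_int c" "P 0 + real d * of_int n + g z - of_int c < real d * of_int v + 1"
      by linarith+
    then show ?thesis by (intro exI[of _ "v - n"]) (simp add: algebra_simps)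
  qed
  then obtain v :: "nat \<Rightarrow> int" where v: "\<And>z. z \<ge> z0 \<Longrightarrow> real d * of_int (v z) \<le> P 0 + g z - of_int c \<and> P 0 + g z - of_int c < real d * of_int (v z) + 1"
    by metis
  have vc: "v z = v z0" if "z \<ge> z0" for z using that
  proof (induction z rule: dec_induct)
    case (step z)
    have "\<bar>real d * of_int (v (Suc z)) - real d * of_int (v z)\<bar> < 5/4"
      using v[of z] v[of "Suc z"] \<open>\<And>z. z0 \<le> z \<Longrightarrow> \<bar>g (Suc z) - g z\<bar> < 1/4\<close>[of z] step.hyps by linarith
    \<comment> \<open>A change of \<open>v\<close> would contribute at least
      \<open>d \<ge> 2\<close>, more than the step 1/4 plus the interval length 1.\<close>
    then have "real d * \<bar>of_int (v (Suc z) - v z)\<bar> < 5/4" by (simp add: abs_mult flip: right_diff_distrib)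
    moreover have "2 * \<bar>of_int (v (Suc z) - v z) :: real\<bar> \<le> real d * \<bar>of_int (v (Suc z) - v z)\<bar>" using d by (intro mult_right_mono) auto
    ultimately have "2 * \<bar>of_int (v (Suc z) - v z) :: real\<bar> < 5/4" by (rule le_less_trans[rotated])
    moreover have "x = 0" if "2 * \<bar>real_of_int x\<bar> < 5/4" for x :: int using that by linarith
    ultimately have "v (Suc z) - v z = 0" by blast
    then show ?case using step.IH by simp
  qed simp
  define Bd where "Bd = \<bar>P 0\<bar> + \<bar>of_int c\<bar> + \<bar>real d * of_int (v z0)\<bar> + 2"
  have bd: "\<bar>g z\<bar> \<le> Bd" if "z \<ge> z0" for z
    using v[OF that] unfolding vc[OF that] Bd_def by (auto simp: abs_le_iff abs_if)
  have "\<forall>\<^sub>F x in at_top. \<bar>w x\<bar> \<ge> Bd + 1" using inf unfolding filterlim_at_top by blast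
  then obtain b where b: "\<And>x. x \<ge> b \<Longrightarrow> \<bar>w x\<bar> \<ge> Bd + 1" by (auto simp: eventually_at_top_linorder)
  define z where "z = max z0 (nat \<lceil>b\<rceil>)"
  have "b \<le> real z" unfolding z_def by linarith
  also have "real z \<le> real (Q * z)" using Qz[of z] by (simp only: of_nat_le_iff)
  finally have "\<bar>g z\<bar> \<ge> Bd + 1" unfolding g_def by (rule b)
  then show False using bd[of z] unfolding z_def by simp
qed

lemma ex_irrational_pos: "\<exists>x::real. x > 0 \<and> x \<notin> \<rat>"
proof -
  have "\<rat> \<noteq> (UNIV :: real set)" using countable_rat uncountable_UNIV_real by metis
  then obtain x :: real where x: "x \<notin> \<rat>" by blast
  then have "\<bar>x\<bar> \<notin> \<rat>" by (metis Rats_abs_iff)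
  moreover have "\<bar>x\<bar> > 0" using x by auto
  ultimately show ?thesis by blast
qed

context hardy_ring
begin

text \<open>Every outcome of the rational decomposition with \<open>j \<ge> 2\<close>, and every
  finite irrational coefficient, gives a local polynomial with irrational leading coefficient:
  multiplication by \<open>Q ^ j\<close> keeps irrationality, and in the stretched case
  \<open>\<tau>\<close> may be chosen. What is left is \<open>j = 1\<close> with derivative tending
  to 0, the slow case.\<close>

lemma residues_nonconstant:
  fixes c :: int and d n0 :: nat
  assumes U: "chain U" and lim: "(U k \<longlongrightarrow> L) at_top"
    and non_poly: "\<And>p :: rat poly. filterlim (\<lambda>x. \<bar>U 0 x - poly (map_poly of_rat p) x\<bar>) at_top at_top"
    and d: "d \<ge> 2"
  shows "\<exists>n\<ge>n0. \<not> int d dvd \<lfloor>U 0 (real n)\<rfloor> - c"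
proof (rule ccontr)
  assume "\<not> ?thesis"
  then have const: "\<And>n. n \<ge> n0 \<Longrightarrow> int d dvd \<lfloor>U 0 (real n)\<rfloor> - c" by blast
  obtain p :: "rat poly" and W j where W: "chain W" "\<And>x. W 0 x = U 0 x - poly (map_poly of_rat p) x" "j \<ge> 1"
    and cases: "(\<exists>L. L / fact j \<notin> \<rat> \<and> (W j \<longlongrightarrow> L) at_top) \<or>
     ((W j \<longlongrightarrow> 0) at_top \<and> (filterlim (W (j - 1)) at_top at_top \<or> filterlim (W (j - 1)) at_bot at_top))"
    using rational_decomposition[OF U lim non_poly] by blast
  define P where "P = (poly (map_poly of_rat p) :: real \<Rightarrow> real)"
  have f: "U 0 x = P x + W 0 x" for x unfolding W(2) P_def by simp
  obtain Q0 where Q0: "Q0 \<ge> 1"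
    "\<And>x h :: int. int (Q0 * d) dvd h \<Longrightarrow> \<exists>n::int. P (of_int (x + h)) - P (of_int x) = real d * of_int n"
    using rat_poly_periodic[of p d] unfolding P_def by blast
  \<comment> \<open>A period of the rational polynomial modulo \<open>d\<close>; the progressions
    are required to have steps divisible by it.\<close>
  define Q where "Q = Q0 * d"
  have Q: "Q \<ge> 1" unfolding Q_def using Q0 d by (simp add: Suc_le_eq)
  note per = Q0(2)[folded Q_def]
  have noloc: "\<not> local_poly (W 0) j \<tau> m Q" if "\<tau> \<notin> \<rat>" for \<tau> m
    using residues_nonconstant_local_poly[OF _ W(3) that d f per const] by blast
  from cases show False
  proof (elim disjE exE conjE)
    fix L' assume L': "L' / fact j \<notin> \<rat>" "(W j \<longlongrightarrow> L') at_top"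
    have "L' / fact j * real Q ^ j \<notin> \<rat>"
    proof
      assume "L' / fact j * real Q ^ j \<in> \<rat>"
      then have "L' / fact j * real Q ^ j / real Q ^ j \<in> \<rat>" by (intro Rats_divide) auto
      then show False using L' Q by simp
    qed
    then show False using local_poly_finite_limit[OF W(1) L'(2) Q] noloc by blast
  next
    obtain \<tau> :: real where \<tau>: "\<tau> > 0" "\<tau> \<notin> \<rat>" using ex_irrational_pos by blast
    assume W0: "(W j \<longlongrightarrow> 0) at_top"
    have slow: False if "j = 1" "filterlim (\<lambda>x. \<bar>W 0 x\<bar>) at_top at_top"
      using residues_nonconstant_slow[OF chainD(2)[OF W(1), of 0] _ that(2) d Q f per const] W0 that by simp
    {
      assume top: "filterlim (W (j - 1)) at_top at_top"
      show False
      proof (cases "j = 1")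
        case True
        then show ?thesis using slow top filterlim_compose[OF filterlim_abs_real top] by simp
      next
        case False
        then have "j \<ge> 2" using W(3) by simp
        from local_poly_infinite_limit[OF W(1) this W0 top Q \<tau>(1)] noloc \<tau> show ?thesis by blast
      qed
    next
      assume "filterlim (W (j - 1)) at_bot at_top"
      then have top: "filterlim (\<lambda>x. - W (j - 1) x) at_top at_top" by (simp add: filterlim_uminus_at_bot)
      show False
      proof (cases "j = 1")
        case True
        then show ?thesis using slow filterlim_compose[OF filterlim_abs_real top] by simp
      next
        case False
        then have "j \<ge> 2" using W(3) by simp
        moreover have "((\<lambda>x. - W j x) \<longlongrightarrow> 0) at_top" using tendsto_minus[OF W0] by simp
        ultimately have "local_poly (\<lambda>x. - W 0 x) j \<tau> (8 * Suc j) Q"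
          using local_poly_infinite_limit[OF chain_uminus[OF W(1)] _ _ top Q \<tau>(1)] by blast
        then have "local_poly (W 0) j (- \<tau>) (8 * Suc j) Q" by (rule local_poly_uminus)
        moreover have "- \<tau> \<notin> \<rat>" using \<tau> by (simp add: Rats_minus_iff)
        ultimately show ?thesis using noloc by blast
      qed
    }
  qed
qed

end

section \<open>Asymptotic bases\<close>

text \<open>Eventually \<open>f\<close> increases by less than 1 from one integer to the next, so
  its integer parts skip no large value and one summand suffices.\<close>

lemma asymptotic_basis_of_slow_growth:
  fixes f :: "real \<Rightarrow> real"
  assumes f: "\<forall>\<^sub>F x in at_top. (f has_real_derivative f' x) (at x)" and f0: "(f' \<longlongrightarrow> 0) at_top"
    and lim: "filterlim f at_top at_top"
  shows "asymptotic_basis (\<lambda>n. \<lfloor>f (real n)\<rfloor>)"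
proof -
  have "\<forall>\<^sub>F x in at_top. \<bar>f' x\<bar> < 1" using f0 by (auto simp: tendsto_iff dist_real_def)
  with f have "\<forall>\<^sub>F x in at_top. (f has_real_derivative f' x) (at x) \<and> \<bar>f' x\<bar> < 1" by eventually_elim auto
  then obtain a where a: "\<And>x. x \<ge> a \<Longrightarrow> (f has_real_derivative f' x) (at x) \<and> \<bar>f' x\<bar> < 1"
    by (auto simp: eventually_at_top_linorder)
  define n1 where "n1 = nat \<lceil>a\<rceil>"
  have step: "f (real (Suc n)) < f (real n) + 1" if "n \<ge> n1" for n
  proof -
    have an: "a \<le> real n" using that unfolding n1_def by linarith
    have "\<exists>t>real n. t < real (Suc n) \<and> f (real (Suc n)) - f (real n) = (real (Suc n) - real n) * f' t"
      by (rule MVT2) (use a an in \<open>auto intro: order_trans\<close>)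
    then obtain t where "t > real n" "f (real (Suc n)) - f (real n) = f' t" by auto
    then show ?thesis using a[of t] an by (simp add: abs_less_iff)
  qed
  define N0 where "N0 = max 1 \<lceil>f (real n1)\<rceil>"
  have "\<exists>n\<ge>1. \<lfloor>f (real n)\<rfloor> = N" if N: "N > N0" for N
  proof -
    have "\<forall>\<^sub>F x in at_top. f x \<ge> of_int N" using lim unfolding filterlim_at_top by blast
    then have "\<forall>\<^sub>F n in sequentially. f (real n) \<ge> of_int N" using filterlim_real_sequentially by (rule eventually_compose_filterlim)
    then obtain b where b: "\<And>n. n \<ge> b \<Longrightarrow> f (real n) \<ge> of_int N" by (auto simp: eventually_sequentially)
    define S where "S = {n. n \<ge> n1 \<and> f (real n) < of_int N}"
    have "S \<subseteq> {..<b}" unfolding S_def using b by (auto simp: not_le[symmetric])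
    then have finS: "finite S" using finite_subset by blast
    have "f (real n1) < of_int N" using N unfolding N0_def by linarith
    then have "n1 \<in> S" unfolding S_def by simp
    then have n: "Max S \<in> S" using finS by (intro Max_in) auto
    have "Suc (Max S) \<notin> S" using Max_ge[OF finS, of "Suc (Max S)"] by auto
    then have "f (real (Suc (Max S))) \<ge> of_int N" using n unfolding S_def by auto
    moreover have "f (real (Suc (Max S))) < of_int N + 1" using step[of "Max S"] n unfolding S_def by auto
    ultimately have "\<lfloor>f (real (Suc (Max S)))\<rfloor> = N" by (intro floor_unique) auto
    then show ?thesis by (intro exI[of _ "Suc (Max S)"]) auto
  qed
  then have "\<exists>n :: nat \<Rightarrow> nat. (\<forall>i\<in>{1..1}. n i \<ge> 1) \<and> (\<Sum>i=1..1::nat. \<lfloor>f (real (n i))\<rfloor>) = N" if "N > N0" for N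
  proof -
    assume *: "\<And>N. N > N0 \<Longrightarrow> \<exists>n\<ge>1. \<lfloor>f (real n)\<rfloor> = N"
    obtain n where "n \<ge> 1" "\<lfloor>f (real n)\<rfloor> = N" using *[OF \<open>N > N0\<close>] by blast
    then show ?thesis by (intro exI[of _ "\<lambda>_. n"]) auto
  qed
  moreover have "N0 \<ge> 1" by (simp add: N0_def)
  ultimately show ?thesis unfolding asymptotic_basis_def by blast
qed

text \<open>Beyond a suitable \<open>n0\<close> the function is increasing, at least 1 and satisfies
  the gap bound. The translated set \<open>A\<close> of its integer parts then meets both
  requirements of \<open>basis_of_positive_density\<close>: density from the local sets and the
  greedy step, absence of a common divisor from \<open>residues_nonconstant\<close>.\<close>

lemma (in hardy_ring) asymptotic_basis_of_local_poly:
  assumes U: "chain U" and lim: "filterlim (U 0) at_top at_top"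
    and growth: "\<And>x. x \<ge> 1 \<Longrightarrow> \<bar>U 0 x\<bar> \<le> K * (\<bar>x\<bar> + 1) ^ D" and K: "K > 0"
    and growth': "\<forall>\<^sub>F x in at_top. \<bar>U 0 x\<bar> \<le> K' * x ^ D"
    and non_poly: "\<And>p :: rat poly. filterlim (\<lambda>x. \<bar>U 0 x - poly (map_poly of_rat p) x\<bar>) at_top at_top"
    and loc: "local_poly (U 0) k \<tau> m 1" and k: "k \<ge> 1" and m: "m \<ge> 1" and \<tau>: "\<tau> \<noteq> 0"
  shows "asymptotic_basis (\<lambda>n. \<lfloor>U 0 (real n)\<rfloor>)"
proof -
  define f where "f = U 0"
  have f: "\<forall>\<^sub>F x in at_top. (f has_real_derivative U (Suc 0) x) (at x)"
    using chainD(2)[OF U, of 0] unfolding f_def .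
  have "\<forall>\<^sub>F x in at_top. U (Suc 0) x > 0"
    using deriv_pos_of_at_top[OF f R_signed[OF chainD(1)[OF U]]] lim unfolding f_def by blast
  then have "\<forall>\<^sub>F x in at_top. U (Suc 0) x \<ge> 0" by eventually_elim simp
  then obtain a where a: "\<And>x y. a \<le> x \<Longrightarrow> x \<le> y \<Longrightarrow> f x \<le> f y" by (rule ev_deriv_nonneg_mono[OF f]) blast
  have "\<forall>\<^sub>F x in at_top. f x \<ge> 1" using lim unfolding f_def filterlim_at_top by blast
  with gap_bound[OF U lim growth'] have "\<forall>\<^sub>F x in at_top. f x \<ge> 1 \<and> f (x + 1) powr (1 / real (Suc D)) \<le> f x powr (1 / real (Suc D)) + 1"
    unfolding f_def by eventually_elim simp
  then obtain b where b: "\<And>x. x \<ge> b \<Longrightarrow> f x \<ge> 1 \<and> f (x + 1) powr (1 / real (Suc D)) \<le> f x powr (1 / real (Suc D)) + 1"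
    by (auto simp: eventually_at_top_linorder)
  define n0 where "n0 = max 1 (nat \<lceil>max a b\<rceil>)"
  have n0: "real n \<ge> a" "real n \<ge> b" "n \<ge> 1" if "n \<ge> n0" for n
  proof -
    have "max a b \<le> real (nat \<lceil>max a b\<rceil>)" by (rule real_nat_ceiling_ge)
    also have "\<dots> \<le> real n" using that unfolding n0_def by simp
    finally show "real n \<ge> a" "real n \<ge> b" by auto
    show "n \<ge> 1" using that unfolding n0_def by simp
  qed
  define c0 where "c0 = \<lfloor>f (real n0)\<rfloor>"
  define A where "A = {nat (\<lfloor>f (real n)\<rfloor> - \<lfloor>f (real n0)\<rfloor>) | n. n \<ge> n0}"
  have mono: "f (real n0) \<le> f (real n)" if "n \<ge> n0" for n using a n0(1)[of n0] that by simp
  have f1: "f (real n) \<ge> 1" if "n \<ge> n0" for n using b n0(2)[OF that] by blast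
  have gap: "f (real (Suc n)) powr (1 / real (Suc D)) \<le> f (real n) powr (1 / real (Suc D)) + 1" if "n \<ge> n0" for n
    using b[OF n0(2)[OF that]] by (simp add: add.commute)
  have A0: "0 \<in> A" unfolding A_def by auto
  have c0: "c0 \<ge> 1" unfolding c0_def using f1[of n0] by simp
  obtain Kg where Kg: "Kg \<ge> 0" "\<And>m. \<exists>a\<in>A. a \<le> m \<and> real (m - a) \<le> Kg * (real m + 1) powr (1 - 1 / real (Suc D))"
    using greedy_step[of n0 f "Suc D"] f1 gap lim mono unfolding A_def f_def by auto
  have f00: "f (real n0) \<ge> 0" using f1[of n0] by simp
  have loc': "local_poly f k \<tau> m 1" using loc unfolding f_def .
  have growth'': "\<And>x. x \<ge> 1 \<Longrightarrow> \<bar>f x\<bar> \<le> K * (\<bar>x\<bar> + 1) ^ D" using growth unfolding f_def .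
  obtain s \<delta> L1 K2 M where \<delta>: "\<delta> > 0" and sets:
    "\<forall>\<^sub>F Z in sequentially. \<exists>E e0. E \<subseteq> sums_of s A \<and> E \<subseteq> {e0..e0 + L1 * Z ^ k} \<and> \<delta> * real Z ^ k \<le> real (card E)
       \<and> real (e0 + L1 * Z ^ k) \<le> K2 * real Z ^ M"
    by (rule local_sets_of_local_poly[OF mono f00 loc' k m \<tau> growth'' K, folded A_def])
  obtain r \<delta>' N0 where dens: "\<delta>' > 0" "\<And>N. N \<ge> N0 \<Longrightarrow> \<delta>' * real N \<le> real (card (sums_of r A \<inter> {0..N}))"
    by (rule density_of_local_sets[OF A0 _ _ Kg k \<delta> sets]) (auto simp: field_simps)
  have fin: "\<exists>L. (U (Suc D) \<longlongrightarrow> L) at_top" by (rule finite_limit_exists[OF U growth'])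
  have gcd: "\<exists>a\<in>A. \<not> d dvd a" if d2: "d \<ge> 2" for d
  proof -
    obtain L where "(U (Suc D) \<longlongrightarrow> L) at_top" using fin by blast
    then obtain n where n: "n \<ge> n0" "\<not> int d dvd \<lfloor>f (real n)\<rfloor> - c0"
      using residues_nonconstant[OF U _ non_poly d2, of "Suc D" L n0 c0] unfolding f_def by blast
    have "\<lfloor>f (real n)\<rfloor> \<ge> c0" unfolding c0_def using mono[OF n(1)] by (rule floor_mono)
    then have "int (nat (\<lfloor>f (real n)\<rfloor> - c0)) = \<lfloor>f (real n)\<rfloor> - c0" by simp
    then have "\<not> d dvd nat (\<lfloor>f (real n)\<rfloor> - c0)" using n(2) by (metis int_dvd_int_iff)
    then show ?thesis unfolding A_def c0_def using n(1) by blast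
  qed
  obtain h M' where h: "h \<ge> 1" "\<And>N. N \<ge> M' \<Longrightarrow> N \<in> sums_of h A"
    using basis_of_positive_density[OF A0 gcd dens] by metis
  \<comment> \<open>Every representation uses exactly \<open>h\<close> elements of \<open>A\<close>,
    so undoing the translation adds \<open>h * c0\<close> in all cases.\<close>
  have "\<exists>n :: nat \<Rightarrow> nat. (\<forall>i\<in>{1..h}. n i \<ge> 1) \<and> (\<Sum>i=1..h. \<lfloor>f (real (n i))\<rfloor>) = N"
    if N: "N > int M' + int h * c0" for N
  proof -
    have "nat (N - int h * c0) \<ge> M'" using N by linarith
    then obtain xs where xs: "nat (N - int h * c0) = sum_list xs" "length xs = h" "set xs \<subseteq> A"
      using h(2) unfolding sums_of_def by blast
    have "\<exists>n. n \<ge> n0 \<and> xs ! i = nat (\<lfloor>f (real n)\<rfloor> - c0)" if "i < h" for i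
    proof -
      have "xs ! i \<in> A" using xs that nth_mem by blast
      then show ?thesis unfolding A_def c0_def by blast
    qed
    then obtain g where g: "\<And>i. i < h \<Longrightarrow> g i \<ge> n0 \<and> xs ! i = nat (\<lfloor>f (real (g i))\<rfloor> - c0)" by metis
    have fg: "\<lfloor>f (real (g i))\<rfloor> = int (xs ! i) + c0" if "i < h" for i
    proof -
      have "\<lfloor>f (real (g i))\<rfloor> \<ge> c0" unfolding c0_def using mono g[OF that] by (intro floor_mono) auto
      then show ?thesis using g[OF that] by simp
    qed
    have "(\<Sum>i=1..h. \<lfloor>f (real (g (i - 1)))\<rfloor>) = (\<Sum>i<h. \<lfloor>f (real (g i))\<rfloor>)"
      by (simp add: sum.atLeast1_atMost_eq)
    also have "\<dots> = (\<Sum>i<h. int (xs ! i) + c0)" using fg by (intro sum.cong) auto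
    also have "\<dots> = int (sum_list xs) + int h * c0"
      by (simp add: sum.distrib sum_list_sum_nth xs(2) atLeast0LessThan)
    also have "\<dots> = N" unfolding xs(1)[symmetric] using N by simp
    finally have "(\<Sum>i=1..h. \<lfloor>f (real (g (i - 1)))\<rfloor>) = N" .
    moreover have "\<forall>i\<in>{1..h}. g (i - 1) \<ge> 1"
    proof
      fix i assume "i \<in> {1..h}"
      then have "i - 1 < h" by auto
      then show "g (i - 1) \<ge> 1" using g n0(3) by blast
    qed
    ultimately show ?thesis by (intro exI[of _ "\<lambda>i. g (i - 1)"]) auto
  qed
  moreover have "int M' + int h * c0 \<ge> 1" 
  proof -
    have "1 * 1 \<le> int h * c0" using h(1) c0 by (intro mult_mono) auto
    then show ?thesis by linarith
  qed
  ultimately show ?thesis unfolding asymptotic_basis_def f_def using h(1)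
    by (intro exI[of _ h] conjI exI[of _ "int M' + int h * c0"]) auto
qed

theorem theorem1:
  fixes f :: "real \<Rightarrow> real"
  assumes hardy: "\<exists>H. hardy_field H \<and> germ_of f \<in> H"
    and lim: "filterlim f at_top at_top"
    and growth: "\<exists>k::nat. k \<ge> 1 \<and> (\<exists>K>0. \<forall>x\<ge>1. \<bar>f x\<bar> \<le> K * (\<bar>x\<bar> + 1) ^ k)"
    and non_poly: "\<forall>g :: rat poly.
      filterlim (\<lambda>x. \<bar>f x - poly (map_poly of_rat g) x\<bar>) at_top at_top"
  shows "asymptotic_basis (\<lambda>n. \<lfloor>f (real n)\<rfloor>)"
proof -
  obtain R where R: "hardy_ring R" "f \<in> R" using hardy hardy_field_in_hardy_ring by blast
  interpret hardy_ring R by (rule R(1))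
  obtain U where U: "chain U" "U 0 = f" using chain_exists[OF R(2)] by blast
  obtain D K where DK: "K > 0" "\<And>x. x \<ge> 1 \<Longrightarrow> \<bar>f x\<bar> \<le> K * (\<bar>x\<bar> + 1) ^ D" using growth by blast
  have growth': "\<forall>\<^sub>F x in at_top. \<bar>U 0 x\<bar> \<le> (K * 2 ^ D) * x ^ D"
    using eventually_ge_at_top[of 1]
  proof eventually_elim
    case (elim x)
    have "(\<bar>x\<bar> + 1) ^ D \<le> (2 * x) ^ D" using elim by (intro power_mono) auto
    then have "K * (\<bar>x\<bar> + 1) ^ D \<le> K * (2 * x) ^ D" using DK(1) by (intro mult_left_mono) auto
    then show ?case using DK(2)[OF elim] unfolding U(2) by (simp add: power_mult_distrib mult.assoc)
  qed
  obtain L where L: "(U (Suc D) \<longlongrightarrow> L) at_top" using finite_limit_exists[OF U(1) growth'] by blast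
  have inf: "filterlim (\<lambda>x. \<bar>U 0 x\<bar>) at_top at_top"
    unfolding U(2) by (rule filterlim_compose[OF filterlim_abs_real lim])
  have main: "asymptotic_basis (\<lambda>n. \<lfloor>f (real n)\<rfloor>)"
    if "local_poly f k \<tau> (8 * Suc k) 1" "k \<ge> 1" "\<tau> \<noteq> 0" for k \<tau>
    using asymptotic_basis_of_local_poly[OF U(1), unfolded U(2), OF lim DK(2) DK(1) growth'[unfolded U(2)] non_poly[rule_format] that(1,2) _ that(3)]
    by simp
  obtain k where k: "k \<ge> 1" and cases: "(\<exists>L. L \<noteq> 0 \<and> (U k \<longlongrightarrow> L) at_top) \<or>
    ((U k \<longlongrightarrow> 0) at_top \<and> (filterlim (U (k - 1)) at_top at_top \<or> filterlim (U (k - 1)) at_bot at_top))"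
    using type_decomposition[OF U(1) L inf] by blast
  from cases show ?thesis
  proof (elim disjE exE conjE)
    fix L' assume "L' \<noteq> 0" "(U k \<longlongrightarrow> L') at_top"
    then show ?thesis using main[OF _ k] local_poly_finite_limit[OF U(1), of k L' 1] U(2) by simp
  next
    assume U0: "(U k \<longlongrightarrow> 0) at_top" and top: "filterlim (U (k - 1)) at_top at_top"
    show ?thesis
    proof (cases "k = 1")
      case True
      then show ?thesis using asymptotic_basis_of_slow_growth[OF chainD(2)[OF U(1), of 0, unfolded U(2)] _ lim] U0 by simp
    next
      case False
      then show ?thesis using main[OF _ k, of 1] local_poly_infinite_limit[OF U(1) _ U0 top, of 1 1] k U(2) by simp
    qed
  next
    \<comment> \<open>Treated by symmetry: the local approximation is obtained for
      \<open>- f\<close> with leading coefficient 1 and negated afterwards, which is why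
      \<open>main\<close> admits negative \<open>\<tau>\<close>.\<close>
    assume U0: "(U k \<longlongrightarrow> 0) at_top" and bot: "filterlim (U (k - 1)) at_bot at_top"
    then have top: "filterlim (\<lambda>x. - U (k - 1) x) at_top at_top" by (simp add: filterlim_uminus_at_bot)
    show ?thesis
    proof (cases "k = 1")
      case True
      then show ?thesis using asymptotic_basis_of_slow_growth[OF chainD(2)[OF U(1), of 0, unfolded U(2)] _ lim] U0 by simp
    next
      case False
      have "((\<lambda>x. - U k x) \<longlongrightarrow> 0) at_top" using tendsto_minus[OF U0] by simp
      then have "local_poly (\<lambda>x. - f x) k 1 (8 * Suc k) 1"
        using local_poly_infinite_limit[OF chain_uminus[OF U(1)] _ _ top, of 1 1] k False U(2) by simp
      then show ?thesis using main[OF local_poly_uminus k] by simp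
    qed
  qed
qed

end
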